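(* There are explicit pseudorandom generators $G:\{-1,+1\}^s\to\{-1,+1\}^n$ that fool any halfspace $h:\{-1,+1\}^n\to\{-1,+1\}$ with error $\epsilon$, i.e. every halfspace $h$ satisfies $$\bigl|\mathbf E_{x\in\{-1,+1\}^s}[h(G(x))]-\mathbf E_{x\in\{-1,+1\}^n}[h(x)]\bigr|\le\epsilon,$$ and that have seed length $$s=O\bigl(\log n\cdot\log^2(1/\epsilon)/\epsilon^2\bigr).$$ Such generators are obtained by taking standard explicit constructions of $k$-wise independent distributions over $\{-1,+1\}^n$, which have seed length $O(k\cdot\log n)$, with $k=O(\log^2(1/\epsilon)/\epsilon^2)$.
   Context: $\mathrm{sign}(t)=+1$ for $t\ge 0$ and $\mathrm{sign}(t)=-1$ for $t<0$. A halfspace is a function $h:\{-1,+1\}^n\to\{-1,+1\}$ of the form $h(x)=\mathrm{sign}(w_1x_1+\dots+w_nx_n-\theta)$ with arbitrary real weights $w_1,\dots,w_n$ and arbitrary real threshold $\theta$. A distribution on $\{-1,+1\}^n$ is $k$-wise independent if its projection on any $k$ indices is uniformly distributed over $\{-1,+1\}^k$. The expectations are over uniformly random $x$ in the indicated sets. The seed length of a generator $G:\{-1,+1\}^s\to\{-1,+1\}^n$ is $s$; a construction of a distribution with seed length $s$ generates it as the output of such a map on a uniformly random input from $\{-1,+1\}^s$. "Explicit" is used in its usual informal sense in pseudorandomness. *)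

theory Defs
  imports "HOL-Probability.Probability"
begin

section \<open>Halfspaces and bounded independence on the sign cube\<close>

definition signs :: "nat set \<Rightarrow> (nat \<Rightarrow> real) set" where
  "signs I = I \<rightarrow>\<^sub>E {-1, 1}"

abbreviation cube :: "nat \<Rightarrow> (nat \<Rightarrow> real) set" where
  "cube n \<equiv> signs {..<n}"

text \<open>Unlike \<^const>\<open>sgn\<close>, the sign of \<open>0\<close> is \<open>1\<close>.\<close>

definition sign_pm :: "real \<Rightarrow> real" where
  "sign_pm t = (if t \<ge> 0 then 1 else -1)"

definition halfspace :: "nat \<Rightarrow> ((nat \<Rightarrow> real) \<Rightarrow> real) \<Rightarrow> bool" where
  "halfspace n h \<longleftrightarrow>
     (\<exists>(w :: nat \<Rightarrow> real) \<theta>. \<forall>x\<in>cube n. h x = sign_pm ((\<Sum>i<n. w i * x i) - \<theta>))"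

text \<open>For \<open>k > n\<close> the condition reads: uniform on the whole cube. Requiring \<open>card S = k\<close>
  instead would make it vacuous in that case.\<close>

definition kwise_independent :: "nat \<Rightarrow> nat \<Rightarrow> (nat \<Rightarrow> real) pmf \<Rightarrow> bool" where
  "kwise_independent n k D \<longleftrightarrow>
     set_pmf D \<subseteq> cube n \<and>
     (\<forall>S \<subseteq> {..<n}. card S = min k n \<longrightarrow>
        map_pmf (\<lambda>x. restrict x S) D = pmf_of_set (signs S))"

definition fools_halfspaces ::
    "nat \<Rightarrow> nat \<Rightarrow> ((nat \<Rightarrow> real) \<Rightarrow> (nat \<Rightarrow> real)) \<Rightarrow> real \<Rightarrow> bool" where
  "fools_halfspaces n s G \<epsilon> \<longleftrightarrow>
     G \<in> cube s \<rightarrow> cube n \<and>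
     (\<forall>h. halfspace n h \<longrightarrow>
        \<bar>measure_pmf.expectation (pmf_of_set (cube s)) (\<lambda>x. h (G x))
         - measure_pmf.expectation (pmf_of_set (cube n)) h\<bar> \<le> \<epsilon>)"

section \<open>Explicitness\<close>

text \<open>
  Explicit means computable, uniformly in all parameters, in deterministic polynomial time.
  The machine is a random access machine with structured control flow and unit cost per
  operation. It has registers and a separate, indirectly addressed memory, both holding natural
  numbers. There is no multiplication, so the largest value at most doubles in a step (up to
  the constants occurring in the program); hence \<open>t\<close> steps can be simulated by a Turing machine
  in time polynomial in \<open>t\<close> and the size of the input.
\<close>

datatype ram =
    Const nat nat
  | Add nat nat nat
  | Sub nat nat nat
  | Load nat nat
  | Store nat nat
  | Seq ram ram
  | IfNZ nat ram ram
  | WhileNZ nat ram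

type_synonym ram_state = "(nat \<Rightarrow> nat) \<times> (nat \<Rightarrow> nat)"

text \<open>\<open>runs P \<sigma> t \<sigma>'\<close>: started in \<open>\<sigma>\<close> (registers, memory), \<open>P\<close> terminates after \<open>t\<close> steps
  in \<open>\<sigma>'\<close>.\<close>

inductive runs :: "ram \<Rightarrow> ram_state \<Rightarrow> nat \<Rightarrow> ram_state \<Rightarrow> bool" where
  Const: "runs (Const d c) (r, m) 1 (r(d := c), m)"
| Add: "runs (Add d a b) (r, m) 1 (r(d := r a + r b), m)"
| Sub: "runs (Sub d a b) (r, m) 1 (r(d := r a - r b), m)"
| Load: "runs (Load d a) (r, m) 1 (r(d := m (r a)), m)"
| Store: "runs (Store a b) (r, m) 1 (r, m(r a := r b))"
| Seq: "runs P \<sigma> t \<sigma>' \<Longrightarrow> runs Q \<sigma>' u \<sigma>'' \<Longrightarrow> runs (Seq P Q) \<sigma> (t + u) \<sigma>''"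
| If_nonzero: "r a \<noteq> 0 \<Longrightarrow> runs P (r, m) t \<sigma> \<Longrightarrow> runs (IfNZ a P Q) (r, m) (Suc t) \<sigma>"
| If_zero: "r a = 0 \<Longrightarrow> runs Q (r, m) t \<sigma> \<Longrightarrow> runs (IfNZ a P Q) (r, m) (Suc t) \<sigma>"
| While_zero: "r a = 0 \<Longrightarrow> runs (WhileNZ a P) (r, m) 1 (r, m)"
| While_nonzero: "r a \<noteq> 0 \<Longrightarrow> runs P (r, m) t \<sigma> \<Longrightarrow> runs (WhileNZ a P) \<sigma> u \<sigma>' \<Longrightarrow>
    runs (WhileNZ a P) (r, m) (Suc (t + u)) \<sigma>'"

definition bit_of_sign :: "real \<Rightarrow> nat" where
  "bit_of_sign b = (if b = 1 then 0 else 1)"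

definition ram_input :: "nat \<Rightarrow> nat \<Rightarrow> nat \<Rightarrow> (nat \<Rightarrow> real) \<Rightarrow> ram_state" where
  "ram_input n k s x =
     ((\<lambda>_. 0)(0 := n, 1 := k), \<lambda>j. if j < s then bit_of_sign (x j) else 0)"

text \<open>
  \<open>seed n k\<close> and \<open>G n k\<close> are the seed length and the map of the generator with parameters
  \<open>n\<close>, \<open>k\<close>. One program, given \<open>n\<close>, \<open>k\<close> and a seed \<open>x\<close>, leaves \<open>seed n k\<close> in register \<open>0\<close> and
  \<open>G n k x\<close> in memory, in time polynomial in \<open>n\<close> and \<open>k\<close>. The all-zero memory encodes a valid
  seed, so the seed length itself can be computed without knowing it in advance.
\<close>

definition explicit_generator ::
    "(nat \<Rightarrow> nat \<Rightarrow> nat) \<Rightarrow> (nat \<Rightarrow> nat \<Rightarrow> (nat \<Rightarrow> real) \<Rightarrow> (nat \<Rightarrow> real)) \<Rightarrow> bool" where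
  "explicit_generator seed G \<longleftrightarrow>
     (\<forall>n k. G n k \<in> cube (seed n k) \<rightarrow> cube n) \<and>
     (\<exists>P c d. \<forall>n k. \<forall>x\<in>cube (seed n k). \<exists>t r m.
        runs P (ram_input n k (seed n k) x) t (r, m) \<and>
        t \<le> c * (n + k + 1) ^ d \<and>
        r 0 = seed n k \<and>
        (\<forall>i<n. m i = bit_of_sign (G n k x i)))"

text \<open>An explicit construction of \<open>k\<close>-wise independent distributions with seed length
  \<open>O(k log n)\<close>.\<close>

definition explicit_kwise_construction ::
    "(nat \<Rightarrow> nat \<Rightarrow> nat) \<Rightarrow> (nat \<Rightarrow> nat \<Rightarrow> (nat \<Rightarrow> real) \<Rightarrow> (nat \<Rightarrow> real)) \<Rightarrow> bool" where
  "explicit_kwise_construction seed G \<longleftrightarrow>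
     explicit_generator seed G \<and>
     (\<forall>n\<ge>2. \<forall>k\<ge>1. kwise_independent n k (map_pmf (G n k) (pmf_of_set (cube (seed n k))))) \<and>
     (\<exists>c. \<forall>n\<ge>2. \<forall>k\<ge>1. real (seed n k) \<le> c * (real k * ln (real n)))"

end

(* A halfspace is determined by S = sum of w_i x_i, and the moments of S of order at most k agree
   under a k-wise independent and under a uniform input. If the weights are regular (no weight
   exceeds e times their l2-norm, normalised to 1), Taylor expansion makes E cos(aS + b) agree up
   to exp(-k) for all frequencies a <= c sqrt k. The sign function is approximated by the integral
   of a Fejer kernel, a finite trigonometric sum with frequencies up to T = 2 ln(1/e) / e plus a
   linear term; the error of the approximation is dominated by Fejer kernels of lower order, whose
   expectation is small because |E exp(iaS)| <= exp(-a^2/8) for a <= 1/e. Arbitrary weights are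
   reduced to this case by removing weights one at a time: either after at most L = O(ln^2(1/e) / e^2)
   steps the rest is regular, and one conditions on the removed coordinates, or the l2-norm of the
   rest decays so fast that O(log(1/e)) of the removed weights are superdecreasing; then the removed
   coordinates alone decide the halfspace with probability 1 - O(e).

   For the construction, let f be a polynomial over GF(2) of degree e = O(log n) such that x^r - 1 is
   a unit modulo f for 0 < r < n. Reading the seed as a polynomial C of degree < k over GF(2)[x]/(f),
   the i-th output is a fixed linear functional of C(x^i); the differences x^i - x^j are units, so
   Lagrange interpolation makes any k outputs independent. A suitable f exists because GF(2^d) has
   elements of order at least n as soon as 2^d > n^2, and it is found by exhaustive search. *)

theory Submission
  imports Defs "HOL-Algebra.Algebraic_Closure_Type" "HOL-Library.Z2"
begin

section \<open>The Fejer kernel\<close>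

text \<open>Every estimate for the sign is a pointwise domination by nonnegative trigonometric sums
  and a multiple of S^2, so it can be integrated under any k-wise independent weights. The uniform
  distribution is just one more such weight: both expectations are compared with the expectation of
  the same trigonometric sum, and Fejer kernels do the work of an anticoncentration theorem for S.
  The two logarithms in k have one source. The harmonic sum over the dominating kernels costs a
  factor ln(1/e), so the frequencies have to reach ln(1/e) / e instead of 1 / e, and a Taylor
  expansion of a cosine of frequency a needs k of order a^2. The argument is scaled by M = 1 / sqrt
  e, so that leaving the first period has probability O(1 / M^2) = O(e). The generator is defined as
  the output of the program. Explicitness then asks for little more than a time bound, whereas
  independence needs a closed form of the output that is the same for all seeds.\<close>

definition fejer :: "nat \<Rightarrow> real \<Rightarrow> real" where
  "fejer m y = 1 + 2 * (\<Sum>j=1..<m. (1 - real j / real m) * cos (real j * y))"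

text \<open>The antiderivative of the kernel that vanishes at 0: a smoothed staircase that rises by
  \<open>2 * pi\<close> per period, mostly near the multiples of \<open>2 * pi\<close>. Between
  \<open>- pi\<close> and \<open>pi\<close> it is therefore close to \<open>pi\<close> times the
  sign.\<close>

definition fejer_int :: "nat \<Rightarrow> real \<Rightarrow> real" where
  "fejer_int m y = y + 2 * (\<Sum>j=1..<m. (1 - real j / real m) / real j * sin (real j * y))"

text \<open>Each cosine times \<open>2 * sin (y / 2)\<close> is a difference of two sines, so the
  sum telescopes.\<close>

lemma dirichlet_kernel:
  "(1 + 2 * (\<Sum>j=1..<Suc m. cos (real j * y))) * sin (y / 2) = sin ((real m + 1/2) * y)"
proof (induction m)
  case (Suc m)
  have "2 * cos ((real m + 1) * y) * sin (y / 2) = sin ((real m + 1) * y + y / 2) - sin ((real m + 1) * y - y / 2)"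
    by (simp add: sin_add sin_diff)
  also have "\<dots> = sin ((real (Suc m) + 1/2) * y) - sin ((real m + 1/2) * y)"
    by (simp add: algebra_simps)
  finally have "2 * cos ((real m + 1) * y) * sin (y / 2) =
    sin ((real (Suc m) + 1/2) * y) - sin ((real m + 1/2) * y)" .
  moreover have "(1 + 2 * (\<Sum>j=1..<Suc (Suc m). cos (real j * y))) * sin (y / 2) =
     (1 + 2 * (\<Sum>j=1..<Suc m. cos (real j * y))) * sin (y / 2) + 2 * cos ((real m + 1) * y) * sin (y / 2)"
    by (simp add: algebra_simps)
  ultimately show ?case using Suc by linarith
qed auto

text \<open>\<open>m * fejer m y\<close> is the sum of the first \<open>m\<close> Dirichlet kernels,
  which is what the recursion for \<open>B\<close> says. Multiplied by \<open>sin (y / 2)\<close>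
  twice, the kernels become differences of squared sines and telescope again.\<close>

lemma fejer_closed_form:
  assumes "m > 0"
  shows "real m * fejer m y * (sin (y / 2))\<^sup>2 = (sin (real m * y / 2))\<^sup>2"
proof -
  define B where "B m = real m + 2 * (\<Sum>j=1..<m. (real m - real j) * cos (real j * y))" for m
  have step: "B (Suc m) = B m + (1 + 2 * (\<Sum>j=1..<Suc m. cos (real j * y)))" for m
  proof -
    have "(\<Sum>j=1..<Suc m. (real (Suc m) - real j) * cos (real j * y)) =
       (\<Sum>j=1..<Suc m. (real m - real j) * cos (real j * y) + cos (real j * y))"
      by (intro sum.cong) (auto simp: algebra_simps)
    also have "\<dots> = (\<Sum>j=1..<m. (real m - real j) * cos (real j * y)) + (\<Sum>j=1..<Suc m. cos (real j * y))"
      by (cases m) (auto simp: sum.distrib)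
    finally show ?thesis unfolding B_def by simp
  qed
  have "B m * (sin (y / 2))\<^sup>2 = (sin (real m * y / 2))\<^sup>2" for m
  proof (induction m)
    case 0 then show ?case by (simp add: B_def)
  next
    case (Suc m)
    have "B (Suc m) * (sin (y / 2))\<^sup>2 = B m * (sin (y / 2))\<^sup>2 + ((1 + 2 * (\<Sum>j=1..<Suc m. cos (real j * y))) * sin (y/2)) * sin (y/2)"
      unfolding step by (simp add: algebra_simps power2_eq_square)
    also have "\<dots> = (sin (real m * y / 2))\<^sup>2 + sin ((real m + 1/2) * y) * sin (y/2)"
      by (simp only: Suc dirichlet_kernel)
    also have "\<dots> = (sin (real (Suc m) * y / 2))\<^sup>2"
    proof -
      define a b where "a = real m * y / 2" and "b = y / 2"
      have e: "(real m + 1/2) * y = a + (a + b)" "real (Suc m) * y / 2 = a + b"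
        by (simp_all add: a_def b_def distrib_right add_divide_distrib)
      have "sin (a + (a + b)) * sin b = (cos (2 * a) - cos (2 * (a + b))) / 2"
        using sin_times_sin[of "a + (a + b)" b] by (simp add: algebra_simps)
      moreover have "(sin c)\<^sup>2 = (1 - cos (2 * c)) / 2" for c :: real
        using cos_double_sin[of c] by simp
      ultimately have "(sin a)\<^sup>2 + sin (a + (a + b)) * sin b = (sin (a + b))\<^sup>2"
        by (simp only: diff_divide_distrib)
      then show ?thesis unfolding e a_def[symmetric] b_def[symmetric] .
    qed
    finally show ?case .
  qed
  then have "B m * (sin (y / 2))\<^sup>2 = (sin (real m * y / 2))\<^sup>2" .
  moreover have "B m = real m * fejer m y"
    unfolding B_def fejer_def using assms
    by (simp add: algebra_simps sum_distrib_left)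
  ultimately show ?thesis by (simp only:)
qed

text \<open>The closed form settles all points except the zeros of \<open>sin (y / 2)\<close>; there
  every cosine is 1 and the coefficients are nonnegative.\<close>

lemma fejer_nonneg: "m > 0 \<Longrightarrow> fejer m y \<ge> 0"
proof (cases "sin (y / 2) = 0")
  case True
  then obtain i :: int where "y / 2 = of_int i * pi" by (auto simp: sin_zero_iff_int2)
  then have y: "y = 2 * pi * of_int i" by simp
  have "cos (real j * y) = 1" for j
    using cos_int_2pin[of "int j * i"] by (simp add: y algebra_simps)
  then show ?thesis
    by (auto simp: fejer_def intro!: add_nonneg_nonneg mult_nonneg_nonneg sum_nonneg)
next
  case False
  assume "m > 0"
  have "0 < real m * (sin (y / 2))\<^sup>2" using False \<open>m > 0\<close> by simp
  moreover have "fejer m y * (real m * (sin (y / 2))\<^sup>2) = (sin (real m * y / 2))\<^sup>2"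
    unfolding fejer_closed_form[OF \<open>m > 0\<close>, of y, symmetric] by (simp only: mult_ac)
  then have "fejer m y * (real m * (sin (y / 2))\<^sup>2) \<ge> 0" by (simp only: zero_le_power2)
  ultimately show ?thesis by (simp add: zero_le_mult_iff)
qed

text \<open>By concavity the sine lies above its chord from 0 to \<open>pi / 2\<close>.\<close>

lemma jordan_sin_lower:
  fixes x :: real
  assumes "0 \<le> x" "x \<le> pi / 2"
  shows "2 / pi * x \<le> sin x"
proof (cases "x = 0")
  case False
  have c: "concave_on {0..pi} sin"
    by (rule f''_le0_imp_concave[where f' = cos and f'' = "\<lambda>x. - sin x"])
       (auto intro!: derivative_eq_intros sin_ge_zero)
  have "(1 - 2 / pi * x) * sin 0 + (2 / pi * x) * sin (pi/2) \<le> sin ((1 - 2 / pi * x) *\<^sub>R 0 + (2 / pi * x) *\<^sub>R (pi/2))"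
    by (rule concave_onD[OF c]) (use assms in \<open>auto simp: field_simps\<close>)
  then show ?thesis by simp
qed auto

lemma fejer_upper:
  assumes "m > 0" "0 < y" "y \<le> pi"
  shows "fejer m y \<le> pi\<^sup>2 / (real m * y\<^sup>2)"
proof -
  have "y / pi \<le> sin (y / 2)" using jordan_sin_lower[of "y/2"] assms by simp
  then have 1: "(y / pi)\<^sup>2 \<le> (sin (y / 2))\<^sup>2" using assms by (intro power_mono) auto
  have "real m * fejer m y * (y / pi)\<^sup>2 \<le> real m * fejer m y * (sin (y / 2))\<^sup>2"
    using 1 fejer_nonneg[OF assms(1), of y] by (intro mult_left_mono) auto
  also have "\<dots> \<le> 1" unfolding fejer_closed_form[OF assms(1)] by (simp add: sin_squared_eq)
  finally show ?thesis using assms by (simp add: field_simps power2_eq_square)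
qed

lemma cos_ge_half: "\<bar>x\<bar> \<le> 1 \<Longrightarrow> 1 / 2 \<le> cos (x::real)"
proof -
  assume "\<bar>x\<bar> \<le> 1"
  then have "\<bar>x\<bar> \<le> pi / 3" using pi_gt3 by linarith
  then have "cos (pi / 3) \<le> cos \<bar>x\<bar>" using pi_gt3 by (intro cos_monotone_0_pi_le) auto
  then show ?thesis by (simp add: cos_60)
qed

lemma fejer_lower:
  assumes "m > 0" "real m * \<bar>y\<bar> \<le> 1"
  shows "real m / 2 \<le> fejer m y"
proof -
  have "(\<Sum>j=1..<m. (1 - real j / real m) * (1 / 2)) \<le> (\<Sum>j=1..<m. (1 - real j / real m) * cos (real j * y))"
  proof (intro sum_mono mult_left_mono cos_ge_half)
    fix j assume "j \<in> {1..<m}"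
    then have "real j * \<bar>y\<bar> \<le> real m * \<bar>y\<bar>" by (intro mult_right_mono) auto
    then show "\<bar>real j * y\<bar> \<le> 1" using assms by (simp add: abs_mult)
  qed auto
  moreover have "(\<Sum>j=1..<m. (1 - real j / real m) * (1 / 2)) = (real m - 1) / 4"
  proof -
    have 2: "2 * (\<Sum>j=1..<n. real j) = real n * (real n - 1)" if "n > 0" for n
      using that by (induction n rule: nat_induct_non_zero) (auto simp: algebra_simps)
    have "(\<Sum>j=1..<m. (1 - real j / real m) * (1 / 2)) = (\<Sum>j=1..<m. 1 - real j / real m) * (1 / 2)"
      by (rule sum_distrib_right [symmetric])
    also have "\<dots> = ((real m - 1) - (\<Sum>j=1..<m. real j) / real m) / 2"
      using assms(1) by (simp only: sum_subtractf flip: sum_divide_distrib) (simp add: of_nat_diff)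
    also have "(\<Sum>j=1..<m. real j) / real m = (real m - 1) / 2"
      using 2[OF assms(1)] assms(1) by (simp add: field_simps)
    also have "((real m - 1) - (real m - 1) / 2) / 2 = (real m - 1) / 4" by (simp add: field_simps)
    finally show ?thesis .
  qed
  ultimately have "(real m - 1) / 4 \<le> (\<Sum>j=1..<m. (1 - real j / real m) * cos (real j * y))" by (simp only:)
  moreover have "real m / 2 \<le> 1 + 2 * ((real m - 1) / 4)" by (simp add: field_simps)
  ultimately show ?thesis unfolding fejer_def by (smt (verit))
qed

section \<open>The integrated kernel as an approximation of the sign\<close>

lemma fejer_int_deriv: "(fejer_int m has_real_derivative fejer m y) (at y)"
  unfolding fejer_int_def[abs_def] fejer_def
  by (auto intro!: derivative_eq_intros sum.cong simp: sum_distrib_left)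

lemma fejer_int_minus: "fejer_int m (- y) = - fejer_int m y"
  by (simp add: fejer_int_def sum_negf)

lemma fejer_int_0 [simp]: "fejer_int m 0 = 0"
  by (simp add: fejer_int_def)

lemma fejer_int_pi [simp]: "fejer_int m pi = pi"
  by (simp add: fejer_int_def)

lemma fejer_int_period: "fejer_int m (y + 2 * pi * real q) = fejer_int m y + 2 * pi * real q"
proof -
  have "sin (real j * (y + 2 * pi * real q)) = sin (real j * y)" for j
    using sin_add[of "real j * y" "2 * pi * of_int (int (j * q))"] sin_int_2pin[of "int (j*q)"] cos_int_2pin[of "int (j*q)"]
    by (simp add: algebra_simps)
  then show ?thesis by (simp add: fejer_int_def)
qed

lemma fejer_int_mono:
  assumes "m > 0" "x \<le> y"
  shows "fejer_int m x \<le> fejer_int m y"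
  using assms(2) by (rule DERIV_nonneg_imp_nondecreasing)
    (use fejer_int_deriv fejer_nonneg[OF assms(1)] in blast)

text \<open>Integrates the bound \<open>fejer_upper\<close> backwards from \<open>pi\<close>, where
  the value is known to be \<open>pi\<close>.\<close>

lemma fejer_int_lower:
  assumes "m > 0" "0 < y" "y \<le> pi"
  shows "pi - pi\<^sup>2 / (real m * y) \<le> fejer_int m y"
proof -
  have "fejer_int m pi + pi\<^sup>2 / (real m * pi) \<le> fejer_int m y + pi\<^sup>2 / (real m * y)"
  proof (rule DERIV_nonpos_imp_nonincreasing[OF assms(3), where f = "\<lambda>y. fejer_int m y + pi\<^sup>2 / (real m * y)"])
    fix x assume x: "y \<le> x" "x \<le> pi"
    have "((\<lambda>y. fejer_int m y + pi\<^sup>2 / (real m * y)) has_real_derivative fejer m x - pi\<^sup>2 / (real m * x\<^sup>2)) (at x)"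
      using assms x by (auto intro!: derivative_eq_intros fejer_int_deriv simp: field_simps power2_eq_square)
    moreover have "fejer m x - pi\<^sup>2 / (real m * x\<^sup>2) \<le> 0"
      using fejer_upper[OF assms(1), of x] x assms by simp
    ultimately show "\<exists>y. ((\<lambda>y. fejer_int m y + pi\<^sup>2 / (real m * y)) has_real_derivative y) (at x) \<and> y \<le> 0" by blast
  qed
  moreover have "pi\<^sup>2 / (real m * pi) \<ge> 0" by simp
  ultimately show ?thesis unfolding fejer_int_pi by linarith
qed

text \<open>Removing whole periods changes \<open>fejer_int m y\<close> and \<open>y\<close> by the
  same amount; within one period monotonicity bounds the rest by \<open>2 * pi\<close>.\<close>

lemma fejer_int_le:
  assumes "m > 0" "0 \<le> y"
  shows "fejer_int m y \<le> y + 2 * pi"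
proof -
  define q where "q = nat \<lfloor>y / (2 * pi)\<rfloor>"
  have q: "real q \<le> y / (2 * pi)" "y / (2 * pi) < real q + 1"
    using assms by (auto simp: q_def)
  have "fejer_int m y = fejer_int m (y - 2 * pi * real q) + 2 * pi * real q"
    using fejer_int_period[of m "y - 2 * pi * real q" q] by simp
  also have "fejer_int m (y - 2 * pi * real q) \<le> fejer_int m (0 + 2 * pi * real 1)"
    using q by (intro fejer_int_mono assms) (auto simp: field_simps)
  also have "\<dots> = 2 * pi" by (subst fejer_int_period) simp
  finally show ?thesis using q by (simp add: field_simps)
qed

text \<open>Three ranges of \<open>y\<close>. Up to \<open>1 / N0\<close> only the trivial error
  bound \<open>pi\<close> is available, and there \<open>fejer N0 y\<close> is of order
  \<open>N0\<close>. From there to \<open>pi\<close> the error is at most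
  \<open>pi^2 / (N * y)\<close>, and \<open>1 / y\<close> is dominated by the weighted sum of
  kernels because about \<open>1 / y\<close> of its terms are at least \<open>1 / 2\<close>. Beyond
  \<open>pi\<close> the linear growth of \<open>fejer_int\<close> is accepted.\<close>

lemma sign_pm_fejer_approx_pos:
  assumes "N > 0" "N0 > 0" "0 \<le> y"
  shows "\<bar>fejer_int N y - pi\<bar> \<le>
     2 * pi * (fejer N0 y / real N0) + 4 * pi\<^sup>2 / real N * (\<Sum>m=1..N0. fejer m y / real m)
     + (if y > pi then 3 * y else 0)"
proof -
  have nn: "0 \<le> fejer N0 y / real N0" "0 \<le> (\<Sum>m=1..N0. fejer m y / real m)"
    using assms by (auto intro!: sum_nonneg divide_nonneg_nonneg fejer_nonneg)
  have nn2: "0 \<le> 2 * pi * (fejer N0 y / real N0)"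
     "0 \<le> 4 * pi\<^sup>2 / real N * (\<Sum>m=1..N0. fejer m y / real m)"
    using nn by (auto intro!: mult_nonneg_nonneg simp del: times_divide_eq_left times_divide_eq_right)
  consider "y > pi" | "y \<le> pi" "real N0 * y \<le> 1" | "y \<le> pi" "real N0 * y > 1" by linarith
  then show ?thesis
  proof cases
    case 1
    have "pi \<le> fejer_int N y" using fejer_int_mono[OF assms(1), of pi y] 1 by simp
    moreover have "fejer_int N y \<le> y + 2 * pi" by (rule fejer_int_le) (use assms in auto)
    ultimately have "\<bar>fejer_int N y - pi\<bar> \<le> 3 * y" using 1 by simp
    then show ?thesis using nn2 1 by simp
  next
    case 2
    have "0 \<le> fejer_int N y" using fejer_int_mono[OF assms(1), of 0 y] assms by simp
    moreover have "fejer_int N y \<le> pi" using fejer_int_mono[OF assms(1), of y pi] 2 by simp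
    ultimately have "\<bar>fejer_int N y - pi\<bar> \<le> pi" by simp
    moreover have "1 / 2 \<le> fejer N0 y / real N0"
      using fejer_lower[of N0 y] 2 assms by (simp add: field_simps)
    then have "2 * pi * (1 / 2) \<le> 2 * pi * (fejer N0 y / real N0)" by (intro mult_left_mono) auto
    ultimately show ?thesis using nn2 2 by simp
  next
    case 3
    have y0: "y > 0" using 3 assms by (cases "y = 0") auto
    have "fejer_int N y \<le> pi" using fejer_int_mono[OF assms(1), of y pi] 3 by simp
    with fejer_int_lower[OF assms(1) y0] 3
    have a: "\<bar>fejer_int N y - pi\<bar> \<le> pi\<^sup>2 / (real N * y)" by simp
    have b: "1 / y \<le> 4 * (\<Sum>m=1..N0. fejer m y / real m)"
    proof (cases "y \<le> 1")
      case True
      \<comment> \<open>Kernels of order at most \<open>1 / y\<close> are still near their peak at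
        \<open>y\<close>, so the first \<open>p\<close> terms are bounded below by
        \<open>1 / 2\<close>; \<open>p <= N0\<close> since \<open>N0 * y > 1\<close>.\<close>
      define p where "p = nat \<lfloor>1 / y\<rfloor>"
      have p: "real p \<le> 1 / y" "1 / y < real p + 1" using y0 by (auto simp: p_def)
      have "1 \<le> p" using True y0 by (simp add: p_def le_nat_floor)
      then have "1 / y \<le> 2 * real p" using p by linarith
      have "p \<le> N0"
      proof -
        have "1 / y < real N0" using 3 y0 by (simp add: field_simps)
        then show ?thesis using p by linarith
      qed
      have "real p / 2 = (\<Sum>m=1..p. 1 / 2)" by simp
      also have "\<dots> \<le> (\<Sum>m=1..p. fejer m y / real m)"
      proof (rule sum_mono)
        fix m assume m: "m \<in> {1..p}"
        have "real m * y \<le> real p * y" using m y0 by (intro mult_right_mono) auto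
        also have "\<dots> \<le> 1" using p y0 by (simp add: field_simps)
        finally show "1 / 2 \<le> fejer m y / real m"
          using fejer_lower[of m y] m y0 by (simp add: field_simps)
      qed
      also have "\<dots> \<le> (\<Sum>m=1..N0. fejer m y / real m)"
        using \<open>p \<le> N0\<close> by (intro sum_mono2) (auto intro!: divide_nonneg_nonneg fejer_nonneg)
      finally show ?thesis using \<open>1 / y \<le> 2 * real p\<close> by linarith
    next
      case False
      \<comment> \<open>For \<open>y > 1\<close> the first term suffices: the kernel of order 1 is
        constantly 1.\<close>
      have "1 = (\<Sum>m=1..1. fejer m y / real m)" by (simp add: fejer_def)
      also have "\<dots> \<le> (\<Sum>m=1..N0. fejer m y / real m)"
        using assms(2) by (intro sum_mono2) (auto intro!: divide_nonneg_nonneg fejer_nonneg)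
      finally have "1 \<le> (\<Sum>m=1..N0. fejer m y / real m)" .
      moreover have "1 / y \<le> 1" using False by simp
      ultimately show ?thesis by linarith
    qed
    have "pi\<^sup>2 / (real N * y) = pi\<^sup>2 / real N * (1 / y)" by simp
    also have "\<dots> \<le> pi\<^sup>2 / real N * (4 * (\<Sum>m=1..N0. fejer m y / real m))"
      by (intro mult_left_mono b) auto
    finally show ?thesis using a nn2 3 by (simp add: mult_ac)
  qed
qed

section \<open>Bounded independence and moments of linear forms\<close>

text \<open>Expectations are taken with respect to weights on the cube rather than pmfs, so that
  conditioning on some coordinates is just multiplication of the weights.\<close>

definition wexp :: "nat \<Rightarrow> ((nat \<Rightarrow> real) \<Rightarrow> real) \<Rightarrow> ((nat \<Rightarrow> real) \<Rightarrow> real) \<Rightarrow> real" where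
  "wexp n \<mu> f = (\<Sum>x\<in>cube n. \<mu> x * f x)"

text \<open>Independence in Fourier terms: nonempty monomials of degree at most \<open>k\<close>
  have mean zero, and \<open>A = {}\<close> says that the total weight is 1. The set
  \<open>J\<close> holds the coordinates that are still free after conditioning on the
  others.\<close>

definition kwise_weights :: "nat \<Rightarrow> nat \<Rightarrow> nat set \<Rightarrow> ((nat \<Rightarrow> real) \<Rightarrow> real) \<Rightarrow> bool" where
  "kwise_weights n k J \<mu> \<longleftrightarrow> J \<subseteq> {..<n} \<and> (\<forall>x\<in>cube n. 0 \<le> \<mu> x) \<and>
     (\<forall>A\<subseteq>J. card A \<le> k \<longrightarrow> wexp n \<mu> (\<lambda>x. \<Prod>i\<in>A. x i) = of_bool (A = {}))"

abbreviation uniform_weights :: "nat \<Rightarrow> (nat \<Rightarrow> real) \<Rightarrow> real" where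
  "uniform_weights n \<equiv> (\<lambda>_. 1 / 2 ^ n)"

lemma finite_signs [simp]: "finite I \<Longrightarrow> finite (signs I)"
  by (auto simp: signs_def intro: finite_PiE)

lemma card_signs: "finite I \<Longrightarrow> card (signs I) = 2 ^ card I"
  by (simp add: signs_def card_PiE numeral_2_eq_2)

lemma cube_sq: "x \<in> cube n \<Longrightarrow> i < n \<Longrightarrow> x i * x i = 1"
  by (auto simp: signs_def PiE_def Pi_def)

lemma wexp_add: "wexp n \<mu> (\<lambda>x. f x + g x) = wexp n \<mu> f + wexp n \<mu> g"
  by (simp add: wexp_def algebra_simps sum.distrib)

lemma wexp_diff: "wexp n \<mu> (\<lambda>x. f x - g x) = wexp n \<mu> f - wexp n \<mu> g"
  by (simp add: wexp_def algebra_simps sum_subtractf)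

lemma wexp_cmult: "wexp n \<mu> (\<lambda>x. c * f x) = c * wexp n \<mu> f"
  by (simp add: wexp_def sum_distrib_left mult_ac)

lemma wexp_sum: "wexp n \<mu> (\<lambda>x. \<Sum>i\<in>I. f i x) = (\<Sum>i\<in>I. wexp n \<mu> (f i))"
  unfolding wexp_def by (subst sum.swap) (simp add: sum_distrib_left)

lemma wexp_cong: "(\<And>x. x \<in> cube n \<Longrightarrow> f x = g x) \<Longrightarrow> wexp n \<mu> f = wexp n \<mu> g"
  by (simp add: wexp_def)

context
  fixes n k J \<mu>
  assumes kw: "kwise_weights n k J \<mu>"
begin

lemma kwise_weights_nonneg: "x \<in> cube n \<Longrightarrow> 0 \<le> \<mu> x"
  using kw by (auto simp: kwise_weights_def)

lemma wexp_const: "wexp n \<mu> (\<lambda>_. c) = c"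
proof -
  have "wexp n \<mu> (\<lambda>x. \<Prod>i\<in>{}. x i) = 1" using kw by (auto simp: kwise_weights_def simp del: prod.empty)
  then have "wexp n \<mu> (\<lambda>x. c * 1) = c" unfolding wexp_cmult by simp
  then show ?thesis by simp
qed

lemma wexp_mono: "(\<And>x. x \<in> cube n \<Longrightarrow> f x \<le> g x) \<Longrightarrow> wexp n \<mu> f \<le> wexp n \<mu> g"
  unfolding wexp_def by (intro sum_mono mult_left_mono kwise_weights_nonneg)

lemma wexp_abs_le: "\<bar>wexp n \<mu> f\<bar> \<le> wexp n \<mu> (\<lambda>x. \<bar>f x\<bar>)"
  unfolding wexp_def using sum_abs[of "\<lambda>x. \<mu> x * f x" "cube n"]
  by (simp add: abs_mult kwise_weights_nonneg cong: sum.cong)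

lemma wexp_abs_diff_le:
  assumes "\<And>x. x \<in> cube n \<Longrightarrow> \<bar>f x - g x\<bar> \<le> h x"
  shows "\<bar>wexp n \<mu> f - wexp n \<mu> g\<bar> \<le> wexp n \<mu> h"
  using wexp_abs_le[of "\<lambda>x. f x - g x"] wexp_mono[of "\<lambda>x. \<bar>f x - g x\<bar>" h] assms
  unfolding wexp_diff by force

end

text \<open>Expanding one factor of the power multiplies the monomial over \<open>A\<close> by some
  \<open>x i\<close>. As \<open>x i * x i = 1\<close>, this inserts \<open>i\<close> into
  \<open>A\<close> or deletes it, so monomials stay multilinear and each lost power costs at most
  one unit of degree.\<close>

lemma wexp_power_prod_eq:
  assumes "kwise_weights n k J \<mu>" "kwise_weights n k J \<nu>" "A \<subseteq> J" "j + card A \<le> k"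
  shows "wexp n \<mu> (\<lambda>x. (\<Sum>i\<in>J. w i * x i) ^ j * (\<Prod>i\<in>A. x i)) =
         wexp n \<nu> (\<lambda>x. (\<Sum>i\<in>J. w i * x i) ^ j * (\<Prod>i\<in>A. x i))"
  using assms(3,4)
proof (induction j arbitrary: A)
  case 0
  then show ?case using assms(1,2) by (simp add: kwise_weights_def)
next
  case (Suc j)
  have J: "J \<subseteq> {..<n}" "finite J" using assms(1) by (auto simp: kwise_weights_def intro: finite_subset)
  have A: "finite A" using Suc.prems J finite_subset by blast
  define B where "B i = (if i \<in> A then A - {i} else insert i A)" for i
  have B: "x i * (\<Prod>i\<in>A. x i) = (\<Prod>i\<in>B i. x i)" if "x \<in> cube n" "i \<in> J" for x i
  proof (cases "i \<in> A")
    case True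
    then have "(\<Prod>i\<in>A. x i) = x i * (\<Prod>i\<in>A - {i}. x i)" using A by (simp add: prod.remove)
    then show ?thesis using True cube_sq[OF that(1), of i] that J by (auto simp: B_def simp flip: mult.assoc)
  qed (use A in \<open>auto simp: B_def\<close>)
  have cB: "B i \<subseteq> J \<and> j + card (B i) \<le> k" if "i \<in> J" for i
    using Suc.prems A that by (auto simp: B_def card_insert_if card_Diff_singleton)
  have *: "wexp n \<rho> (\<lambda>x. (\<Sum>i\<in>J. w i * x i) ^ Suc j * (\<Prod>i\<in>A. x i)) =
     (\<Sum>i\<in>J. w i * wexp n \<rho> (\<lambda>x. (\<Sum>i\<in>J. w i * x i) ^ j * (\<Prod>i\<in>B i. x i)))" for \<rho>
  proof -
    have "wexp n \<rho> (\<lambda>x. (\<Sum>i\<in>J. w i * x i) ^ Suc j * (\<Prod>i\<in>A. x i)) =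
      wexp n \<rho> (\<lambda>x. \<Sum>i\<in>J. w i * ((\<Sum>i\<in>J. w i * x i) ^ j * (\<Prod>i\<in>B i. x i)))"
    proof (rule wexp_cong)
      fix x assume x: "x \<in> cube n"
      have "(\<Sum>i\<in>J. w i * x i) ^ Suc j * (\<Prod>i\<in>A. x i) =
         (\<Sum>i\<in>J. w i * x i) * ((\<Sum>i\<in>J. w i * x i) ^ j * (\<Prod>i\<in>A. x i))" by simp
      also have "\<dots> = (\<Sum>i\<in>J. w i * x i * ((\<Sum>i\<in>J. w i * x i) ^ j * (\<Prod>i\<in>A. x i)))"
        by (rule sum_distrib_right)
      also have "\<dots> = (\<Sum>i\<in>J. w i * ((\<Sum>i\<in>J. w i * x i) ^ j * (\<Prod>i\<in>B i. x i)))"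
        by (intro sum.cong refl) (simp add: B[OF x, symmetric] mult_ac)
      finally show "(\<Sum>i\<in>J. w i * x i) ^ Suc j * (\<Prod>i\<in>A. x i) = \<dots>" .
    qed
    then show ?thesis by (simp add: wexp_sum wexp_cmult)
  qed
  show ?case unfolding * using Suc.IH cB by (intro sum.cong) auto
qed

lemma wexp_power_eq:
  assumes "kwise_weights n k J \<mu>" "kwise_weights n k J \<nu>" "j \<le> k"
  shows "wexp n \<mu> (\<lambda>x. (\<Sum>i\<in>J. w i * x i) ^ j) = wexp n \<nu> (\<lambda>x. (\<Sum>i\<in>J. w i * x i) ^ j)"
  using wexp_power_prod_eq[OF assms(1,2), of "{}" j] assms(3) by simp

lemma sum_cube_prod:
  fixes f :: "nat \<Rightarrow> real \<Rightarrow> 'a::comm_semiring_1"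
  shows "(\<Sum>x\<in>cube n. \<Prod>i<n. f i (x i)) = (\<Prod>i<n. f i 1 + f i (-1))"
proof -
  have "(\<Prod>i<n. \<Sum>y\<in>{-1,1::real}. f i y) = (\<Sum>x\<in>cube n. \<Prod>i<n. f i (x i))"
    unfolding signs_def by (rule prod_sum_PiE) auto
  then show ?thesis by (simp add: add.commute)
qed

lemma wexp_uniform_prod: "wexp n (uniform_weights n) (\<lambda>x. \<Prod>i<n. f i (x i)) = (\<Prod>i<n. (f i 1 + f i (-1)) / 2)"
  unfolding wexp_def by (simp add: sum_cube_prod prod_dividef flip: sum_divide_distrib)

lemma prod_restrict:
  fixes f :: "nat \<Rightarrow> 'a::comm_monoid_mult"
  assumes "A \<subseteq> {..<n::nat}"
  shows "(\<Prod>i\<in>A. f i) = (\<Prod>i<n. if i \<in> A then f i else 1)"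
  using assms by (simp add: prod.If_cases Int_absorb1)

lemma wexp_uniform_prod_subset:
  assumes "A \<subseteq> {..<n}"
  shows "wexp n (uniform_weights n) (\<lambda>x. \<Prod>i\<in>A. f i (x i)) = (\<Prod>i\<in>A. (f i 1 + f i (-1)) / 2)"
proof -
  have "wexp n (uniform_weights n) (\<lambda>x. \<Prod>i\<in>A. f i (x i)) =
     wexp n (uniform_weights n) (\<lambda>x. \<Prod>i<n. (if i \<in> A then f i else (\<lambda>_. 1)) (x i))"
    unfolding prod_restrict[OF assms] by (intro wexp_cong prod.cong) auto
  also have "\<dots> = (\<Prod>i\<in>A. (f i 1 + f i (-1)) / 2)"
    unfolding prod_restrict[OF assms] by (subst wexp_uniform_prod, intro prod.cong) auto
  finally show ?thesis .
qed

lemma kwise_weights_uniform: "J \<subseteq> {..<n} \<Longrightarrow> kwise_weights n k J (uniform_weights n)"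
proof -
  assume J: "J \<subseteq> {..<n}"
  have "wexp n (uniform_weights n) (\<lambda>x. \<Prod>i\<in>A. x i) = of_bool (A = {})" if "A \<subseteq> J" for A
  proof -
    have A: "A \<subseteq> {..<n}" using that J by blast
    then have "finite A" using finite_subset by blast
    note A = A this
    show ?thesis
      using wexp_uniform_prod_subset[OF A(1), of "\<lambda>_ y. y"] A(2) by (auto simp: zero_power card_gt_0_iff)
  qed
  then show ?thesis using J by (simp add: kwise_weights_def)
qed

section \<open>Moments and characteristic functions of weighted sums of random signs\<close>

lemma sinh_le_mult_cosh: "0 \<le> x \<Longrightarrow> sinh x \<le> x * cosh (x::real)"
proof -
  assume "0 \<le> x"
  have "0 * cosh 0 - sinh 0 \<le> x * cosh x - sinh x"
  proof (rule DERIV_nonneg_imp_nondecreasing[OF \<open>0 \<le> x\<close>])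
    fix y :: real assume "0 \<le> y"
    then show "\<exists>z. ((\<lambda>x. x * cosh x - sinh x) has_real_derivative z) (at y) \<and> 0 \<le> z"
      by (intro exI[of _ "y * sinh y"]) (auto intro!: derivative_eq_intros)
  qed
  then show ?thesis by simp
qed

text \<open>The derivative of \<open>ln (cosh x)\<close> is \<open>sinh x / cosh x\<close>, which is
  at most \<open>x\<close>. This is the subgaussian bound for a single random sign.\<close>

lemma cosh_le_exp_square: "cosh x \<le> exp (x\<^sup>2 / 2)" for x :: real
proof -
  have pos: "cosh x \<le> exp (x\<^sup>2 / 2)" if "0 \<le> x" for x :: real
  proof -
    have "(0::real)\<^sup>2 / 2 - ln (cosh 0) \<le> x\<^sup>2 / 2 - ln (cosh x)"
    proof (rule DERIV_nonneg_imp_nondecreasing[OF that])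
      fix y :: real assume "0 \<le> y"
      then have "0 \<le> y - sinh y / cosh y" using sinh_le_mult_cosh[of y] by (simp add: field_simps)
      then show "\<exists>z. ((\<lambda>x. x\<^sup>2 / 2 - ln (cosh x)) has_real_derivative z) (at y) \<and> 0 \<le> z"
        by (intro exI[of _ "y - sinh y / cosh y"]) (auto intro!: derivative_eq_intros)
    qed
    then have "ln (cosh x) \<le> x\<^sup>2 / 2" by simp
    then have "exp (ln (cosh x)) \<le> exp (x\<^sup>2 / 2)" by (simp only: exp_le_cancel_iff)
    then show ?thesis by simp
  qed
  show ?thesis using pos[of "\<bar>x\<bar>"] by (simp add: cosh_real_abs)
qed

lemma power_div_fact_le_exp: "0 \<le> x \<Longrightarrow> x ^ k / fact k \<le> exp (x::real)"
proof -
  assume "0 \<le> x"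
  then have "(\<Sum>i\<in>{k}. x ^ i /\<^sub>R fact i) \<le> (\<Sum>i. x ^ i /\<^sub>R fact i)"
    by (intro sum_le_suminf summable_exp_generic) auto
  then show ?thesis by (simp add: exp_def divide_inverse mult.commute)
qed

lemma wexp_uniform_exp_le:
  assumes "J \<subseteq> {..<n}"
  shows "wexp n (uniform_weights n) (\<lambda>x. exp (l * (\<Sum>i\<in>J. w i * x i))) \<le> exp (l\<^sup>2 / 2 * (\<Sum>i\<in>J. (w i)\<^sup>2))"
proof -
  have J: "finite J" using assms finite_subset by blast
  have "wexp n (uniform_weights n) (\<lambda>x. exp (l * (\<Sum>i\<in>J. w i * x i))) =
     wexp n (uniform_weights n) (\<lambda>x. \<Prod>i\<in>J. exp (l * w i * x i))"
    by (intro wexp_cong) (simp add: exp_sum[OF J] sum_distrib_left mult_ac)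
  also have "\<dots> = (\<Prod>i\<in>J. cosh (l * w i))"
    using wexp_uniform_prod_subset[OF assms, of "\<lambda>i y. exp (l * w i * y)"] by (simp add: cosh_field_def)
  also have "\<dots> \<le> (\<Prod>i\<in>J. exp ((l * w i)\<^sup>2 / 2))"
    by (intro prod_mono) (auto intro: cosh_le_exp_square simp: cosh_real_nonneg)
  also have "\<dots> = exp (l\<^sup>2 / 2 * (\<Sum>i\<in>J. (w i)\<^sup>2))"
    by (simp add: exp_sum[OF J] sum_distrib_left power_mult_distrib)
  finally show ?thesis .
qed

lemma wexp_uniform_moment_le:
  assumes "J \<subseteq> {..<n}" "even k" "k > 0" "(\<Sum>i\<in>J. (w i)\<^sup>2) = 1"
  shows "wexp n (uniform_weights n) (\<lambda>x. (\<Sum>i\<in>J. w i * x i) ^ k / fact k) \<le> 2 * (exp 1 / real k) ^ (k div 2)"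
proof -
  define S where "S x = (\<Sum>i\<in>J. w i * x i)" for x :: "nat \<Rightarrow> real"
  \<comment> \<open>Minimises \<open>exp (l^2 / 2) / l^k\<close>.\<close>
  define l where "l = sqrt (real k)"
  have l: "l > 0" "l\<^sup>2 = real k" using assms by (auto simp: l_def)
  have lk: "l ^ k = real k ^ (k div 2)" using assms(2) l(2) by (metis dvd_mult_div_cancel power_mult)
  note u = kwise_weights_uniform[OF assms(1), of 0]
  have "wexp n (uniform_weights n) (\<lambda>x. S x ^ k / fact k) \<le>
     wexp n (uniform_weights n) (\<lambda>x. 1 / l ^ k * (exp (l * S x) + exp ((- l) * S x)))"
  proof (rule wexp_mono[OF u])
    fix x
    have "l ^ k * (S x ^ k / fact k) = \<bar>l * S x\<bar> ^ k / fact k"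
      using assms(2) by (simp add: power_mult_distrib power_even_abs)
    also have "\<dots> \<le> exp \<bar>l * S x\<bar>" by (rule power_div_fact_le_exp) simp
    also have "\<dots> \<le> exp (l * S x) + exp ((- l) * S x)" by (auto simp: abs_if)
    finally show "S x ^ k / fact k \<le> 1 / l ^ k * (exp (l * S x) + exp ((- l) * S x))"
      using l by (simp add: field_simps)
  qed
  also have "\<dots> \<le> 1 / l ^ k * (exp (l\<^sup>2 / 2 * 1) + exp ((-l)\<^sup>2 / 2 * 1))"
    using wexp_uniform_exp_le[OF assms(1), of l w] wexp_uniform_exp_le[OF assms(1), of "-l" w] l
    unfolding wexp_cmult wexp_add S_def assms(4) by (intro mult_left_mono add_mono) auto
  also have "\<dots> = 2 * (exp (real k / 2) / l ^ k)" by (simp add: l)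
  also have "exp (real k / 2) = exp 1 ^ (k div 2)"
    using assms(2) by (auto elim!: evenE simp: exp_of_nat_mult[symmetric])
  finally show ?thesis unfolding S_def lk by (simp add: power_divide)
qed

lemma Re_mult_of_real: "Re (z * complex_of_real r) = Re z * r"
  by simp

text \<open>The coefficients are real parts of those of \<open>iexp b * iexp z\<close>; they are
  hidden because later only the degree and the remainder matter.\<close>

lemma cos_taylor:
  "\<exists>c. \<forall>z::real. \<bar>cos (z + b) - (\<Sum>j<k. c j * z ^ j)\<bar> \<le> \<bar>z\<bar> ^ k / fact k" if k0: "k > 0"
proof -
  obtain n where k: "k = Suc n" using k0 gr0_implies_Suc by blast
  define c where "c j = Re (iexp b * \<i> ^ j / fact j)" for j
  have "\<bar>cos (z + b) - (\<Sum>j<k. c j * z ^ j)\<bar> \<le> \<bar>z\<bar> ^ k / fact k" for z :: real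
  proof -
    have "cos (z + b) = Re (iexp b * iexp z)"
      by (simp add: exp_add[symmetric] algebra_simps Re_exp flip: of_real_add)
    moreover have "(\<Sum>j<k. c j * z ^ j) = Re (iexp b * (\<Sum>j\<le>n. (\<i> * z) ^ j / fact j))"
      unfolding sum_distrib_left Re_sum k lessThan_Suc_atMost
    proof (rule sum.cong[OF refl])
      fix j
      have "iexp b * ((\<i> * z) ^ j / fact j) = (iexp b * \<i> ^ j / fact j) * complex_of_real (z ^ j)"
        by (simp add: power_mult_distrib)
      then show "c j * z ^ j = Re (iexp b * ((\<i> * z) ^ j / fact j))"
        unfolding c_def by (simp only: Re_mult_of_real)
    qed
    ultimately have "\<bar>cos (z + b) - (\<Sum>j<k. c j * z ^ j)\<bar> =
        \<bar>Re (iexp b * (iexp z - (\<Sum>j\<le>n. (\<i> * z) ^ j / fact j)))\<bar>"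
      by (simp add: right_diff_distrib)
    also have "\<dots> \<le> cmod (iexp b * (iexp z - (\<Sum>j\<le>n. (\<i> * z) ^ j / fact j)))" by (rule abs_Re_le_cmod)
    also have "\<dots> = cmod (iexp z - (\<Sum>j\<le>n. (\<i> * z) ^ j / fact j))" by (simp add: norm_mult)
    also have "\<dots> \<le> \<bar>z\<bar> ^ k / fact k" unfolding k by (rule iexp_approx1)
    finally show ?thesis .
  qed
  then show ?thesis by blast
qed

text \<open>The Taylor polynomial has degree below \<open>k\<close> and hence the same mean under
  both weights. The remainder is governed by the \<open>k\<close>-th moment, which is itself among
  the moments that agree, so the uniform bound applies to it. The condition on \<open>a\<close>
  turns \<open>a^2 * exp 1 / k\<close> into at most \<open>exp (-2)\<close>, whose power
  \<open>k div 2\<close> is \<open>exp (- k)\<close>.\<close>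

lemma wexp_cos_close:
  assumes "kwise_weights n k J \<mu>" "even k" "k > 0" "(\<Sum>i\<in>J. (w i)\<^sup>2) = 1" "a\<^sup>2 * exp 3 \<le> real k"
  shows "\<bar>wexp n \<mu> (\<lambda>x. cos (a * (\<Sum>i\<in>J. w i * x i) + b)) -
          wexp n (uniform_weights n) (\<lambda>x. cos (a * (\<Sum>i\<in>J. w i * x i) + b))\<bar> \<le> 4 * exp (- real k)"
proof -
  define S where "S x = (\<Sum>i\<in>J. w i * x i)" for x :: "nat \<Rightarrow> real"
  have J: "J \<subseteq> {..<n}" using assms(1) by (simp add: kwise_weights_def)
  note u = kwise_weights_uniform[OF J, of k]
  obtain c where c: "\<And>z::real. \<bar>cos (z + b) - (\<Sum>j<k. c j * z ^ j)\<bar> \<le> \<bar>z\<bar> ^ k / fact k"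
    using cos_taylor[OF assms(3)] by blast
  define p where "p x = (\<Sum>j<k. c j * (a * S x) ^ j)" for x
  have mom: "wexp n \<nu> (\<lambda>x. \<bar>a * S x\<bar> ^ k / fact k) \<le> 2 * exp (- real k)" if "kwise_weights n k J \<nu>" for \<nu>
  proof -
    have "wexp n \<nu> (\<lambda>x. \<bar>a * S x\<bar> ^ k / fact k) = a ^ k / fact k * wexp n \<nu> (\<lambda>x. S x ^ k)"
      unfolding wexp_cmult[symmetric] using assms(2)
      by (intro wexp_cong) (simp add: power_mult_distrib power_even_abs)
    also have "\<dots> = a ^ k / fact k * wexp n (uniform_weights n) (\<lambda>x. S x ^ k)"
      unfolding S_def by (subst wexp_power_eq[OF that u]) auto
    also have "\<dots> = a ^ k * wexp n (uniform_weights n) (\<lambda>x. S x ^ k / fact k)"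
      using wexp_cmult[of n "uniform_weights n" "1 / fact k" "\<lambda>x. S x ^ k"] by simp
    also have "\<dots> \<le> a ^ k * (2 * (exp 1 / real k) ^ (k div 2))"
      unfolding S_def using assms by (intro mult_left_mono wexp_uniform_moment_le J) (auto simp: zero_le_even_power)
    also have "a ^ k = (a\<^sup>2) ^ (k div 2)" using assms(2) by (metis dvd_mult_div_cancel power_mult)
    also have "(a\<^sup>2) ^ (k div 2) * (2 * (exp 1 / real k) ^ (k div 2)) = 2 * (a\<^sup>2 * exp 1 / real k) ^ (k div 2)"
      by (simp flip: power_mult_distrib)
    also have "\<dots> \<le> 2 * (exp (-2)) ^ (k div 2)"
    proof (intro mult_left_mono power_mono)
      have "a\<^sup>2 * exp 1 = a\<^sup>2 * exp 3 * exp (-2)" by (simp flip: exp_add)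
      also have "\<dots> \<le> real k * exp (-2)" using assms(5) by (intro mult_right_mono) auto
      finally show "a\<^sup>2 * exp 1 / real k \<le> exp (-2)" using assms(3) by (simp add: field_simps)
    qed auto
    also have "exp (-2::real) ^ (k div 2) = exp (- real k)"
      using assms(2) by (auto elim!: evenE simp: exp_of_nat_mult[symmetric])
    finally show ?thesis .
  qed
  have pe: "wexp n \<mu> p = wexp n (uniform_weights n) p"
    unfolding p_def wexp_sum power_mult_distrib wexp_cmult mult.assoc[symmetric]
    using wexp_power_eq[OF assms(1) u] unfolding S_def by (intro sum.cong refl) (auto simp: wexp_cmult)
  have cl: "\<bar>wexp n \<nu> (\<lambda>x. cos (a * S x + b)) - wexp n \<nu> p\<bar> \<le> 2 * exp (- real k)" if "kwise_weights n k J \<nu>" for \<nu>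
    using wexp_abs_diff_le[OF that, of "\<lambda>x. cos (a * S x + b)" p "\<lambda>x. \<bar>a * S x\<bar> ^ k / fact k"] mom[OF that] c
    by (fastforce simp: p_def)
  show ?thesis using cl[OF assms(1)] cl[OF u] pe unfolding S_def by linarith
qed

text \<open>Half-angle formula: \<open>cos y = 1 - 2 * (sin (y / 2))^2\<close>, and the sine is at
  least \<open>|y| / 4\<close> because \<open>pi < 4\<close>. On this range the cosine is positive,
  so the absolute value is harmless.\<close>

lemma abs_cos_le_exp:
  fixes y :: real
  assumes "\<bar>y\<bar> \<le> 1"
  shows "\<bar>cos y\<bar> \<le> exp (- (y\<^sup>2 / 8))"
proof -
  have "\<bar>y\<bar> / pi \<le> sin (\<bar>y\<bar> / 2)" using jordan_sin_lower[of "\<bar>y\<bar> / 2"] assms pi_gt3 by simp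
  moreover have "\<bar>y\<bar> / 4 \<le> \<bar>y\<bar> / pi" using pi_less_4 by (intro divide_left_mono) auto
  ultimately have "\<bar>y\<bar> / 4 \<le> sin (\<bar>y\<bar> / 2)" by (rule order_trans[rotated])
  then have "(\<bar>y\<bar> / 4)\<^sup>2 \<le> (sin (\<bar>y\<bar> / 2))\<^sup>2" by (rule power_mono) simp
  then have 1: "y\<^sup>2 / 8 \<le> 2 * (sin (\<bar>y\<bar> / 2))\<^sup>2" by (simp add: power_divide)
  have "cos y = cos (2 * (\<bar>y\<bar> / 2))" by simp
  also have "\<dots> = 1 - 2 * (sin (\<bar>y\<bar> / 2))\<^sup>2" by (rule cos_double_sin)
  finally have "cos y \<le> 1 - y\<^sup>2 / 8" using 1 by simp
  also have "\<dots> \<le> exp (- (y\<^sup>2 / 8))" using exp_ge_add_one_self[of "- (y\<^sup>2/8)"] by simp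
  finally show ?thesis using cos_ge_half[OF assms] by simp
qed

text \<open>The complex exponential factorises over the coordinates, and the two signs of each
  coordinate add up to a real number, so the shift \<open>b\<close> survives only through its real
  part.\<close>

lemma wexp_uniform_cos:
  assumes "J \<subseteq> {..<n}"
  shows "wexp n (uniform_weights n) (\<lambda>x. cos (a * (\<Sum>i\<in>J. w i * x i) + b)) = cos b * (\<Prod>i\<in>J. cos (a * w i))"
proof -
  have J: "finite J" using assms finite_subset by blast
  let ?f = "\<lambda>i y. if i \<in> J then iexp (a * w i * y) else 1"
  have "(\<Sum>x\<in>cube n. iexp (a * (\<Sum>i\<in>J. w i * x i) + b)) = (\<Sum>x\<in>cube n. iexp b * (\<Prod>i<n. ?f i (x i)))"
  proof (rule sum.cong[OF refl])
    fix x :: "nat \<Rightarrow> real"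
    have "iexp (a * (\<Sum>i\<in>J. w i * x i) + b) = iexp b * exp (\<Sum>i\<in>J. \<i> * complex_of_real (a * w i * x i))"
      by (simp add: exp_add[symmetric] algebra_simps sum_distrib_left)
    also have "\<dots> = iexp b * (\<Prod>i<n. ?f i (x i))"
      unfolding exp_sum[OF J] prod_restrict[OF assms] by (intro arg_cong2[where f = "(*)"] prod.cong) auto
    finally show "iexp (a * (\<Sum>i\<in>J. w i * x i) + b) = iexp b * (\<Prod>i<n. ?f i (x i))" .
  qed
  also have "\<dots> = iexp b * (\<Prod>i<n. ?f i 1 + ?f i (-1))"
    by (subst sum_distrib_left[symmetric], subst sum_cube_prod) simp
  also have "(\<Prod>i<n. ?f i 1 + ?f i (-1)) = (\<Prod>i<n. complex_of_real (2 * (if i \<in> J then cos (a * w i) else 1)))"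
  proof (intro prod.cong refl)
    fix i
    have "iexp t + iexp (- t) = complex_of_real (2 * cos t)" for t :: real
      by (simp add: complex_eq_iff Re_exp Im_exp)
    from this[of "a * w i"] show "?f i 1 + ?f i (-1) = complex_of_real (2 * (if i \<in> J then cos (a * w i) else 1))" by simp
  qed
  also have "\<dots> = complex_of_real (2 ^ n * (\<Prod>i\<in>J. cos (a * w i)))"
    unfolding of_real_prod[symmetric] prod.distrib prod_restrict[OF assms] by simp
  finally have "Re (\<Sum>x\<in>cube n. iexp (a * (\<Sum>i\<in>J. w i * x i) + b)) = Re (iexp b * complex_of_real (2 ^ n * (\<Prod>i\<in>J. cos (a * w i))))"
    by simp
  then show ?thesis unfolding wexp_def Re_sum Re_mult_of_real by (simp add: Re_exp flip: sum_divide_distrib)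
qed

text \<open>Gaussian decay of the characteristic function, as long as no single term
  \<open>a * w i\<close> exceeds 1. Regularity of the weights enters here: it widens the range of
  admissible frequencies \<open>a\<close>.\<close>

lemma wexp_uniform_cos_le:
  assumes "J \<subseteq> {..<n}" "(\<Sum>i\<in>J. (w i)\<^sup>2) = 1" "\<And>i. i \<in> J \<Longrightarrow> \<bar>a * w i\<bar> \<le> 1"
  shows "\<bar>wexp n (uniform_weights n) (\<lambda>x. cos (a * (\<Sum>i\<in>J. w i * x i) + b))\<bar> \<le> exp (- (a\<^sup>2 / 8))"
proof -
  have J: "finite J" using assms finite_subset by blast
  have "\<bar>cos b * (\<Prod>i\<in>J. cos (a * w i))\<bar> \<le> 1 * \<bar>\<Prod>i\<in>J. cos (a * w i)\<bar>"
    unfolding abs_mult by (intro mult_right_mono) auto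
  also have "\<dots> \<le> (\<Prod>i\<in>J. exp (- ((a * w i)\<^sup>2 / 8)))"
    unfolding abs_prod mult_1_left by (intro prod_mono conjI abs_cos_le_exp assms) auto
  also have "\<dots> = exp (- (a\<^sup>2 / 8 * (\<Sum>i\<in>J. (w i)\<^sup>2)))"
    by (simp add: exp_sum[OF J, symmetric] sum_negf sum_distrib_left power_mult_distrib)
  finally show ?thesis using assms(2) by (simp add: wexp_uniform_cos[OF assms(1)])
qed

section \<open>Regular halfspaces\<close>

lemma kwise_weights_mono:
  "kwise_weights n k J \<mu> \<Longrightarrow> k' \<le> k \<Longrightarrow> J' \<subseteq> J \<Longrightarrow> kwise_weights n k' J' \<mu>"
  unfolding kwise_weights_def by (meson order_trans)

lemma wexp_square:
  assumes "kwise_weights n k J \<mu>" "k \<ge> 2"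
  shows "wexp n \<mu> (\<lambda>x. (\<Sum>i\<in>J. w i * x i)\<^sup>2) = (\<Sum>i\<in>J. (w i)\<^sup>2)"
proof -
  have J: "J \<subseteq> {..<n}" "finite J" using assms(1) by (auto simp: kwise_weights_def intro: finite_subset)
  have ij: "wexp n \<mu> (\<lambda>x. x i * x j) = of_bool (i = j)" if "i \<in> J" "j \<in> J" for i j
  proof (cases "i = j")
    case True
    have "wexp n \<mu> (\<lambda>x. x i * x j) = wexp n \<mu> (\<lambda>_. 1)"
      using True that J by (intro wexp_cong) (auto simp: cube_sq)
    then show ?thesis using True wexp_const[OF assms(1)] by simp
  next
    case False
    have "wexp n \<mu> (\<lambda>x. \<Prod>i\<in>{i,j}. x i) = of_bool ({i,j} = {})"
      using assms(1) that card_insert_le_m1[of 2 "{j}" i] assms(2) unfolding kwise_weights_def by force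
    then show ?thesis using False by simp
  qed
  have "wexp n \<mu> (\<lambda>x. (\<Sum>i\<in>J. w i * x i)\<^sup>2) = wexp n \<mu> (\<lambda>x. \<Sum>i\<in>J. \<Sum>j\<in>J. w i * w j * (x i * x j))"
    by (intro wexp_cong) (simp add: power2_eq_square sum_product mult_ac)
  also have "\<dots> = (\<Sum>i\<in>J. \<Sum>j\<in>J. w i * w j * of_bool (i = j))"
    unfolding wexp_sum wexp_cmult by (intro sum.cong refl) (simp add: ij)
  also have "\<dots> = (\<Sum>i\<in>J. (w i)\<^sup>2)"
    by (intro sum.cong refl) (simp add: of_bool_def sum.delta'[OF J(2)] power2_eq_square if_distrib cong: if_cong)
  finally show ?thesis .
qed

lemma fejer_minus: "fejer m (- y) = fejer m y"
  by (simp add: fejer_def)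

lemma sign_pm_fejer_approx:
  assumes "N > 0" "N0 > 0"
  shows "\<bar>pi * sign_pm y - fejer_int N y\<bar> \<le>
     2 * pi * (fejer N0 y / real N0) + 4 * pi\<^sup>2 / real N * (\<Sum>m=1..N0. fejer m y / real m)
     + (if \<bar>y\<bar> > pi then 3 * \<bar>y\<bar> else 0)"
proof (cases "y \<ge> 0")
  case True
  then show ?thesis using sign_pm_fejer_approx_pos[OF assms, of y] by (simp add: sign_pm_def abs_minus_commute)
next
  case False
  then show ?thesis using sign_pm_fejer_approx_pos[OF assms, of "- y"]
    by (simp add: sign_pm_def fejer_minus fejer_int_minus abs_minus_commute)
qed

text \<open>With \<open>u = j / (3 * M)\<close> the exponent is \<open>9/8 * u^2\<close>, which is
  at least \<open>u - 1/4\<close> by completing the square. The terms are thus below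
  \<open>exp (1/4)\<close> times a geometric sequence of ratio
  \<open>exp (- 1 / (3 * M))\<close>.\<close>

lemma sum_gaussian_le:
  assumes "M \<ge> (1::real)"
  shows "(\<Sum>j=1..<m. exp (- ((real j / M)\<^sup>2 / 8))) \<le> 4 * M"
proof -
  define q where "q = exp (- (1 / (3 * M)))"
  have q: "0 < q" "q < 1" using assms by (auto simp: q_def)
  have e4: "exp (1/4) \<le> (4/3::real)"
  proof -
    have "exp (1/4::real) ^ 4 = exp 1" by (simp flip: exp_of_nat_mult)
    also have "\<dots> \<le> 3" by (rule exp_le)
    also have "\<dots> \<le> (4/3::real) ^ 4" by (simp add: power_divide)
    finally show ?thesis by (rule power_le_imp_le_base[where n = 3, simplified]) auto
  qed
  have "exp (- ((real j / M)\<^sup>2 / 8)) \<le> 4/3 * q ^ j" for j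
  proof -
    define u where "u = real j / (3 * M)"
    have "(real j / M)\<^sup>2 = 9 * u\<^sup>2" using assms by (simp add: u_def power2_eq_square)
    moreover have "0 \<le> u\<^sup>2 - u + 1/4" using zero_le_power2[of "u - 1/2"] by (simp add: power2_eq_square algebra_simps)
    ultimately have "- ((real j / M)\<^sup>2 / 8) \<le> 1/4 - u" using zero_le_power2[of u] by linarith
    then have "exp (- ((real j / M)\<^sup>2 / 8)) \<le> exp (1/4 - u)" by simp
    also have "\<dots> = exp (1/4) * exp (- u)" by (simp flip: exp_add)
    also have "exp (- u) = q ^ j" by (simp add: q_def u_def flip: exp_of_nat_mult)
    also have "exp (1/4) * q ^ j \<le> 4/3 * q ^ j" using e4 q by (intro mult_right_mono) auto
    finally show ?thesis .
  qed
  then have "(\<Sum>j=1..<m. exp (- ((real j / M)\<^sup>2 / 8))) \<le> 4/3 * (\<Sum>j=1..<m. q ^ j)"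
    unfolding sum_distrib_left by (intro sum_mono)
  also have "(\<Sum>j=1..<m. q ^ j) \<le> 3 * M"
  proof -
    have "(\<Sum>j=1..<Suc m. q ^ j) * (1 - q) = q - q ^ Suc m" for m
    proof (induction m)
      case (Suc m)
      have "(\<Sum>j=1..<Suc (Suc m). q ^ j) = (\<Sum>j=1..<Suc m. q ^ j) + q ^ Suc m" by simp
      then show ?case using Suc by (simp only: distrib_right) (simp add: algebra_simps)
    qed simp
    then have "(\<Sum>j=1..<m. q ^ j) * (1 - q) \<le> q" using q by (cases m) (auto simp del: sum.op_ivl_Suc)
    moreover have "q \<le> 3 * M * (1 - q)"
    proof -
      have "1 + 1 / (3 * M) \<le> exp (1 / (3 * M))" by (rule exp_ge_add_one_self)
      then have "q * (1 + 1 / (3 * M)) \<le> q * exp (1 / (3 * M))" using q by (intro mult_left_mono) auto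
      also have "\<dots> = 1" by (simp add: q_def flip: exp_add)
      finally show ?thesis using assms by (simp add: field_simps)
    qed
    ultimately have "(\<Sum>j=1..<m. q ^ j) * (1 - q) \<le> 3 * M * (1 - q)" by (rule order_trans)
    then show ?thesis using q by simp
  qed
  finally show ?thesis by simp
qed

text \<open>An anticoncentration bound in disguise: the kernel is at least \<open>m / 2\<close>
  where the sum is within \<open>M / m\<close> of \<open>\<theta>\<close>, so that event has weight
  at most \<open>34 * M / m\<close>. It follows from the Gaussian decay of the coefficients alone;
  17 collects \<open>1 + 8 + 8 * M\<close> for \<open>M \<ge> 1\<close>.\<close>

lemma wexp_fejer_le:
  assumes "kwise_weights n k J \<mu>" "even k" "k > 0" "(\<Sum>i\<in>J. (w i)\<^sup>2) = 1"
    and \<tau>: "\<And>i. i \<in> J \<Longrightarrow> \<bar>w i\<bar> \<le> \<tau>"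
    and M: "M \<ge> 1" "m > 0" "real m * \<tau> \<le> M" "(real m / M)\<^sup>2 * exp 3 \<le> real k" "real m * exp (- real k) \<le> 1"
  shows "wexp n \<mu> (\<lambda>x. fejer m (((\<Sum>i\<in>J. w i * x i) - \<theta>) / M)) \<le> 17 * M"
proof -
  define S where "S x = (\<Sum>i\<in>J. w i * x i)" for x :: "nat \<Rightarrow> real"
  have J: "J \<subseteq> {..<n}" using assms(1) by (simp add: kwise_weights_def)
  have c: "wexp n \<mu> (\<lambda>x. cos (real j * ((S x - \<theta>) / M))) \<le> 4 * exp (- real k) + exp (- ((real j / M)\<^sup>2 / 8))"
    if j: "j \<in> {1..<m}" for j
  proof -
    define a where "a = real j / M"
    define b where "b = - (real j * \<theta> / M)"
    have am: "0 \<le> a" "a \<le> real m / M" using j M by (auto simp: a_def divide_right_mono)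
    then have "a\<^sup>2 \<le> (real m / M)\<^sup>2" by (rule power_mono[rotated])
    then have "a\<^sup>2 * exp 3 \<le> real k" using M(4) by (smt (verit) mult_right_mono exp_gt_zero)
    from wexp_cos_close[OF assms(1-4) this, of b]
    have 1: "\<bar>wexp n \<mu> (\<lambda>x. cos (a * S x + b)) - wexp n (uniform_weights n) (\<lambda>x. cos (a * S x + b))\<bar> \<le> 4 * exp (- real k)"
      by (simp add: S_def)
    have "\<bar>a * w i\<bar> \<le> 1" if "i \<in> J" for i
    proof -
      have "\<bar>a * w i\<bar> \<le> real m / M * \<tau>"
        unfolding abs_mult using am \<tau>[OF that] by (intro mult_mono) auto
      also have "\<dots> \<le> 1" using M by (simp add: field_simps)
      finally show ?thesis .
    qed
    then have "\<bar>wexp n (uniform_weights n) (\<lambda>x. cos (a * S x + b))\<bar> \<le> exp (- (a\<^sup>2 / 8))"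
      unfolding S_def by (intro wexp_uniform_cos_le J assms)
    with 1 have "wexp n \<mu> (\<lambda>x. cos (a * S x + b)) \<le> 4 * exp (- real k) + exp (- (a\<^sup>2 / 8))" by linarith
    moreover have "a * S x + b = real j * ((S x - \<theta>) / M)" for x
      by (simp add: a_def b_def diff_divide_distrib right_diff_distrib)
    ultimately show ?thesis by (simp add: a_def)
  qed
  have "wexp n \<mu> (\<lambda>x. fejer m ((S x - \<theta>) / M)) =
      1 + 2 * (\<Sum>j=1..<m. (1 - real j / real m) * wexp n \<mu> (\<lambda>x. cos (real j * ((S x - \<theta>) / M))))"
    unfolding fejer_def wexp_add wexp_cmult wexp_sum wexp_const[OF assms(1)] ..
  also have "\<dots> \<le> 1 + 2 * (\<Sum>j=1..<m. 4 * exp (- real k) + exp (- ((real j / M)\<^sup>2 / 8)))"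
  proof (intro add_left_mono mult_left_mono sum_mono)
    fix j assume j: "j \<in> {1..<m}"
    have "(1 - real j / real m) * wexp n \<mu> (\<lambda>x. cos (real j * ((S x - \<theta>) / M))) \<le>
        (1 - real j / real m) * (4 * exp (- real k) + exp (- ((real j / M)\<^sup>2 / 8)))"
      using c[OF j] j by (intro mult_left_mono) auto
    also have "\<dots> \<le> 1 * (4 * exp (- real k) + exp (- ((real j / M)\<^sup>2 / 8)))"
      by (intro mult_right_mono) auto
    finally show "(1 - real j / real m) * wexp n \<mu> (\<lambda>x. cos (real j * ((S x - \<theta>) / M))) \<le>
       4 * exp (- real k) + exp (- ((real j / M)\<^sup>2 / 8))" by simp
  qed auto
  also have "\<dots> = 1 + 8 * (real (m - 1) * exp (- real k)) + 2 * (\<Sum>j=1..<m. exp (- ((real j / M)\<^sup>2 / 8)))"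
    by (simp add: sum.distrib)
  also have "\<dots> \<le> 1 + 8 * 1 + 2 * (4 * M)"
  proof (intro add_mono mult_left_mono sum_gaussian_le M)
    have "real (m - 1) * exp (- real k) \<le> real m * exp (- real k)" by (intro mult_right_mono) auto
    then show "real (m - 1) * exp (- real k) \<le> 1" using M by linarith
  qed auto
  also have "\<dots> \<le> 17 * M" using M by simp
  finally show ?thesis by (simp add: S_def)
qed

lemma sum_inverse_le: "N > 0 \<Longrightarrow> (\<Sum>m=1..N. 1 / real m) \<le> 1 + ln (real N)"
proof (induction N rule: nat_induct_non_zero)
  case (Suc N)
  have "ln (real N / real (Suc N)) \<le> real N / real (Suc N) - 1"
    using Suc by (intro ln_le_minus_one) auto
  then have "1 / real (Suc N) \<le> ln (real (Suc N)) - ln (real N)"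
    using Suc by (simp add: ln_div field_simps)
  then show ?case using Suc by simp
qed auto

text \<open>Chebyshev: for a threshold beyond \<open>M\<close> the sign can differ from
  \<open>sign_pm (- \<theta>)\<close> only if the sum exceeds \<open>M\<close> in absolute
  value.\<close>

lemma wexp_sign_far:
  assumes "kwise_weights n k J \<mu>" "k \<ge> 2" "(\<Sum>i\<in>J. (w i)\<^sup>2) = 1" "0 < M" "M < \<bar>\<theta>\<bar>"
  shows "\<bar>wexp n \<mu> (\<lambda>x. sign_pm ((\<Sum>i\<in>J. w i * x i) - \<theta>)) - sign_pm (- \<theta>)\<bar> \<le> 2 / M\<^sup>2"
proof -
  have "\<bar>wexp n \<mu> (\<lambda>x. sign_pm ((\<Sum>i\<in>J. w i * x i) - \<theta>)) - wexp n \<mu> (\<lambda>_. sign_pm (- \<theta>))\<bar> \<le>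
     wexp n \<mu> (\<lambda>x. 2 / M\<^sup>2 * (\<Sum>i\<in>J. w i * x i)\<^sup>2)"
  proof (rule wexp_abs_diff_le[OF assms(1)])
    fix x :: "nat \<Rightarrow> real"
    define s where "s = (\<Sum>i\<in>J. w i * x i)"
    have "\<bar>sign_pm (s - \<theta>) - sign_pm (- \<theta>)\<bar> \<le> 2 / M\<^sup>2 * s\<^sup>2"
    proof (cases "\<bar>s\<bar> \<le> M")
      case True
      then have "sign_pm (s - \<theta>) = sign_pm (- \<theta>)" using assms by (auto simp: sign_pm_def)
      then show ?thesis by simp
    next
      case False
      then have "M\<^sup>2 \<le> s\<^sup>2" using assms(4) by (simp add: abs_le_square_iff[symmetric])
      then have "2 \<le> 2 / M\<^sup>2 * s\<^sup>2" using assms(4) by (simp add: field_simps)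
      then show ?thesis by (auto simp: sign_pm_def)
    qed
    then show "\<bar>sign_pm ((\<Sum>i\<in>J. w i * x i) - \<theta>) - sign_pm (- \<theta>)\<bar> \<le> 2 / M\<^sup>2 * (\<Sum>i\<in>J. w i * x i)\<^sup>2"
      by (simp add: s_def)
  qed
  then show ?thesis unfolding wexp_cmult wexp_square[OF assms(1,2)] wexp_const[OF assms(1)] assms(3) by simp
qed

lemma wexp_sign_fejer_int:
  assumes "kwise_weights n k J \<mu>" "even k" "k \<ge> 2" "(\<Sum>i\<in>J. (w i)\<^sup>2) = 1"
    and \<tau>: "\<And>i. i \<in> J \<Longrightarrow> \<bar>w i\<bar> \<le> \<tau>" "0 \<le> \<tau>"
    and M: "M \<ge> 1" "N0 > 0" "N0 \<le> N" "real N0 * \<tau> \<le> M"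
    and N: "(real N / M)\<^sup>2 * exp 3 \<le> real k" "real N * exp (- real k) \<le> 1"
    and \<theta>: "\<bar>\<theta>\<bar> \<le> M"
  shows "\<bar>pi * wexp n \<mu> (\<lambda>x. sign_pm ((\<Sum>i\<in>J. w i * x i) - \<theta>)) -
           wexp n \<mu> (\<lambda>x. fejer_int N (((\<Sum>i\<in>J. w i * x i) - \<theta>) / M))\<bar> \<le>
     pi * (34 * M / real N0 + 272 * (M / real N) * (1 + ln (real N0)) + 1 / M\<^sup>2)"
proof -
  define S where "S x = (\<Sum>i\<in>J. w i * x i)" for x :: "nat \<Rightarrow> real"
  define y where "y x = (S x - \<theta>) / M" for x
  have k: "k > 0" using assms by simp
  have F: "wexp n \<mu> (\<lambda>x. fejer m (y x)) \<le> 17 * M" if "m \<in> {1..N0}" for m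
    unfolding y_def S_def
  proof (rule wexp_fejer_le[OF assms(1,2) k assms(4) \<tau>(1) M(1)])
    have mN: "real m \<le> real N0" "real m \<le> real N" using that M by auto
    show "m > 0" using that by simp
    show "real m * \<tau> \<le> M" using mN M(4) \<tau>(2) by (meson mult_right_mono order_trans)
    have "(real m / M)\<^sup>2 \<le> (real N / M)\<^sup>2" using mN M by (intro power_mono divide_right_mono) auto
    then show "(real m / M)\<^sup>2 * exp 3 \<le> real k" using N(1) by (smt (verit) mult_right_mono exp_gt_zero)
    show "real m * exp (- real k) \<le> 1" using N(2) mN by (meson mult_right_mono order_trans exp_ge_zero)
  qed
  have "\<bar>wexp n \<mu> (\<lambda>x. pi * sign_pm (S x - \<theta>)) - wexp n \<mu> (\<lambda>x. fejer_int N (y x))\<bar> \<le>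
    wexp n \<mu> (\<lambda>x. 2 * pi / real N0 * fejer N0 (y x) +
      (\<Sum>m=1..N0. 4 * pi\<^sup>2 / real N / real m * fejer m (y x)) + 9 / 4 / M\<^sup>2 * (S x)\<^sup>2)"
  proof (rule wexp_abs_diff_le[OF assms(1)])
    fix x :: "nat \<Rightarrow> real"
    have sg: "sign_pm (S x - \<theta>) = sign_pm (y x)" using M by (auto simp: sign_pm_def y_def zero_le_divide_iff)
    have "(if \<bar>y x\<bar> > pi then 3 * \<bar>y x\<bar> else 0) \<le> 9 / 4 / M\<^sup>2 * (S x)\<^sup>2"
    proof (cases "\<bar>y x\<bar> > pi")
      case True
      \<comment> \<open>Outside one period \<open>|y| > 3\<close>, and
        \<open>|y| \<le> t + 1\<close> because \<open>|\<theta>| \<le> M\<close>; so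
        \<open>t \<ge> 2\<close>, and from there on \<open>3 * (t + 1) \<le> 9/4 * t^2\<close>. This
        trades the linear error for a second moment.\<close>
      define t where "t = \<bar>S x\<bar> / M"
      have yt: "\<bar>y x\<bar> \<le> t + 1"
      proof -
        have "\<bar>y x\<bar> = \<bar>S x - \<theta>\<bar> / M" using M by (simp add: y_def)
        also have "\<dots> \<le> (\<bar>S x\<bar> + M) / M" using M \<theta> by (intro divide_right_mono) auto
        finally show ?thesis using M by (simp add: t_def add_divide_distrib)
      qed
      then have t2: "t \<ge> 2" using True pi_gt3 by linarith
      then have "t * 2 \<le> t * t" by (intro mult_left_mono) auto
      then have "3 * \<bar>y x\<bar> \<le> 9 / 4 * (t * t)" using yt t2 by linarith
      also have "t * t = (S x)\<^sup>2 / M\<^sup>2" by (simp add: t_def power2_eq_square flip: abs_mult)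
      finally show ?thesis using True by simp
    qed auto
    moreover have "N > 0" using M by simp
    ultimately have "\<bar>pi * sign_pm (y x) - fejer_int N (y x)\<bar> \<le> 2 * pi * (fejer N0 (y x) / real N0) + 4 * pi\<^sup>2 / real N * (\<Sum>m=1..N0. fejer m (y x) / real m) + 9 / 4 / M\<^sup>2 * (S x)\<^sup>2"
      using sign_pm_fejer_approx[of N N0 "y x"] M(2) by linarith
    then show "\<bar>pi * sign_pm (S x - \<theta>) - fejer_int N (y x)\<bar> \<le> 2 * pi / real N0 * fejer N0 (y x) +
      (\<Sum>m=1..N0. 4 * pi\<^sup>2 / real N / real m * fejer m (y x)) + 9 / 4 / M\<^sup>2 * (S x)\<^sup>2"
      unfolding sg by (simp add: sum_distrib_left)
  qed
  note approx = this
  have q94: "9 / 4 / M\<^sup>2 \<le> pi / M\<^sup>2" using pi_gt3 by (intro divide_right_mono) auto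
  note approx
  also have "wexp n \<mu> (\<lambda>x. 2 * pi / real N0 * fejer N0 (y x) +
      (\<Sum>m=1..N0. 4 * pi\<^sup>2 / real N / real m * fejer m (y x)) + 9 / 4 / M\<^sup>2 * (S x)\<^sup>2) =
      2 * pi / real N0 * wexp n \<mu> (\<lambda>x. fejer N0 (y x)) +
      (\<Sum>m=1..N0. 4 * pi\<^sup>2 / real N / real m * wexp n \<mu> (\<lambda>x. fejer m (y x))) + 9 / 4 / M\<^sup>2"
    unfolding wexp_add wexp_sum wexp_cmult S_def wexp_square[OF assms(1,3)] assms(4) by simp
  also have "\<dots> \<le> 2 * pi / real N0 * (17 * M) + (\<Sum>m=1..N0. 4 * pi\<^sup>2 / real N / real m * (17 * M)) + pi / M\<^sup>2"
    using M q94 by (intro add_mono sum_mono mult_left_mono F) auto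
  also have "(\<Sum>m=1..N0. 4 * pi\<^sup>2 / real N / real m * (17 * M)) = pi * (68 * pi * (M / real N)) * (\<Sum>m=1..N0. 1 / real m)"
    unfolding sum_distrib_left by (intro sum.cong refl) (simp add: power2_eq_square)
  also have "\<dots> \<le> pi * (68 * 4 * (M / real N)) * (1 + ln (real N0))"
    using M pi_less_4 by (intro mult_mono sum_inverse_le mult_right_mono) (auto intro!: mult_nonneg_nonneg sum_nonneg)
  finally have "\<bar>pi * wexp n \<mu> (\<lambda>x. sign_pm (S x - \<theta>)) - wexp n \<mu> (\<lambda>x. fejer_int N (y x))\<bar> \<le>
     2 * pi / real N0 * (17 * M) + pi * (68 * 4 * (M / real N)) * (1 + ln (real N0)) + pi / M\<^sup>2"
    unfolding wexp_cmult by simp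
  also have "\<dots> = pi * (34 * M / real N0 + 272 * (M / real N) * (1 + ln (real N0)) + 1 / M\<^sup>2)"
    by (simp add: algebra_simps)
  finally show ?thesis by (simp add: S_def y_def)
qed

text \<open>The linear term has exactly the same mean under both weights. Each sine is a cosine with
  phase shifted by \<open>pi / 2\<close>, and its coefficient is at most 1.\<close>

lemma wexp_fejer_int_close:
  assumes "kwise_weights n k J \<mu>" "even k" "k \<ge> 2" "(\<Sum>i\<in>J. (w i)\<^sup>2) = 1"
    and M: "M \<ge> 1" and N: "(real N / M)\<^sup>2 * exp 3 \<le> real k"
  shows "\<bar>wexp n \<mu> (\<lambda>x. fejer_int N (((\<Sum>i\<in>J. w i * x i) - \<theta>) / M)) -
          wexp n (uniform_weights n) (\<lambda>x. fejer_int N (((\<Sum>i\<in>J. w i * x i) - \<theta>) / M))\<bar> \<le> 8 * real N * exp (- real k)"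
proof -
  define S where "S x = (\<Sum>i\<in>J. w i * x i)" for x :: "nat \<Rightarrow> real"
  define y where "y x = (S x - \<theta>) / M" for x
  have J: "J \<subseteq> {..<n}" using assms(1) by (simp add: kwise_weights_def)
  note u = kwise_weights_uniform[OF J, of k]
  have lin: "wexp n \<nu> y = (wexp n \<nu> (\<lambda>x. S x ^ 1) - \<theta>) / M" if "kwise_weights n k J \<nu>" for \<nu>
  proof -
    have "wexp n \<nu> y = wexp n \<nu> (\<lambda>x. 1 / M * (S x ^ 1 - \<theta>))" by (simp add: y_def[abs_def])
    then show ?thesis unfolding wexp_cmult wexp_diff wexp_const[OF that] by simp
  qed
  have "wexp n \<mu> (\<lambda>x. S x ^ 1) = wexp n (uniform_weights n) (\<lambda>x. S x ^ 1)"
    unfolding S_def using assms(3) by (intro wexp_power_eq[OF assms(1) u]) simp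
  then have ly: "wexp n \<mu> y = wexp n (uniform_weights n) y" by (simp add: lin[OF assms(1)] lin[OF u])
  have s: "\<bar>wexp n \<mu> (\<lambda>x. sin (real j * y x)) - wexp n (uniform_weights n) (\<lambda>x. sin (real j * y x))\<bar> \<le> 4 * exp (- real k)"
    if j: "j \<in> {1..<N}" for j
  proof -
    define a where "a = real j / M"
    define b where "b = - (real j * \<theta> / M) - pi / 2"
    have am: "0 \<le> a" "a \<le> real N / M" using j M by (auto simp: a_def divide_right_mono)
    then have "a\<^sup>2 \<le> (real N / M)\<^sup>2" by (rule power_mono[rotated])
    then have "a\<^sup>2 * exp 3 \<le> real k" using N by (smt (verit) mult_right_mono exp_gt_zero)
    from wexp_cos_close[OF assms(1,2) _ assms(4) this, of b] assms(3)
    have 1: "\<bar>wexp n \<mu> (\<lambda>x. cos (a * S x + b)) - wexp n (uniform_weights n) (\<lambda>x. cos (a * S x + b))\<bar> \<le> 4 * exp (- real k)"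
      by (simp add: S_def)
    have e: "a * S x + b = real j * y x - pi / 2" for x
      by (simp add: a_def b_def y_def diff_divide_distrib right_diff_distrib)
    have "cos (a * S x + b) = sin (real j * y x)" for x
      unfolding e by (simp add: cos_diff)
    then show ?thesis using 1 by simp
  qed
  have "wexp n \<mu> (\<lambda>x. fejer_int N (y x)) - wexp n (uniform_weights n) (\<lambda>x. fejer_int N (y x)) =
     2 * (\<Sum>j=1..<N. (1 - real j / real N) / real j * (wexp n \<mu> (\<lambda>x. sin (real j * y x)) - wexp n (uniform_weights n) (\<lambda>x. sin (real j * y x))))"
    unfolding fejer_int_def wexp_add wexp_cmult wexp_sum using ly
    by (simp add: right_diff_distrib sum_subtractf)
  also have "\<bar>\<dots>\<bar> \<le> 2 * (\<Sum>j=1..<N. 1 * (4 * exp (- real k)))"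
    unfolding abs_mult
  proof (intro mult_mono order_trans[OF sum_abs] sum_mono)
    fix j assume j: "j \<in> {1..<N}"
    have "0 \<le> 1 - real j / real N" "1 - real j / real N \<le> 1" "1 \<le> real j"
      using j by auto
    then have "0 \<le> 1 - real j / real N" "1 - real j / real N \<le> real j" "0 < real j" by linarith+
    then have "\<bar>(1 - real j / real N) / real j\<bar> \<le> 1" by simp
    then show "\<bar>(1 - real j / real N) / real j * (wexp n \<mu> (\<lambda>x. sin (real j * y x)) - wexp n (uniform_weights n) (\<lambda>x. sin (real j * y x)))\<bar>
       \<le> 1 * (4 * exp (- real k))"
      unfolding abs_mult using s[OF j] by (intro mult_mono) auto
  qed (auto intro!: sum_nonneg)
  also have "\<dots> \<le> 8 * real N * exp (- real k)" by simp
  finally show ?thesis by (simp add: S_def y_def)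
qed

lemma regular_near:
  assumes "kwise_weights n k J \<mu>" "even k" "k \<ge> 2" "(\<Sum>i\<in>J. (w i)\<^sup>2) = 1"
    and \<tau>: "\<And>i. i \<in> J \<Longrightarrow> \<bar>w i\<bar> \<le> \<tau>" "0 \<le> \<tau>"
    and M: "M \<ge> 1" "N0 > 0" "N0 \<le> N" "real N0 * \<tau> \<le> M"
    and N: "(real N / M)\<^sup>2 * exp 3 \<le> real k" "real N * exp (- real k) \<le> 1"
    and \<theta>: "\<bar>\<theta>\<bar> \<le> M"
  shows "\<bar>wexp n \<mu> (\<lambda>x. sign_pm ((\<Sum>i\<in>J. w i * x i) - \<theta>)) -
           wexp n (uniform_weights n) (\<lambda>x. sign_pm ((\<Sum>i\<in>J. w i * x i) - \<theta>))\<bar> \<le>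
     2 * (34 * M / real N0 + 272 * (M / real N) * (1 + ln (real N0)) + 1 / M\<^sup>2) + 3 * real N * exp (- real k)"
proof -
  have J: "J \<subseteq> {..<n}" using assms(1) by (simp add: kwise_weights_def)
  note u = kwise_weights_uniform[OF J, of k]
  let ?s = "\<lambda>\<nu>. wexp n \<nu> (\<lambda>x. sign_pm ((\<Sum>i\<in>J. w i * x i) - \<theta>))"
  let ?B = "34 * M / real N0 + 272 * (M / real N) * (1 + ln (real N0)) + 1 / M\<^sup>2"
  have "\<bar>pi * ?s \<mu> - pi * ?s (uniform_weights n)\<bar> \<le> 2 * (pi * ?B) + 8 * real N * exp (- real k)"
    using wexp_sign_fejer_int[OF assms] wexp_sign_fejer_int[OF u assms(2-)]
      wexp_fejer_int_close[OF assms(1-4) M(1) N(1), of \<theta>] by linarith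
  also have "\<dots> \<le> pi * (2 * ?B + 3 * real N * exp (- real k))"
  proof -
    have "8 * (real N * exp (- real k)) \<le> pi * 3 * (real N * exp (- real k))"
      using pi_gt3 by (intro mult_right_mono) auto
    then show ?thesis by (simp add: algebra_simps)
  qed
  finally have "pi * \<bar>?s \<mu> - ?s (uniform_weights n)\<bar> \<le> pi * (2 * ?B + 3 * real N * exp (- real k))"
    by (simp add: abs_mult flip: right_diff_distrib)
  then show ?thesis by simp
qed

lemma two_div_square_exp: "x > 0 \<Longrightarrow> exp (- x) \<le> 2 / x\<^sup>2" for x :: real
  using power_div_fact_le_exp[of x 2] by (simp add: exp_minus field_simps)

text \<open>Balances the error terms. \<open>M = 1 / sqrt e\<close> makes \<open>1 / M^2\<close>
  equal to \<open>e\<close>; \<open>N0\<close>, about \<open>M / e\<close>, is the largest order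
  with \<open>N0 * e \<le> M\<close>, as the decay of the kernel coefficients requires;
  \<open>N\<close>, about \<open>M * T\<close>, carries the factor \<open>l\<close> in
  \<open>T = 2 * l / e\<close> that cancels \<open>1 + ln N0\<close>. Thresholds beyond
  \<open>M\<close> are left to Chebyshev.\<close>

lemma regular_unit:
  assumes "kwise_weights n k J \<mu>" "even k" "(\<Sum>i\<in>J. (w i)\<^sup>2) = 1"
    and w: "\<And>i. i \<in> J \<Longrightarrow> \<bar>w i\<bar> \<le> e"
    and e: "0 < e" "e \<le> 1/2" and k: "500 * (ln (1/e))\<^sup>2 / e\<^sup>2 \<le> real k"
  shows "\<bar>wexp n \<mu> (\<lambda>x. sign_pm ((\<Sum>i\<in>J. w i * x i) - \<theta>)) -
           wexp n (uniform_weights n) (\<lambda>x. sign_pm ((\<Sum>i\<in>J. w i * x i) - \<theta>))\<bar> \<le> 1100 * e"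
proof -
  define l where "l = ln (1/e)"
  have l: "l \<ge> 2/3"
  proof -
    have "ln 2 \<le> l" unfolding l_def using e by (subst ln_le_cancel_iff) (auto simp: field_simps)
    then show ?thesis using ln2_ge_two_thirds by linarith
  qed
  define M where "M = 1 / sqrt e"
  have se: "0 < sqrt e" "sqrt e \<le> 1" "e \<le> sqrt e" "sqrt e * sqrt e = e"
    using e by (auto simp: real_le_rsqrt power2_eq_square mult_left_le_one_le)
  have M: "1 \<le> M" "M \<le> 1 / e" "M\<^sup>2 = 1 / e"
    using se e by (auto simp: M_def field_simps power2_eq_square)
  define T where "T = 2 * l / e"
  have T: "1 / e \<le> T" "2 \<le> 1 / e" using l e by (auto simp: T_def field_simps)
  have k_big: "1 / e\<^sup>2 \<le> real k" "500 * l / e\<^sup>2 * (2/3) \<le> real k"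
  proof -
    have ll: "2/3 * (2/3) \<le> l * l" "2/3 * l \<le> l * l"
      using mult_mono[of "2/3" l "2/3" l] mult_right_mono[of "2/3" l l] l by auto
    have "1 / e\<^sup>2 \<le> 500 * l\<^sup>2 / e\<^sup>2" using ll e by (intro divide_right_mono) (auto simp: power2_eq_square)
    then show "1 / e\<^sup>2 \<le> real k" using k unfolding l_def by linarith
    have "500 * l * (2/3) / e\<^sup>2 \<le> 500 * l\<^sup>2 / e\<^sup>2" using ll e by (intro divide_right_mono) (auto simp: power2_eq_square)
    then show "500 * l / e\<^sup>2 * (2/3) \<le> real k" using k unfolding l_def by simp
  qed
  have "1 / e \<le> 1 / e\<^sup>2" "4 \<le> 1 / e\<^sup>2"
    using T(2) mult_mono[OF T(2) T(2)] mult_right_mono[of 1 "1/e" "1/e"] e by (auto simp: power2_eq_square)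
  then have ke: "1 / e \<le> real k" "4 \<le> real k" using k_big by linarith+
  then have k2: "k \<ge> 2" by simp
  show ?thesis
  proof (cases "\<bar>\<theta>\<bar> \<le> M")
    case False
    have J: "J \<subseteq> {..<n}" using assms(1) by (simp add: kwise_weights_def)
    note u = kwise_weights_uniform[OF J, of k]
    have "2 / M\<^sup>2 = 2 * e" by (simp add: M)
    then show ?thesis
      using wexp_sign_far[OF assms(1) k2 assms(3), of M \<theta>] wexp_sign_far[OF u k2 assms(3), of M \<theta>] False M e by linarith
  next
    case True
    define N where "N = nat \<lceil>M * T\<rceil>"
    define N0 where "N0 = nat \<lfloor>M / e\<rfloor>"
    have MT: "M / e \<le> M * T" using T M by (metis mult_left_mono divide_inverse inverse_eq_divide order_trans zero_le_one)
    have Me: "2 \<le> M / e" "M / e \<le> 1 / e\<^sup>2"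
      using T mult_mono[OF M(1) T(2)] M divide_right_mono[of M "1/e" e] e by (auto simp: power2_eq_square)
    have N: "M * T \<le> real N" "real N \<le> M * T + 1" using M T e l by (auto simp: N_def T_def)
    have N2: "real N \<le> 2 * (M * T)" using N MT Me by linarith
    have N0: "real N0 \<le> M / e" "M / (2 * e) \<le> real N0"
    proof -
      show "real N0 \<le> M / e" using Me by (simp add: N0_def)
      have "M / e - 1 \<le> real N0" using Me by (simp add: N0_def)
      then show "M / (2 * e) \<le> real N0" using Me by (simp add: field_simps)
    qed
    have N0p: "N0 > 0" using N0 Me by (cases N0) auto
    have "real N0 \<le> real N" using N0 MT N by linarith
    then have N0N: "N0 \<le> N" by simp
    have NM: "real N / M \<le> 2 * T" using N2 M by (simp add: field_simps)
    have c1: "(real N / M)\<^sup>2 * exp 3 \<le> real k"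
    proof -
      \<comment> \<open>\<open>N / M \<le> 2 * T = 4 * l / e\<close>, so
        \<open>16 * 27 = 432\<close> is needed out of the 500 in the assumption on
        \<open>k\<close>.\<close>
      have "exp (3::real) = exp 1 ^ 3" by (simp flip: exp_of_nat_mult)
      also have "\<dots> \<le> 3 ^ 3" by (intro power_mono exp_le) auto
      finally have "exp (3::real) \<le> 27" by simp
      then have "(real N / M)\<^sup>2 * exp 3 \<le> (2 * T)\<^sup>2 * 27"
        using NM M by (intro mult_mono power_mono) auto
      also have "\<dots> = 432 * l\<^sup>2 / e\<^sup>2" by (simp add: T_def power2_eq_square)
      also have "\<dots> \<le> 500 * l\<^sup>2 / e\<^sup>2" by (intro divide_right_mono) auto
      finally show ?thesis using k by (simp add: l_def)
    qed
    have c2: "real N * exp (- real k) \<le> e / 3"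
    proof -
      have "M * T \<le> 1 / e * T" using M T e by (intro mult_right_mono) (auto intro: order_trans)
      also have "\<dots> = 2 * l / e\<^sup>2" by (simp add: T_def power2_eq_square)
      finally have "real N \<le> 4 * l / e\<^sup>2" using N2 by simp
      then have "real N \<le> real k / 10" using k_big by (simp add: field_simps)
      then have "real N * exp (- real k) \<le> real k / 10 * (2 / (real k)\<^sup>2)"
        using ke by (intro mult_mono two_div_square_exp) auto
      also have "\<dots> = 1 / (5 * real k)" using ke by (simp add: power2_eq_square field_simps)
      also have "\<dots> \<le> e / 3" using ke e by (simp add: field_simps)
      finally show ?thesis .
    qed
    have "M / real N0 \<le> 2 * e" using N0 N0p e by (simp add: field_simps)
    then have b1: "34 * M / real N0 \<le> 68 * e" by simp
    have b2: "272 * (M / real N) * (1 + ln (real N0)) \<le> 476 * e"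
    proof -
      have Np: "real N > 0" using N0N N0p by simp
      have "ln (real N0) \<le> ln (1 / e\<^sup>2)" using N0 Me N0p by (subst ln_le_cancel_iff) auto
      also have "\<dots> = 2 * l" using e by (simp add: l_def ln_div ln_realpow)
      finally have "1 + ln (real N0) \<le> 7/2 * l" using l by linarith
      moreover have "M / real N \<le> e / (2 * l)"
        using N(1) Np l e M by (simp add: T_def field_simps)
      moreover have "0 \<le> ln (real N0)" using N0p by simp
      ultimately have "272 * (M / real N) * (1 + ln (real N0)) \<le> 272 * (e / (2 * l)) * (7/2 * l)"
        using M e l by (intro mult_mono) auto
      also have "\<dots> = 476 * e" using l by simp
      finally show ?thesis .
    qed
    have "real N0 * e \<le> M" using N0 e by (simp add: field_simps)
    from regular_near[OF assms(1,2) k2 assms(3) w less_imp_le[OF e(1)] M(1) N0p N0N this c1 _ True] c2 e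
    have "\<bar>wexp n \<mu> (\<lambda>x. sign_pm ((\<Sum>i\<in>J. w i * x i) - \<theta>)) -
           wexp n (uniform_weights n) (\<lambda>x. sign_pm ((\<Sum>i\<in>J. w i * x i) - \<theta>))\<bar> \<le>
     2 * (34 * M / real N0 + 272 * (M / real N) * (1 + ln (real N0)) + 1 / M\<^sup>2) + 3 * real N * exp (- real k)"
      by simp
    \<comment> \<open>The sum is \<open>(2 * (68 + 476 + 1) + 1) * e = 1091 * e\<close>.\<close>
    then show ?thesis using b1 b2 c2 e by (simp add: M(3))
  qed
qed

text \<open>The sign is invariant under scaling, so the weights are normalised. \<open>k\<close> is
  lowered to an even number, which the step from 500 to 501 pays for. Vanishing weights cannot be
  normalised, but then the halfspace is constant.\<close>

lemma regular_fooling: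
  assumes kw: "kwise_weights n k J \<mu>"
    and w: "\<And>i. i \<in> J \<Longrightarrow> \<bar>w i\<bar> \<le> e * sqrt (\<Sum>i\<in>J. (w i)\<^sup>2)"
    and e: "0 < e" "e \<le> 1/2" and k: "501 * (ln (1/e))\<^sup>2 / e\<^sup>2 \<le> real k"
  shows "\<bar>wexp n \<mu> (\<lambda>x. sign_pm ((\<Sum>i\<in>J. w i * x i) - \<theta>)) -
           wexp n (uniform_weights n) (\<lambda>x. sign_pm ((\<Sum>i\<in>J. w i * x i) - \<theta>))\<bar> \<le> 1100 * e"
proof (cases "(\<Sum>i\<in>J. (w i)\<^sup>2) = 0")
  case True
  have J: "J \<subseteq> {..<n}" using kw by (simp add: kwise_weights_def)
  then have "finite J" using finite_subset by blast
  then have "w i = 0" if "i \<in> J" for i using True that by (simp add: sum_nonneg_eq_0_iff)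
  then have "(\<Sum>i\<in>J. w i * x i) = 0" for x by simp
  then show ?thesis using e wexp_const[OF kw] wexp_const[OF kwise_weights_uniform[OF J]] by simp
next
  case False
  define s where "s = sqrt (\<Sum>i\<in>J. (w i)\<^sup>2)"
  have s: "s > 0" "s\<^sup>2 = (\<Sum>i\<in>J. (w i)\<^sup>2)"
    using False sum_nonneg[of J "\<lambda>i. (w i)\<^sup>2"] by (auto simp: s_def less_le)
  define k' where "k' = (if even k then k else k - 1)"
  have l: "ln (1/e) \<ge> 2/3"
  proof -
    have "ln 2 \<le> ln (1/e)" using e by (subst ln_le_cancel_iff) (auto simp: field_simps)
    then show ?thesis using ln2_ge_two_thirds by linarith
  qed
  have "1 \<le> (ln (1/e))\<^sup>2 / e\<^sup>2"
  proof -
    have "e\<^sup>2 \<le> (2/3)\<^sup>2" using e by (intro power_mono) auto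
    also have "\<dots> \<le> (ln (1/e))\<^sup>2" using l by (intro power_mono) auto
    finally show ?thesis using e by (simp add: field_simps)
  qed
  moreover have "real k \<le> real k' + 1" "k' \<le> k" "even k'" by (auto simp: k'_def)
  ultimately have k': "500 * (ln (1/e))\<^sup>2 / e\<^sup>2 \<le> real k'" "k' \<le> k" "even k'" using k by linarith+
  have "(\<Sum>i\<in>J. (w i / s)\<^sup>2) = 1"
    using s False by (simp add: power_divide flip: sum_divide_distrib)
  moreover have "\<bar>w i / s\<bar> \<le> e" if "i \<in> J" for i using w[OF that] s by (simp add: field_simps flip: s_def)
  ultimately have "\<bar>wexp n \<mu> (\<lambda>x. sign_pm ((\<Sum>i\<in>J. w i / s * x i) - \<theta> / s)) -
           wexp n (uniform_weights n) (\<lambda>x. sign_pm ((\<Sum>i\<in>J. w i / s * x i) - \<theta> / s))\<bar> \<le> 1100 * e"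
    using e k' by (intro regular_unit[OF kwise_weights_mono[OF kw k'(2) order_refl]]) auto
  moreover have "sign_pm ((\<Sum>i\<in>J. w i / s * x i) - \<theta> / s) = sign_pm ((\<Sum>i\<in>J. w i * x i) - \<theta>)" for x
  proof -
    have "(\<Sum>i\<in>J. w i / s * x i) - \<theta> / s = ((\<Sum>i\<in>J. w i * x i) - \<theta>) / s"
      by (simp add: diff_divide_distrib sum_divide_distrib)
    then show ?thesis using s by (simp add: sign_pm_def zero_le_divide_iff)
  qed
  ultimately show ?thesis by simp
qed

section \<open>Conditioning on a set of coordinates\<close>

definition cond_weights :: "nat set \<Rightarrow> (nat \<Rightarrow> real) \<Rightarrow> ((nat \<Rightarrow> real) \<Rightarrow> real) \<Rightarrow> (nat \<Rightarrow> real) \<Rightarrow> real" where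
  "cond_weights H z \<mu> x = 2 ^ card H * of_bool (restrict x H = z) * \<mu> x"

text \<open>A factor \<open>1 + z i * x i\<close> is 2 where \<open>x\<close> agrees with
  \<open>z\<close> and 0 where it does not; written like this, the indicator expands into
  monomials.\<close>

lemma cond_weights_eq_prod:
  assumes "x \<in> cube n" "H \<subseteq> {..<n}" "z \<in> signs H"
  shows "2 ^ card H * of_bool (restrict x H = z) = (\<Prod>i\<in>H. 1 + z i * x i)"
proof (cases "restrict x H = z")
  case True
  have "1 + z i * x i = 2" if "i \<in> H" for i
    using that assms cube_sq[of x n i] by (auto simp flip: True)
  then have "(\<Prod>i\<in>H. 1 + z i * x i) = (\<Prod>i\<in>H. 2)" by (intro prod.cong) auto
  then show ?thesis using True by simp
next
  case False
  moreover have "z \<in> extensional H" using assms(3) by (simp add: signs_def PiE_def)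
  ultimately obtain i where i: "i \<in> H" "x i \<noteq> z i"
    using extensionalityI[of "restrict x H" H z] by (auto simp: restrict_extensional)
  have "x i \<in> {-1,1}" "z i \<in> {-1,1}" using i assms by (auto simp: signs_def PiE_def Pi_def)
  then have "1 + z i * x i = 0" using i by auto
  then show ?thesis using False i assms(2) finite_subset[OF assms(2)] by (auto intro!: prod_zero[symmetric])
qed

text \<open>Expanding the indicator over the subsets \<open>B\<close> of \<open>H\<close> turns a
  monomial over \<open>A\<close> into monomials over \<open>B \<union> A\<close>, of degree at most
  \<open>k\<close>. Only \<open>B = A = {}\<close> survives, so the factor \<open>2 ^ card H\<close>
  is exactly the right normalisation.\<close>

lemma kwise_weights_cond:
  assumes kw: "kwise_weights n k {..<n} \<mu>" and H: "H \<subseteq> {..<n}" "card H \<le> k" and z: "z \<in> signs H"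
  shows "kwise_weights n (k - card H) ({..<n} - H) (cond_weights H z \<mu>)"
  unfolding kwise_weights_def
proof (intro conjI allI impI ballI)
  fix x assume "x \<in> cube n"
  then show "0 \<le> cond_weights H z \<mu> x"
    using kwise_weights_nonneg[OF kw] by (simp add: cond_weights_def)
next
  fix A assume A: "A \<subseteq> {..<n} - H" "card A \<le> k - card H"
  have fin: "finite A" "finite H" using A H by (auto intro: finite_subset)
  have "wexp n (cond_weights H z \<mu>) (\<lambda>x. \<Prod>i\<in>A. x i) =
     wexp n \<mu> (\<lambda>x. \<Sum>B\<in>Pow H. (\<Prod>i\<in>B. z i) * (\<Prod>i\<in>B \<union> A. x i))"
    unfolding wexp_def
  proof (rule sum.cong[OF refl])
    fix x assume x: "x \<in> cube n"
    have "(\<Prod>i\<in>H. 1 + z i * x i) * (\<Prod>i\<in>A. x i) = (\<Sum>B\<in>Pow H. (\<Prod>i\<in>B. z i * x i)) * (\<Prod>i\<in>A. x i)"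
      using prod_add[OF fin(2), of "\<lambda>i. z i * x i" "\<lambda>_. 1"] by (simp add: add.commute)
    also have "\<dots> = (\<Sum>B\<in>Pow H. (\<Prod>i\<in>B. z i * x i) * (\<Prod>i\<in>A. x i))" by (rule sum_distrib_right)
    also have "\<dots> = (\<Sum>B\<in>Pow H. (\<Prod>i\<in>B. z i) * (\<Prod>i\<in>B \<union> A. x i))"
    proof (rule sum.cong[OF refl])
      fix B assume "B \<in> Pow H"
      then have "B \<inter> A = {}" "finite B" using A fin by (auto intro: finite_subset)
      then show "(\<Prod>i\<in>B. z i * x i) * (\<Prod>i\<in>A. x i) = (\<Prod>i\<in>B. z i) * (\<Prod>i\<in>B \<union> A. x i)"
        using fin by (simp add: prod.union_disjoint prod.distrib)
    qed
    finally show "cond_weights H z \<mu> x * (\<Prod>i\<in>A. x i) = \<mu> x * (\<Sum>B\<in>Pow H. (\<Prod>i\<in>B. z i) * (\<Prod>i\<in>B \<union> A. x i))"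
      by (simp add: cond_weights_def cond_weights_eq_prod[OF x H(1) z, symmetric])
  qed
  also have "\<dots> = (\<Sum>B\<in>Pow H. (\<Prod>i\<in>B. z i) * of_bool (B \<union> A = {}))"
    unfolding wexp_sum wexp_cmult
  proof (rule sum.cong[OF refl])
    fix B assume B: "B \<in> Pow H"
    have "card (B \<union> A) \<le> card B + card A" by (rule card_Un_le)
    also have "\<dots> \<le> k" using card_mono[OF fin(2), of B] B A H by auto
    finally have "wexp n \<mu> (\<lambda>x. \<Prod>i\<in>B \<union> A. x i) = of_bool (B \<union> A = {})"
      using kw A B H unfolding kwise_weights_def by (metis Diff_subset PowD Un_least order_trans)
    then show "(\<Prod>i\<in>B. z i) * wexp n \<mu> (\<lambda>x. \<Prod>i\<in>B \<union> A. x i) = (\<Prod>i\<in>B. z i) * of_bool (B \<union> A = {})" by simp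
  qed
  also have "\<dots> = (\<Sum>B\<in>Pow H. if B = {} then of_bool (A = {}) else 0)"
    by (intro sum.cong refl) auto
  also have "\<dots> = of_bool (A = {})" using fin(2) by (subst sum.delta) auto
  finally show "wexp n (cond_weights H z \<mu>) (\<lambda>x. \<Prod>i\<in>A. x i) = of_bool (A = {})" .
qed auto

lemma wexp_cond_cong:
  assumes "\<And>x. x \<in> cube n \<Longrightarrow> restrict x H = z \<Longrightarrow> f x = g x"
  shows "wexp n (cond_weights H z \<mu>) f = wexp n (cond_weights H z \<mu>) g"
  unfolding wexp_def using assms by (intro sum.cong) (auto simp: cond_weights_def)

lemma wexp_decompose:
  assumes "H \<subseteq> {..<n}"
  shows "wexp n \<mu> f = (\<Sum>z\<in>signs H. wexp n (cond_weights H z \<mu>) f) / 2 ^ card H"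
proof -
  have fin: "finite H" using assms finite_subset by blast
  have "(\<Sum>z\<in>signs H. wexp n (cond_weights H z \<mu>) f) =
     (\<Sum>x\<in>cube n. \<Sum>z\<in>signs H. of_bool (restrict x H = z) * (2 ^ card H * \<mu> x * f x))"
    unfolding wexp_def by (subst sum.swap) (simp add: cond_weights_def mult_ac)
  also have "\<dots> = (\<Sum>x\<in>cube n. 2 ^ card H * \<mu> x * f x)"
  proof (rule sum.cong[OF refl])
    fix x assume "x \<in> cube n"
    then have "restrict x H \<in> signs H" using assms by (auto simp: signs_def PiE_def Pi_def)
    then show "(\<Sum>z\<in>signs H. of_bool (restrict x H = z) * (2 ^ card H * \<mu> x * f x)) = 2 ^ card H * \<mu> x * f x"
      using fin by (simp add: of_bool_def if_distrib[of "\<lambda>c. c * _"] sum.delta' cong: if_cong)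
  qed
  also have "\<dots> = 2 ^ card H * wexp n \<mu> f" by (simp add: wexp_def sum_distrib_left mult_ac)
  finally show ?thesis by simp
qed

lemma wexp_head:
  assumes "kwise_weights n k {..<n} \<mu>" "H \<subseteq> {..<n}" "card H \<le> k"
  shows "wexp n \<mu> (\<lambda>x. f (restrict x H)) = (\<Sum>z\<in>signs H. f z) / 2 ^ card H"
proof -
  have "wexp n (cond_weights H z \<mu>) (\<lambda>x. f (restrict x H)) = f z" if "z \<in> signs H" for z
  proof -
    have "wexp n (cond_weights H z \<mu>) (\<lambda>x. f (restrict x H)) = wexp n (cond_weights H z \<mu>) (\<lambda>_. f z)"
      by (rule wexp_cond_cong) simp
    also have "\<dots> = f z" by (rule wexp_const[OF kwise_weights_cond[OF assms that]])
    finally show ?thesis .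
  qed
  then show ?thesis by (simp add: wexp_decompose[OF assms(2), of \<mu>])
qed

lemma regular_tail_fooling:
  assumes kw: "kwise_weights n k {..<n} \<mu>" and H: "H \<subseteq> {..<n}"
    and w: "\<And>i. i \<in> {..<n} - H \<Longrightarrow> \<bar>w i\<bar> \<le> e * sqrt (\<Sum>i\<in>{..<n} - H. (w i)\<^sup>2)"
    and e: "0 < e" "e \<le> 1/2" and k: "real (card H) + 501 * (ln (1/e))\<^sup>2 / e\<^sup>2 \<le> real k"
  shows "\<bar>wexp n \<mu> (\<lambda>x. sign_pm ((\<Sum>i<n. w i * x i) - \<theta>)) -
           wexp n (uniform_weights n) (\<lambda>x. sign_pm ((\<Sum>i<n. w i * x i) - \<theta>))\<bar> \<le> 2200 * e"
proof -
  let ?T = "{..<n} - H"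
  \<comment> \<open>Uniform head, and for each head an independent uniform tail. No weights
    \<open>\<nu>\<close> occur in it, so it serves as the common reference value for
    \<open>\<mu>\<close> and for the uniform weights; this doubles 1100 to 2200.\<close>
  define \<Phi> where "\<Phi> = (\<Sum>z\<in>signs H. wexp n (uniform_weights n)
     (\<lambda>x. sign_pm ((\<Sum>i\<in>?T. w i * x i) - (\<theta> - (\<Sum>i\<in>H. w i * z i))))) / 2 ^ card H"
  have fin: "finite H" using H finite_subset by blast
  have "0 \<le> 501 * (ln (1/e))\<^sup>2 / e\<^sup>2" by simp
  then have Hk: "card H \<le> k" "501 * (ln (1/e))\<^sup>2 / e\<^sup>2 \<le> real (k - card H)" using k by linarith+
  have "\<bar>wexp n \<nu> (\<lambda>x. sign_pm ((\<Sum>i<n. w i * x i) - \<theta>)) - \<Phi>\<bar> \<le> 1100 * e"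
    if \<nu>: "kwise_weights n k {..<n} \<nu>" for \<nu>
  proof -
    have "\<bar>wexp n (cond_weights H z \<nu>) (\<lambda>x. sign_pm ((\<Sum>i<n. w i * x i) - \<theta>)) -
       wexp n (uniform_weights n) (\<lambda>x. sign_pm ((\<Sum>i\<in>?T. w i * x i) - (\<theta> - (\<Sum>i\<in>H. w i * z i))))\<bar> \<le> 1100 * e"
      if z: "z \<in> signs H" for z
    proof -
      have "wexp n (cond_weights H z \<nu>) (\<lambda>x. sign_pm ((\<Sum>i<n. w i * x i) - \<theta>)) =
        wexp n (cond_weights H z \<nu>) (\<lambda>x. sign_pm ((\<Sum>i\<in>?T. w i * x i) - (\<theta> - (\<Sum>i\<in>H. w i * z i))))"
      proof (rule wexp_cond_cong)
        fix x assume x: "restrict x H = z"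
        have "(\<Sum>i<n. w i * x i) = (\<Sum>i\<in>?T. w i * x i) + (\<Sum>i\<in>H. w i * x i)"
          using H by (simp add: sum.subset_diff)
        also have "(\<Sum>i\<in>H. w i * x i) = (\<Sum>i\<in>H. w i * z i)" by (intro sum.cong) (auto simp flip: x)
        finally show "sign_pm ((\<Sum>i<n. w i * x i) - \<theta>) = sign_pm ((\<Sum>i\<in>?T. w i * x i) - (\<theta> - (\<Sum>i\<in>H. w i * z i)))"
          by (simp add: algebra_simps)
      qed
      then show ?thesis
        using regular_fooling[OF kwise_weights_cond[OF \<nu> H Hk(1) z] w e Hk(2)] by simp
    qed
    then have "(\<Sum>z\<in>signs H. \<bar>wexp n (cond_weights H z \<nu>) (\<lambda>x. sign_pm ((\<Sum>i<n. w i * x i) - \<theta>)) -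
       wexp n (uniform_weights n) (\<lambda>x. sign_pm ((\<Sum>i\<in>?T. w i * x i) - (\<theta> - (\<Sum>i\<in>H. w i * z i))))\<bar>) \<le>
       (\<Sum>z\<in>signs H. 1100 * e)"
      by (rule sum_mono)
    then have "\<bar>(\<Sum>z\<in>signs H. wexp n (cond_weights H z \<nu>) (\<lambda>x. sign_pm ((\<Sum>i<n. w i * x i) - \<theta>)) -
       wexp n (uniform_weights n) (\<lambda>x. sign_pm ((\<Sum>i\<in>?T. w i * x i) - (\<theta> - (\<Sum>i\<in>H. w i * z i)))))\<bar> \<le> 2 ^ card H * (1100 * e)"
      by (intro order_trans[OF sum_abs]) (simp only: sum_constant card_signs[OF fin] of_nat_power of_nat_numeral)
    then show ?thesis
      unfolding \<Phi>_def wexp_decompose[OF H, of \<nu>] sum_subtractf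
      by (simp add: field_simps flip: diff_divide_distrib)
  qed
  from this[OF kw] this[OF kwise_weights_uniform[OF order_refl]] show ?thesis by linarith
qed

section \<open>Arbitrary halfspaces\<close>

text \<open>Greedy removal: an irregular remainder contains a weight above \<open>e\<close> times
  its norm, and this coordinate becomes the next value of \<open>f\<close>. The order of removal is
  kept, because the decay of the successive remainders is what the second alternative is used
  for.\<close>

lemma regular_or_decay:
  fixes w :: "nat \<Rightarrow> real"
  shows "(\<exists>H\<subseteq>J. finite H \<and> card H \<le> L \<and> (\<forall>i\<in>J - H. \<bar>w i\<bar> \<le> e * sqrt (\<Sum>i\<in>J - H. (w i)\<^sup>2))) \<or>
    (\<exists>f. inj_on f {..<L} \<and> f ` {..<L} \<subseteq> J \<and> (\<forall>l<L. e * sqrt (\<Sum>i\<in>J - f ` {..<l}. (w i)\<^sup>2) < \<bar>w (f l)\<bar>))"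
proof (induction L)
  case 0
  then show ?case by simp
next
  case (Suc L)
  then consider (reg) H where "H \<subseteq> J" "finite H" "card H \<le> L" "\<forall>i\<in>J - H. \<bar>w i\<bar> \<le> e * sqrt (\<Sum>i\<in>J - H. (w i)\<^sup>2)"
    | (decay) f where "inj_on f {..<L}" "f ` {..<L} \<subseteq> J" "\<forall>l<L. e * sqrt (\<Sum>i\<in>J - f ` {..<l}. (w i)\<^sup>2) < \<bar>w (f l)\<bar>"
    by blast
  then show ?case
  proof cases
    case reg
    then show ?thesis by (meson le_Suc_eq)
  next
    case decay
    let ?H = "f ` {..<L}"
    show ?thesis
    proof (cases "\<forall>i\<in>J - ?H. \<bar>w i\<bar> \<le> e * sqrt (\<Sum>i\<in>J - ?H. (w i)\<^sup>2)")
      case True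
      have "card ?H \<le> Suc L" using card_image_le[of "{..<L}" f] by simp
      then show ?thesis using True decay by blast
    next
      case False
      then obtain i where i: "i \<in> J" "i \<notin> ?H" "e * sqrt (\<Sum>i\<in>J - ?H. (w i)\<^sup>2) < \<bar>w i\<bar>" by force
      have im: "f(L := i) ` {..<l} = f ` {..<l}" if "l \<le> L" for l using that by (auto simp: image_def)
      have "inj_on (f(L := i)) {..<Suc L}"
        using decay(1) i(2) by (auto simp: inj_on_def lessThan_Suc)
      moreover have "f(L := i) ` {..<Suc L} \<subseteq> J" using decay(2) i by (auto simp: lessThan_Suc)
      moreover have "\<forall>l<Suc L. e * sqrt (\<Sum>j\<in>J - f(L := i) ` {..<l}. (w j)\<^sup>2) < \<bar>w ((f(L := i)) l)\<bar>"
      proof (intro allI impI)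
        fix l assume "l < Suc L"
        then show "e * sqrt (\<Sum>j\<in>J - f(L := i) ` {..<l}. (w j)\<^sup>2) < \<bar>w ((f(L := i)) l)\<bar>"
          using decay(3) i(3) im[of l] by (cases "l = L") (simp_all del: fun_upd_image)
      qed
      ultimately show ?thesis by blast
    qed
  qed
qed

section \<open>Superdecreasing weights decide a halfspace\<close>

lemma superdecreasing_sum_abs_le:
  fixes v :: "nat \<Rightarrow> real"
  assumes "\<And>q. Suc q < t \<Longrightarrow> \<bar>v (Suc q)\<bar> \<le> \<bar>v q\<bar> / 3"
  shows "(\<Sum>q<t. \<bar>v q\<bar>) \<le> 3/2 * \<bar>v 0\<bar>"
  using assms
proof (induction t arbitrary: v)
  case (Suc t)
  have IH: "(\<Sum>q<t. \<bar>v (Suc q)\<bar>) \<le> 3/2 * \<bar>v (Suc 0)\<bar>" using Suc.prems by (intro Suc.IH) auto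
  show ?case
  proof (cases "t = 0")
    case False
    then have "\<bar>v (Suc 0)\<bar> \<le> \<bar>v 0\<bar> / 3" using Suc.prems by simp
    then show ?thesis using IH unfolding sum.lessThan_Suc_shift by linarith
  qed auto
qed simp

lemma superdecreasing_antitone:
  fixes v :: "nat \<Rightarrow> real"
  assumes "\<And>q. Suc q < t \<Longrightarrow> \<bar>v (Suc q)\<bar> \<le> \<bar>v q\<bar> / 3" "a < t"
  shows "\<bar>v a\<bar> \<le> \<bar>v 0\<bar>"
  using assms(2)
proof (induction a)
  case (Suc a)
  then show ?case using assms(1)[of a] by simp
qed simp

text \<open>At the first disagreement \<open>q\<close> the sums differ by \<open>2 * |v q|\<close>,
  while all later terms change this by at most \<open>2 * 3/2 * |v q| / 3 = |v q|\<close>. What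
  remains is at least \<open>|v q|\<close>, hence at least the last weight.\<close>

lemma superdecreasing_separated:
  fixes v x y :: "nat \<Rightarrow> real"
  assumes "\<And>q. Suc q < t \<Longrightarrow> \<bar>v (Suc q)\<bar> \<le> \<bar>v q\<bar> / 3"
    and "\<And>q. q < t \<Longrightarrow> x q \<in> {-1, 1} \<and> y q \<in> {-1, 1}" and "\<exists>q<t. x q \<noteq> y q"
  shows "\<bar>v (t - 1)\<bar> \<le> \<bar>\<Sum>q<t. v q * (x q - y q)\<bar>"
  using assms
proof (induction t arbitrary: v x y)
  case (Suc t)
  have split: "(\<Sum>q<Suc t. v q * (x q - y q)) = v 0 * (x 0 - y 0) + (\<Sum>q<t. v (Suc q) * (x (Suc q) - y (Suc q)))"
    by (rule sum.lessThan_Suc_shift)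
  show ?case
  proof (cases "x 0 = y 0")
    case True
    then obtain q where q: "q < Suc t" "x q \<noteq> y q" "q \<noteq> 0" using Suc.prems(3) by metis
    then have "\<exists>q<t. x (Suc q) \<noteq> y (Suc q)" by (intro exI[of _ "q - 1"]) auto
    then have "\<bar>v (Suc (t - 1))\<bar> \<le> \<bar>\<Sum>q<t. v (Suc q) * (x (Suc q) - y (Suc q))\<bar>"
      using Suc.prems by (intro Suc.IH) auto
    moreover have "Suc (t - 1) = t" using q by simp
    ultimately show ?thesis unfolding split using True by simp
  next
    case False
    have d: "\<bar>x q - y q\<bar> \<le> 2" if "q < Suc t" for q using Suc.prems(2)[OF that] by auto
    have "\<bar>x 0 - y 0\<bar> = 2" using Suc.prems(2)[of 0] False by auto
    then have v0: "\<bar>v 0 * (x 0 - y 0)\<bar> = 2 * \<bar>v 0\<bar>" by (simp add: abs_mult)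
    have "\<bar>\<Sum>q<t. v (Suc q) * (x (Suc q) - y (Suc q))\<bar> \<le> (\<Sum>q<t. \<bar>v (Suc q)\<bar> * 2)"
      by (intro order_trans[OF sum_abs] sum_mono) (simp add: abs_mult mult_left_mono d)
    also have "\<dots> = 2 * (\<Sum>q<t. \<bar>v (Suc q)\<bar>)" by (simp add: sum_distrib_left mult.commute)
    also have "\<dots> \<le> \<bar>v 0\<bar>"
    proof (cases "t = 0")
      case False
      have "(\<Sum>q<t. \<bar>v (Suc q)\<bar>) \<le> 3/2 * \<bar>v (Suc 0)\<bar>"
        using Suc.prems(1) by (intro superdecreasing_sum_abs_le) auto
      then show ?thesis using Suc.prems(1)[of 0] False by simp
    qed simp
    finally have "\<bar>v 0\<bar> \<le> \<bar>\<Sum>q<Suc t. v q * (x q - y q)\<bar>" unfolding split using v0 by linarith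
    moreover have "\<bar>v t\<bar> \<le> \<bar>v 0\<bar>" using Suc.prems(1) by (intro superdecreasing_antitone[of "Suc t"]) auto
    ultimately show ?thesis by simp
  qed
qed simp

text \<open>Two sign vectors that agree off the selected coordinates and both come within half of
  the smallest selected weight of the threshold must be equal, by separation. So the vectors counted
  are determined by the other coordinates.\<close>

lemma card_near_threshold_le:
  fixes w :: "nat \<Rightarrow> real"
  assumes "finite H" "inj_on g {..<t}" "g ` {..<t} \<subseteq> H"
    and dec: "\<And>q. Suc q < t \<Longrightarrow> \<bar>w (g (Suc q))\<bar> \<le> \<bar>w (g q)\<bar> / 3"
  shows "card {z \<in> signs H. \<bar>(\<Sum>i\<in>H. w i * z i) - \<theta>\<bar> < \<bar>w (g (t - 1))\<bar> / 2} \<le> 2 ^ (card H - t)"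
proof -
  let ?R = "H - g ` {..<t}"
  let ?X = "{z \<in> signs H. \<bar>(\<Sum>i\<in>H. w i * z i) - \<theta>\<bar> < \<bar>w (g (t - 1))\<bar> / 2}"
  have "inj_on (\<lambda>z. restrict z ?R) ?X"
  proof (rule inj_onI)
    fix x y assume x: "x \<in> ?X" and y: "y \<in> ?X" and xy: "restrict x ?R = restrict y ?R"
    have eq: "x i = y i" if "i \<in> ?R" for i using fun_cong[OF xy, of i] that by simp
    have "(\<Sum>i\<in>H. w i * x i) - (\<Sum>i\<in>H. w i * y i) = (\<Sum>i\<in>H. w i * (x i - y i))"
      by (simp add: right_diff_distrib sum_subtractf)
    also have "\<dots> = (\<Sum>i\<in>g ` {..<t}. w i * (x i - y i))"
      using assms eq by (intro sum.mono_neutral_right) auto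
    also have "\<dots> = (\<Sum>q<t. w (g q) * (x (g q) - y (g q)))"
      using assms(2) by (simp add: sum.reindex)
    finally have s: "(\<Sum>i\<in>H. w i * x i) - (\<Sum>i\<in>H. w i * y i) = (\<Sum>q<t. w (g q) * (x (g q) - y (g q)))" .
    have "\<forall>q<t. x (g q) = y (g q)"
    proof (rule ccontr)
      assume "\<not> ?thesis"
      moreover have "x (g q) \<in> {-1, 1} \<and> y (g q) \<in> {-1, 1}" if "q < t" for q
      proof -
        have "g q \<in> H" using assms(3) that by auto
        then show ?thesis using x y by (auto simp: signs_def PiE_def Pi_def)
      qed
      ultimately have "\<bar>w (g (t - 1))\<bar> \<le> \<bar>\<Sum>q<t. w (g q) * (x (g q) - y (g q))\<bar>"
        using superdecreasing_separated[of t "\<lambda>q. w (g q)" "\<lambda>q. x (g q)" "\<lambda>q. y (g q)"] dec by blast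
      then show False using x y unfolding s[symmetric] by (simp add: abs_if split: if_splits)
    qed
    then have "x i = y i" if "i \<in> H" for i using eq that by blast
    moreover have "x \<in> extensional H" "y \<in> extensional H" using x y by (auto simp: signs_def PiE_def)
    ultimately show "x = y" by (intro extensionalityI[of _ H]) auto
  qed
  moreover have "(\<lambda>z. restrict z ?R) ` ?X \<subseteq> signs ?R" by (auto simp: signs_def PiE_def Pi_def)
  ultimately have "card ?X \<le> card (signs ?R)" using assms(1) by (intro card_inj_on_le) auto
  also have "card ?R = card H - t"
    using assms card_image[OF assms(2)] finite_subset[OF assms(3)] by (simp add: card_Diff_subset)
  then have "card (signs ?R) = 2 ^ (card H - t)" using assms(1) by (simp add: card_signs)
  finally show ?thesis .
qed

text \<open>Replaces the halfspace by the sign of its head \<open>A\<close>. The two differ only if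
  the head is within \<open>\<rho>\<close> of the threshold, of probability at most
  \<open>1 / 2 ^ t\<close>, or if the tail reaches \<open>\<rho>\<close>, which Chebyshev bounds.
  The costs are \<open>2 * e\<close> and \<open>e\<close>, once for each of the two weights. On the
  head both are exactly uniform.\<close>

lemma decay_fooling:
  fixes w :: "nat \<Rightarrow> real"
  assumes kw: "kwise_weights n k {..<n} \<mu>" and H: "H \<subseteq> {..<n}" and k: "card H + 2 \<le> k"
    and g: "inj_on g {..<t}" "g ` {..<t} \<subseteq> H" "w (g (t - 1)) \<noteq> 0"
    and dec: "\<And>q. Suc q < t \<Longrightarrow> \<bar>w (g (Suc q))\<bar> \<le> \<bar>w (g q)\<bar> / 3"
    and t: "1 / 2 ^ t \<le> e" and e: "0 < e" "e \<le> 1"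
    and tail: "9 * (\<Sum>i\<in>{..<n} - H. (w i)\<^sup>2) \<le> e\<^sup>2 * (w (g (t - 1)))\<^sup>2"
  shows "\<bar>wexp n \<mu> (\<lambda>x. sign_pm ((\<Sum>i<n. w i * x i) - \<theta>)) -
           wexp n (uniform_weights n) (\<lambda>x. sign_pm ((\<Sum>i<n. w i * x i) - \<theta>))\<bar> \<le> 6 * e"
proof -
  let ?T = "{..<n} - H"
  define \<rho> where "\<rho> = \<bar>w (g (t - 1))\<bar> / 2"
  have \<rho>: "\<rho> > 0" "4 * \<rho>\<^sup>2 = (w (g (t - 1)))\<^sup>2" using g by (auto simp: \<rho>_def power_divide)
  define A where "A z = (\<Sum>i\<in>H. w i * z i) - \<theta>" for z
  have fin: "finite H" using H finite_subset by blast
  have th: "t \<le> card H" using card_mono[OF fin g(2)] card_image[OF g(1)] by simp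
  have main: "\<bar>wexp n \<nu> (\<lambda>x. sign_pm ((\<Sum>i<n. w i * x i) - \<theta>)) - (\<Sum>z\<in>signs H. sign_pm (A z)) / 2 ^ card H\<bar> \<le> 3 * e"
    if \<nu>: "kwise_weights n k {..<n} \<nu>" for \<nu>
  proof -
    have A_res: "A x = A (restrict x H)" for x by (simp add: A_def)
    have "\<bar>wexp n \<nu> (\<lambda>x. sign_pm ((\<Sum>i<n. w i * x i) - \<theta>)) - wexp n \<nu> (\<lambda>x. sign_pm (A (restrict x H)))\<bar> \<le>
      wexp n \<nu> (\<lambda>x. 2 * of_bool (\<bar>A (restrict x H)\<bar> < \<rho>) + 2 / \<rho>\<^sup>2 * (\<Sum>i\<in>?T. w i * x i)\<^sup>2)"
    proof (rule wexp_abs_diff_le[OF \<nu>])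
      fix x :: "nat \<Rightarrow> real"
      define s where "s = (\<Sum>i\<in>?T. w i * x i)"
      have "(\<Sum>i<n. w i * x i) = s + (\<Sum>i\<in>H. w i * x i)"
        unfolding s_def using H by (simp add: sum.subset_diff)
      then have sA: "(\<Sum>i<n. w i * x i) - \<theta> = s + A x" by (simp add: A_def)
      have "\<bar>sign_pm (s + A x) - sign_pm (A x)\<bar> \<le> 2 * of_bool (\<bar>A x\<bar> < \<rho>) + 2 / \<rho>\<^sup>2 * s\<^sup>2"
      proof -
        have nn: "0 \<le> 2 / \<rho>\<^sup>2 * s\<^sup>2" by simp
        consider "\<bar>A x\<bar> < \<rho>" | "\<rho> \<le> \<bar>s\<bar>" | "\<bar>A x\<bar> \<ge> \<rho>" "\<bar>s\<bar> < \<rho>" by linarith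
        then show ?thesis
        proof cases
          case 1
          then show ?thesis using nn by (simp add: sign_pm_def)
        next
          case 2
          then have "\<rho>\<^sup>2 \<le> s\<^sup>2" using \<rho>(1) by (simp add: abs_le_square_iff[symmetric])
          then have "2 \<le> 2 / \<rho>\<^sup>2 * s\<^sup>2" using \<rho>(1) by (simp add: field_simps)
          then show ?thesis by (auto simp: sign_pm_def)
        next
          case 3
          then have "sign_pm (s + A x) = sign_pm (A x)" by (auto simp: sign_pm_def)
          then show ?thesis using nn by simp
        qed
      qed
      then show "\<bar>sign_pm ((\<Sum>i<n. w i * x i) - \<theta>) - sign_pm (A (restrict x H))\<bar> \<le>
         2 * of_bool (\<bar>A (restrict x H)\<bar> < \<rho>) + 2 / \<rho>\<^sup>2 * (\<Sum>i\<in>?T. w i * x i)\<^sup>2"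
        unfolding sA A_res[of x, symmetric] s_def .
    qed
    also have "\<dots> = 2 * ((\<Sum>z\<in>signs H. of_bool (\<bar>A z\<bar> < \<rho>)) / 2 ^ card H) + 2 / \<rho>\<^sup>2 * (\<Sum>i\<in>?T. (w i)\<^sup>2)"
    proof -
      have k2: "2 \<le> k" "card H \<le> k" using k by auto
      have T: "kwise_weights n k ?T \<nu>" using \<nu> by (rule kwise_weights_mono) auto
      show ?thesis
        unfolding wexp_add wexp_cmult wexp_square[OF T k2(1)]
        by (subst wexp_head[OF \<nu> H k2(2), of "\<lambda>z. of_bool (\<bar>A z\<bar> < \<rho>)"]) simp
    qed
    also have "(\<Sum>z\<in>signs H. of_bool (\<bar>A z\<bar> < \<rho>)) = real (card {z \<in> signs H. \<bar>A z\<bar> < \<rho>})"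
      using fin by (simp add: of_bool_def sum.If_cases Int_def)
    finally have split: "\<bar>wexp n \<nu> (\<lambda>x. sign_pm ((\<Sum>i<n. w i * x i) - \<theta>)) - wexp n \<nu> (\<lambda>x. sign_pm (A (restrict x H)))\<bar> \<le>
      2 * (real (card {z \<in> signs H. \<bar>A z\<bar> < \<rho>}) / 2 ^ card H) + 2 / \<rho>\<^sup>2 * (\<Sum>i\<in>?T. (w i)\<^sup>2)" .
    have head: "real (card {z \<in> signs H. \<bar>A z\<bar> < \<rho>}) / 2 ^ card H \<le> e"
    proof -
      have "card {z \<in> signs H. \<bar>A z\<bar> < \<rho>} \<le> 2 ^ (card H - t)"
        unfolding A_def \<rho>_def by (intro card_near_threshold_le fin g dec)
      then have "real (card {z \<in> signs H. \<bar>A z\<bar> < \<rho>}) \<le> 2 ^ (card H - t)"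
        by (metis of_nat_le_iff of_nat_numeral of_nat_power)
      then have "real (card {z \<in> signs H. \<bar>A z\<bar> < \<rho>}) / 2 ^ card H \<le> 2 ^ (card H - t) / 2 ^ card H"
        by (rule divide_right_mono) simp
      also have "\<dots> = 1 / 2 ^ t" using th by (simp add: power_diff)
      finally show ?thesis using t by linarith
    qed
    have "2 / \<rho>\<^sup>2 * (\<Sum>i\<in>?T. (w i)\<^sup>2) \<le> e"
    proof -
      have "9 * (\<Sum>i\<in>?T. (w i)\<^sup>2) \<le> e\<^sup>2 * (4 * \<rho>\<^sup>2)" using tail \<rho> by simp
      also have "\<dots> \<le> e * (4 * \<rho>\<^sup>2)" using e by (intro mult_right_mono) (auto simp: power2_eq_square mult_left_le_one_le)
      finally have "9 * (\<Sum>i\<in>?T. (w i)\<^sup>2) \<le> 4 * (e * \<rho>\<^sup>2)" by simp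
      moreover have "0 \<le> e * \<rho>\<^sup>2" using e by simp
      ultimately have "2 * (\<Sum>i\<in>?T. (w i)\<^sup>2) \<le> e * \<rho>\<^sup>2" by linarith
      then show ?thesis using \<rho> by (simp add: field_simps)
    qed
    with split head have "\<bar>wexp n \<nu> (\<lambda>x. sign_pm ((\<Sum>i<n. w i * x i) - \<theta>)) - wexp n \<nu> (\<lambda>x. sign_pm (A (restrict x H)))\<bar> \<le> 3 * e"
      by linarith
    moreover have "wexp n \<nu> (\<lambda>x. sign_pm (A (restrict x H))) = (\<Sum>z\<in>signs H. sign_pm (A z)) / 2 ^ card H"
      using k by (intro wexp_head[OF \<nu> H]) simp
    ultimately show ?thesis by simp
  qed
  from main[OF kw] main[OF kwise_weights_uniform[OF order_refl]] show ?thesis by linarith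
qed

text \<open>Each removed weight takes at least the fraction \<open>e^2\<close> of the remaining sum
  of squares with it.\<close>

lemma decay_squares:
  fixes w :: "nat \<Rightarrow> real"
  assumes J: "finite J" and f: "inj_on f {..<L}" "f ` {..<L} \<subseteq> J" and e: "0 \<le> e" "e \<le> 1"
    and gt: "\<And>l. l < L \<Longrightarrow> e * sqrt (\<Sum>i\<in>J - f ` {..<l}. (w i)\<^sup>2) < \<bar>w (f l)\<bar>"
    and "l + m \<le> L"
  shows "(\<Sum>i\<in>J - f ` {..<l + m}. (w i)\<^sup>2) \<le> (1 - e\<^sup>2) ^ m * (\<Sum>i\<in>J - f ` {..<l}. (w i)\<^sup>2)"
  using assms(7)
proof (induction m)
  case (Suc m)
  let ?s = "\<lambda>l. \<Sum>i\<in>J - f ` {..<l}. (w i)\<^sup>2"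
  have lt: "l + m < L" using Suc.prems by simp
  have notin: "f (l + m) \<notin> f ` {..<l + m}"
  proof
    assume "f (l + m) \<in> f ` {..<l + m}"
    then obtain x where x: "x < l + m" "f (l + m) = f x" by auto
    then have "l + m = x" using lt inj_onD[OF f(1), of "l + m" x] by simp
    then show False using x by simp
  qed
  have im: "f ` {..<l + Suc m} = insert (f (l + m)) (f ` {..<l + m})" by (simp add: lessThan_Suc)
  have fJ: "f (l + m) \<in> J" using f(2) lt by (simp add: image_subset_iff)
  have "a \<in> J \<Longrightarrow> a \<notin> A \<Longrightarrow> J - A = insert a (J - insert a A)" for a A by blast
  from this[OF fJ notin] have "J - f ` {..<l + m} = insert (f (l + m)) (J - f ` {..<l + Suc m})"
    unfolding im .
  moreover have "f (l + m) \<notin> J - f ` {..<l + Suc m}" unfolding im by simp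
  ultimately have "?s (l + m) = (w (f (l + m)))\<^sup>2 + ?s (l + Suc m)"
    using J by simp
  moreover have "e\<^sup>2 * ?s (l + m) \<le> (w (f (l + m)))\<^sup>2"
  proof -
    have "(e * sqrt (?s (l + m)))\<^sup>2 \<le> \<bar>w (f (l + m))\<bar>\<^sup>2"
      using gt[OF lt] e by (intro power_mono mult_nonneg_nonneg real_sqrt_ge_zero sum_nonneg) auto
    then show ?thesis by (simp add: power_mult_distrib sum_nonneg)
  qed
  ultimately have "?s (l + Suc m) \<le> (1 - e\<^sup>2) * ?s (l + m)" by (simp add: algebra_simps)
  also have "\<dots> \<le> (1 - e\<^sup>2) * ((1 - e\<^sup>2) ^ m * ?s l)"
    using Suc e by (intro mult_left_mono) (auto simp: power_le_one)
  finally show ?case by (simp add: mult_ac)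
qed simp

theorem kwise_weights_fool_halfspaces:
  fixes w :: "nat \<Rightarrow> real"
  assumes kw: "kwise_weights n k {..<n} \<mu>"
    and e: "0 < e" "e \<le> 1/2" and k: "600 * (ln (1/e))\<^sup>2 / e\<^sup>2 \<le> real k"
  shows "\<bar>wexp n \<mu> (\<lambda>x. sign_pm ((\<Sum>i<n. w i * x i) - \<theta>)) -
           wexp n (uniform_weights n) (\<lambda>x. sign_pm ((\<Sum>i<n. w i * x i) - \<theta>))\<bar> \<le> 2200 * e"
proof -
  define l where "l = ln (1/e)"
  have l: "l \<ge> 2/3"
  proof -
    have "ln 2 \<le> l" unfolding l_def using e by (subst ln_le_cancel_iff) (auto simp: field_simps)
    then show ?thesis using ln2_ge_two_thirds by linarith
  qed
  define Q where "Q = l\<^sup>2 / e\<^sup>2"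
  have e2: "e\<^sup>2 \<le> 1/4" using power_mono[of e "1/2" 2] e by (simp add: power2_eq_square)
  have "4/9 \<le> l\<^sup>2" using power_mono[of "2/3" l 2] l by (simp add: power2_eq_square)
  then have Q1: "1 \<le> Q" using e2 e by (simp add: Q_def field_simps)
  have kQ: "600 * Q \<le> real k" using k by (simp add: Q_def l_def)
  \<comment> \<open>The number of superdecreasing weights to be selected, so that
    \<open>1 / 2 ^ t \<le> e\<close>. Rounding up is covered by
    \<open>1 \<le> 3/2 * l\<close>.\<close>
  define t where "t = nat \<lceil>l / ln 2\<rceil>"
  \<comment> \<open>The number of removals between two selected weights; they shrink the sum of
    squares by the factor \<open>exp (- K * e^2) \<le> e ^ 8\<close>.\<close>
  define K where "K = nat \<lceil>8 * l / e\<^sup>2\<rceil>"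
  have ln2: "ln 2 > (0::real)" by simp
  have t: "l / ln 2 \<le> real t" "real t \<le> 3 * l"
  proof -
    have "0 \<le> l / ln 2" using l by simp
    then show "l / ln 2 \<le> real t" by (simp add: t_def)
    have "l / ln 2 \<le> l / (2/3)" using l ln2_ge_two_thirds by (intro divide_left_mono) auto
    also have "\<dots> = 3/2 * l" by simp
    finally have "l / ln 2 \<le> 3/2 * l" .
    moreover have "real t \<le> l / ln 2 + 1" using \<open>0 \<le> l / ln 2\<close> unfolding t_def by linarith
    ultimately show "real t \<le> 3 * l" using l by argo
  qed
  have "l / ln 2 > 0" using l by simp
  then have t0: "t > 0" using t(1) by (cases t) auto
  have K: "8 * l / e\<^sup>2 \<le> real K" "real K \<le> 9 * l / e\<^sup>2"
  proof -
    have nn: "0 \<le> 8 * l / e\<^sup>2" using l by simp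
    then show "8 * l / e\<^sup>2 \<le> real K" by (simp add: K_def)
    have "real K \<le> 8 * l / e\<^sup>2 + 1" using nn unfolding K_def by linarith
    moreover have "1 \<le> l / e\<^sup>2" using l e2 e by (simp add: field_simps)
    moreover have "8 * l / e\<^sup>2 = 8 * (l / e\<^sup>2)" "9 * l / e\<^sup>2 = 9 * (l / e\<^sup>2)" by simp_all
    ultimately show "real K \<le> 9 * l / e\<^sup>2" by linarith
  qed
  have "0 < 8 * l / e\<^sup>2" using l e by simp
  then have K0: "K > 0" using K(1) by (cases K) auto
  define L where "L = t * K"
  have L: "real L \<le> 27 * Q"
  proof -
    have "real L \<le> (3 * l) * (9 * l / e\<^sup>2)" unfolding L_def of_nat_mult using t K l by (intro mult_mono) auto
    then show ?thesis by (simp add: Q_def power2_eq_square)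
  qed
  \<comment> \<open>Of \<open>e ^ 8\<close>, four powers are spent on the constant:
    \<open>e ^ 4 \<le> 1/16 \<le> 1/9\<close>. The 9 becomes the ratio 3 between consecutive
    selected weights.\<close>
  have expK: "(1 - e\<^sup>2) ^ K \<le> e ^ 4 / 9"
  proof -
    have "1 - e\<^sup>2 \<le> exp (- e\<^sup>2)" using exp_ge_add_one_self[of "- e\<^sup>2"] by simp
    then have "(1 - e\<^sup>2) ^ K \<le> exp (- e\<^sup>2) ^ K" using e2 by (intro power_mono) auto
    also have "\<dots> = exp (- (real K * e\<^sup>2))" by (simp flip: exp_of_nat_mult)
    also have "\<dots> \<le> exp (- (8 * l))" using K e by (simp add: field_simps)
    also have "\<dots> = exp (real 8 * (- l))" by simp
    also have "\<dots> = exp (- l) ^ 8" by (rule exp_of_nat_mult)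
    also have "exp (- l) = e" using e by (simp add: l_def ln_div)
    also have "e ^ 8 = e ^ 4 * (e\<^sup>2 * e\<^sup>2)" by (simp flip: power_add)
    also have "\<dots> \<le> e ^ 4 * (1/4 * (1/4))" using e2 by (intro mult_left_mono mult_mono) auto
    also have "\<dots> \<le> e ^ 4 / 9" using e by simp
    finally show ?thesis .
  qed
  consider (reg) H where "H \<subseteq> {..<n}" "finite H" "card H \<le> L" "\<forall>i\<in>{..<n} - H. \<bar>w i\<bar> \<le> e * sqrt (\<Sum>i\<in>{..<n} - H. (w i)\<^sup>2)"
    | (decay) f where "inj_on f {..<L}" "f ` {..<L} \<subseteq> {..<n}" "\<forall>l<L. e * sqrt (\<Sum>i\<in>{..<n} - f ` {..<l}. (w i)\<^sup>2) < \<bar>w (f l)\<bar>"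
    using regular_or_decay[of "{..<n}" L w e] by blast
  then show ?thesis
  proof cases
    case reg
    \<comment> \<open>The head uses at most \<open>27 * Q\<close> of the available independence and
      the regular tail \<open>501 * Q\<close>, together below \<open>600 * Q\<close>.\<close>
    have "real (card H) + 501 * (ln (1/e))\<^sup>2 / e\<^sup>2 \<le> real k"
      using reg(3) L kQ Q1 by (simp add: l_def[symmetric] Q_def)
    then show ?thesis using reg e by (intro regular_tail_fooling[OF kw]) auto
  next
    case decay
    define H where "H = f ` {..<L}"
    define g where "g q = f (q * K)" for q
    let ?s = "\<lambda>l. \<Sum>i\<in>{..<n} - f ` {..<l}. (w i)\<^sup>2"
    have s0: "0 \<le> ?s l" for l by (intro sum_nonneg) auto
    have qK: "q * K < L" "(q + 1) * K \<le> L" if "q < t" for q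
    proof -
      have "(q + 1) * K \<le> t * K" using that by (intro mult_right_mono) auto
      then show "(q + 1) * K \<le> L" by (simp add: L_def)
      then show "q * K < L" using K0 by simp
    qed
    have gt: "e\<^sup>2 * ?s l \<le> (w (f l))\<^sup>2" "w (f l) \<noteq> 0" if "l < L" for l
    proof -
      have "0 \<le> e * sqrt (?s l)" using e s0 by simp
      moreover have d: "e * sqrt (?s l) < \<bar>w (f l)\<bar>" using decay(3) that by blast
      ultimately show "w (f l) \<noteq> 0" by auto
      have "(e * sqrt (?s l))\<^sup>2 \<le> \<bar>w (f l)\<bar>\<^sup>2" using d \<open>0 \<le> e * sqrt (?s l)\<close> by (intro power_mono) auto
      then show "e\<^sup>2 * ?s l \<le> (w (f l))\<^sup>2" using s0 by (simp add: power_mult_distrib)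
    qed
    \<comment> \<open>One factor \<open>e^2\<close> of \<open>e ^ 4\<close> converts the sum of
      squares before the block into the square of the weight removed there; the other one is kept
      for the Chebyshev bound of the last tail.\<close>
    have step: "9 * ?s ((q + 1) * K) \<le> e\<^sup>2 * (w (g q))\<^sup>2" if "q < t" for q
    proof -
      have "?s (q * K + K) \<le> (1 - e\<^sup>2) ^ K * ?s (q * K)"
        using decay e qK[OF that] by (intro decay_squares[where L = L]) auto
      also have "\<dots> \<le> e ^ 4 / 9 * ?s (q * K)" by (intro mult_right_mono expK s0)
      finally have "9 * ?s ((q + 1) * K) \<le> e\<^sup>2 * (e\<^sup>2 * ?s (q * K))" by (simp add: algebra_simps flip: power_add)
      also have "\<dots> \<le> e\<^sup>2 * (w (f (q * K)))\<^sup>2" using gt(1)[OF qK(1)[OF that]] by (intro mult_left_mono) auto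
      finally show ?thesis by (simp add: g_def)
    qed
    \<comment> \<open>The next selected weight still belongs to the remainder after block
      \<open>q\<close>, so its square is at most that sum of squares.\<close>
    have dec: "\<bar>w (g (Suc q))\<bar> \<le> \<bar>w (g q)\<bar> / 3" if "Suc q < t" for q
    proof -
      have lt: "Suc q * K < L" by (rule qK(1)[OF that])
      have "g (Suc q) \<in> {..<n} - f ` {..<Suc q * K}"
        using decay(2) lt inj_on_image_mem_iff[OF decay(1), of "Suc q * K" "{..<Suc q * K}"]
        by (auto simp: g_def simp del: mult_Suc)
      then have "(w (g (Suc q)))\<^sup>2 \<le> ?s (Suc q * K)" by (intro member_le_sum) auto
      then have "9 * (w (g (Suc q)))\<^sup>2 \<le> e\<^sup>2 * (w (g q))\<^sup>2" using step[of q] that by simp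
      also have "\<dots> \<le> 1 * (w (g q))\<^sup>2" using e2 by (intro mult_right_mono) auto
      finally have "(w (g (Suc q)))\<^sup>2 \<le> (w (g q) / 3)\<^sup>2" by (simp add: power_divide)
      then show ?thesis by (simp add: abs_le_square_iff[symmetric])
    qed
    have t1: "t - 1 < t" "(t - 1 + 1) * K = L" using t0 by (auto simp: L_def)
    have "\<bar>wexp n \<mu> (\<lambda>x. sign_pm ((\<Sum>i<n. w i * x i) - \<theta>)) -
           wexp n (uniform_weights n) (\<lambda>x. sign_pm ((\<Sum>i<n. w i * x i) - \<theta>))\<bar> \<le> 6 * e"
    proof (rule decay_fooling[OF kw, where H = H and g = g and t = t])
      show "H \<subseteq> {..<n}" using decay by (simp add: H_def)
      have "card H = L" using decay(1) by (simp add: H_def card_image)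
      then show "card H + 2 \<le> k" using L kQ Q1 by linarith
      show "inj_on g {..<t}"
      proof (rule inj_onI)
        fix x y assume "x \<in> {..<t}" "y \<in> {..<t}" "g x = g y"
        then have "x * K = y * K" using inj_onD[OF decay(1), of "x * K" "y * K"] qK(1) by (simp add: g_def)
        then show "x = y" using K0 by simp
      qed
      show "g ` {..<t} \<subseteq> H" using qK(1) by (auto simp: H_def g_def)
      show "w (g (t - 1)) \<noteq> 0" using gt(2)[OF qK(1)[OF t1(1)]] by (simp add: g_def)
      show "\<bar>w (g (Suc q))\<bar> \<le> \<bar>w (g q)\<bar> / 3" if "Suc q < t" for q by (rule dec[OF that])
      show "1 / 2 ^ t \<le> e"
      proof -
        have "l \<le> real t * ln 2" using t(1) ln2 by (simp add: field_simps)
        then have "exp l \<le> exp (real t * ln 2)" by simp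
        also have "\<dots> = 2 ^ t" by (simp add: exp_of_nat_mult)
        finally have "1 / e \<le> 2 ^ t" using e by (simp add: l_def)
        then show ?thesis using e by (simp add: field_simps)
      qed
      show "9 * (\<Sum>i\<in>{..<n} - H. (w i)\<^sup>2) \<le> e\<^sup>2 * (w (g (t - 1)))\<^sup>2"
        using step[OF t1(1)] unfolding t1(2) H_def .
    qed (use e in auto)
    then show ?thesis using e by linarith
  qed
qed

section \<open>From weights back to distributions and generators\<close>

lemma kwise_independent_imp_weights:
  assumes D: "kwise_independent n k D"
  shows "kwise_weights n k {..<n} (pmf D)"
  unfolding kwise_weights_def
proof (intro conjI allI impI)
  fix A assume A: "A \<subseteq> {..<n}" "card A \<le> k"
  have supp: "set_pmf D \<subseteq> cube n" using D by (simp add: kwise_independent_def)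
  have "card A \<le> min k n" using A card_mono[OF _ A(1)] by simp
  \<comment> \<open>\<open>kwise_independent\<close> speaks about index sets of size exactly
    \<open>min k n\<close>, so \<open>A\<close> is enlarged to such a set before projecting.\<close>
  then obtain S where S: "A \<subseteq> S" "S \<subseteq> {..<n}" "card S = min k n"
    using exists_subset_between[of A "min k n" "{..<n}"] A by auto
  have fin: "finite S" using S finite_subset by blast
  have res: "(\<Prod>i\<in>A. restrict x S i) = (\<Prod>i\<in>A. x i)" for x :: "nat \<Rightarrow> real"
    by (intro prod.cong refl) (simp add: subsetD[OF S(1)])
  have "wexp n (pmf D) (\<lambda>x. \<Prod>i\<in>A. x i) = measure_pmf.expectation D (\<lambda>x. \<Prod>i\<in>A. restrict x S i)"
    unfolding wexp_def res using supp
    by (subst integral_measure_pmf_real[of "cube n"]) (auto simp: mult.commute)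
  also have "\<dots> = measure_pmf.expectation (map_pmf (\<lambda>x. restrict x S) D) (\<lambda>x. \<Prod>i\<in>A. x i)"
    by simp
  also have "map_pmf (\<lambda>x. restrict x S) D = pmf_of_set (signs S)"
    using D S by (simp add: kwise_independent_def)
  also have "measure_pmf.expectation (pmf_of_set (signs S)) (\<lambda>x. \<Prod>i\<in>A. x i) = (\<Sum>x\<in>signs S. \<Prod>i\<in>A. x i) / card (signs S)"
    by (intro integral_pmf_of_set finite_signs fin) (auto simp: signs_def PiE_eq_empty_iff)
  also have "(\<Sum>x\<in>signs S. \<Prod>i\<in>A. x i) = (\<Sum>x\<in>signs S. \<Prod>i\<in>S. if i \<in> A then x i else 1)"
    using S fin by (intro sum.cong refl) (simp add: prod.If_cases Int_absorb1)
  also have "\<dots> = (\<Prod>i\<in>S. \<Sum>y\<in>{-1,1}. if i \<in> A then y else 1)"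
    unfolding signs_def by (rule prod_sum_PiE[OF fin, symmetric]) auto
  also have "\<dots> = (\<Prod>i\<in>S. if i \<in> A then 0 else 2)" by (intro prod.cong) auto
  also have "\<dots> / card (signs S) = of_bool (A = {})"
  proof (cases "A = {}")
    case True
    then show ?thesis using fin by (simp add: card_signs)
  next
    case False
    then have "(\<Prod>i\<in>S. if i \<in> A then 0 else 2 :: real) = 0" using S fin by (intro prod_zero) auto
    then show ?thesis using False by simp
  qed
  finally show "wexp n (pmf D) (\<lambda>x. \<Prod>i\<in>A. x i) = of_bool (A = {})" .
qed auto

lemma kwise_independent_fools:
  assumes G: "G \<in> cube s \<rightarrow> cube n"
    and D: "kwise_independent n k (map_pmf G (pmf_of_set (cube s)))"
    and e: "0 < e" "e \<le> 1/2" and k: "600 * (ln (1/e))\<^sup>2 / e\<^sup>2 \<le> real k"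
  shows "fools_halfspaces n s G (2200 * e)"
  unfolding fools_halfspaces_def
proof (intro conjI G allI impI)
  fix h assume "halfspace n h"
  then obtain w \<theta> where h: "\<And>x. x \<in> cube n \<Longrightarrow> h x = sign_pm ((\<Sum>i<n. w i * x i) - \<theta>)"
    unfolding halfspace_def by blast
  let ?D = "map_pmf G (pmf_of_set (cube s))"
  have ne: "cube m \<noteq> {}" for m by (auto simp: signs_def PiE_eq_empty_iff)
  have supp: "set_pmf ?D \<subseteq> cube n" using D by (simp add: kwise_independent_def)
  have "measure_pmf.expectation (pmf_of_set (cube s)) (\<lambda>x. h (G x)) = measure_pmf.expectation ?D h"
    by simp
  also have "\<dots> = wexp n (pmf ?D) h"
    unfolding wexp_def using supp by (subst integral_measure_pmf_real[of "cube n"]) (auto simp: mult.commute)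
  also have "\<dots> = wexp n (pmf ?D) (\<lambda>x. sign_pm ((\<Sum>i<n. w i * x i) - \<theta>))" by (intro wexp_cong h)
  finally have 1: "measure_pmf.expectation (pmf_of_set (cube s)) (\<lambda>x. h (G x)) = \<dots>" .
  have "measure_pmf.expectation (pmf_of_set (cube n)) h = sum h (cube n) / card (cube n)"
    using ne by (intro integral_pmf_of_set) auto
  also have "\<dots> = wexp n (uniform_weights n) h"
    by (simp add: wexp_def card_signs sum_divide_distrib)
  also have "\<dots> = wexp n (uniform_weights n) (\<lambda>x. sign_pm ((\<Sum>i<n. w i * x i) - \<theta>))" by (intro wexp_cong h)
  finally have 2: "measure_pmf.expectation (pmf_of_set (cube n)) h = \<dots>" .
  show "\<bar>measure_pmf.expectation (pmf_of_set (cube s)) (\<lambda>x. h (G x)) - measure_pmf.expectation (pmf_of_set (cube n)) h\<bar> \<le> 2200 * e"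
    unfolding 1 2 by (rule kwise_weights_fool_halfspaces[OF kwise_independent_imp_weights[OF D] e k])
qed

text \<open>Runs the previous result with \<open>e = \<epsilon> / 2200\<close>, which puts
  \<open>2200\<^sup>2\<close> into the constant. Since
  \<open>2200 \<le> 2 ^ 12 \<le> (1 / \<epsilon>) ^ 12\<close>, the logarithm grows by a factor of
  at most 13.\<close>

lemma explicit_kwise_construction_fools:
  assumes "explicit_kwise_construction seed G"
  shows "\<exists>C'. \<forall>n\<ge>2. \<forall>\<epsilon>::real. 0 < \<epsilon> \<and> \<epsilon> \<le> 1/2 \<longrightarrow>
           (let k = nat \<lceil>(600 * 13\<^sup>2 * 2200\<^sup>2) * ((ln (1 / \<epsilon>))\<^sup>2 / \<epsilon>\<^sup>2)\<rceil> in
              fools_halfspaces n (seed n k) (G n k) \<epsilon> \<and>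
              real (seed n k) \<le> C' * (ln (real n) * (ln (1 / \<epsilon>))\<^sup>2 / \<epsilon>\<^sup>2))"
proof -
  define C :: real where "C = 600 * 13\<^sup>2 * 2200\<^sup>2"
  have C: "C > 0" by (simp add: C_def)
  from assms obtain c where c: "\<And>n k. n \<ge> 2 \<Longrightarrow> k \<ge> 1 \<Longrightarrow> real (seed n k) \<le> c * (real k * ln (real n))"
    unfolding explicit_kwise_construction_def by blast
  have main: "fools_halfspaces n (seed n k) (G n k) \<epsilon> \<and>
      real (seed n k) \<le> (\<bar>c\<bar> * (C + 1)) * (ln (real n) * (ln (1 / \<epsilon>))\<^sup>2 / \<epsilon>\<^sup>2)"
    if n: "n \<ge> 2" and \<epsilon>: "0 < \<epsilon>" "\<epsilon> \<le> 1/2" and k: "k = nat \<lceil>C * ((ln (1 / \<epsilon>))\<^sup>2 / \<epsilon>\<^sup>2)\<rceil>" for n k :: nat and \<epsilon> :: real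
  proof -
    define Q where "Q = (ln (1 / \<epsilon>))\<^sup>2 / \<epsilon>\<^sup>2"
    have ln2: "2/3 \<le> ln (1 / \<epsilon>)"
    proof -
      have "ln 2 \<le> ln (1 / \<epsilon>)" using \<epsilon> by (subst ln_le_cancel_iff) (auto simp: field_simps)
      then show ?thesis using ln2_ge_two_thirds by linarith
    qed
    have Q: "1 \<le> Q"
    proof -
      have "\<epsilon>\<^sup>2 \<le> (2/3)\<^sup>2" using \<epsilon> by (intro power_mono) auto
      also have "\<dots> \<le> (ln (1 / \<epsilon>))\<^sup>2" using ln2 by (intro power_mono) auto
      finally show ?thesis using \<epsilon> by (simp add: Q_def field_simps)
    qed
    have kQ: "C * Q \<le> real k" "real k \<le> C * Q + 1"
    proof -
      have "0 \<le> C * Q" using C Q by simp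
      then show "C * Q \<le> real k" "real k \<le> C * Q + 1" unfolding k Q_def[symmetric] by linarith+
    qed
    have "0 < C * Q" using C Q by simp
    then have k1: "k \<ge> 1" using kQ(1) by (cases k) auto
    define e where "e = \<epsilon> / 2200"
    have e: "0 < e" "e \<le> 1/2" "2200 * e = \<epsilon>" using \<epsilon> by (auto simp: e_def)
    have "ln (1 / e) \<le> 13 * ln (1 / \<epsilon>)"
    proof -
      have "(2200::real) \<le> 2 ^ 12" by simp
      also have "\<dots> \<le> (1 / \<epsilon>) ^ 12" using \<epsilon> by (intro power_mono) (auto simp: field_simps)
      finally have "2200 * (1 / \<epsilon>) \<le> (1 / \<epsilon>) ^ 12 * (1 / \<epsilon>)" using \<epsilon> by (intro mult_right_mono) auto
      also have "\<dots> = (1 / \<epsilon>) ^ 13" by (simp add: eval_nat_numeral)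
      finally have "ln (1 / e) \<le> ln ((1 / \<epsilon>) ^ 13)" using \<epsilon> by (subst ln_le_cancel_iff) (auto simp: e_def)
      also have "\<dots> = 13 * ln (1 / \<epsilon>)" using \<epsilon> by (subst ln_realpow) auto
      finally show ?thesis .
    qed
    moreover have "0 \<le> ln (1 / e)" using e by (simp add: field_simps)
    ultimately have "(ln (1 / e))\<^sup>2 \<le> (13 * ln (1 / \<epsilon>))\<^sup>2" by (rule power_mono)
    then have "600 * (ln (1/e))\<^sup>2 / e\<^sup>2 \<le> 600 * (13 * ln (1 / \<epsilon>))\<^sup>2 / e\<^sup>2"
      by (intro divide_right_mono mult_left_mono) auto
    also have "\<dots> = C * Q" by (simp add: C_def Q_def e_def power_mult_distrib power_divide)
    finally have ke: "600 * (ln (1/e))\<^sup>2 / e\<^sup>2 \<le> real k" using kQ by linarith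
    have "fools_halfspaces n (seed n k) (G n k) (2200 * e)"
    proof (rule kwise_independent_fools[OF _ _ e(1,2) ke])
      show "G n k \<in> cube (seed n k) \<rightarrow> cube n"
        using assms unfolding explicit_kwise_construction_def explicit_generator_def by blast
      show "kwise_independent n k (map_pmf (G n k) (pmf_of_set (cube (seed n k))))"
        using assms n k1 unfolding explicit_kwise_construction_def by blast
    qed
    moreover have "real (seed n k) \<le> (\<bar>c\<bar> * (C + 1)) * (ln (real n) * Q)"
    proof -
      have lnn: "0 \<le> ln (real n)" using n by simp
      have "real (seed n k) \<le> c * (real k * ln (real n))" by (rule c[OF n k1])
      also have "\<dots> \<le> \<bar>c\<bar> * ((C + 1) * Q * ln (real n))"
      proof (intro mult_mono)
        show "real k \<le> (C + 1) * Q" using kQ(2) Q by (simp add: algebra_simps)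
      qed (use lnn C Q in auto)
      finally show ?thesis by (simp add: mult_ac)
    qed
    ultimately show ?thesis by (simp add: e(3) Q_def)
  qed
  show ?thesis
    unfolding Let_def C_def[symmetric] using main[OF _ _ _ refl] by (intro exI[of _ "\<bar>c\<bar> * (C + 1)"]) blast
qed

section \<open>Programs with bounded loops\<close>

text \<open>Every loop is bounded by the value of a register on entry, so that all programs terminate and
  their running time has a bound that is computed from the syntax. \<open>Rep c b P\<close> counts down in
  register \<open>c\<close>; register \<open>2\<close> is scratch space for the constant \<open>1\<close>.\<close>

datatype loop =
    Set nat nat
  | Plus nat nat nat
  | Minus nat nat nat
  | Get nat nat
  | Put nat nat
  | Then loop loop (infixr ";;" 60)
  | Cond nat loop loop
  | Rep nat nat loop

text \<open>The machine cannot copy registers, so the counter is loaded by clearing it and adding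
  the bound; decrementing takes the 1 from register 2.\<close>

fun ram_of :: "loop \<Rightarrow> ram" where
  "ram_of (Set d c) = Const d c"
| "ram_of (Plus d a b) = Add d a b"
| "ram_of (Minus d a b) = Sub d a b"
| "ram_of (Get d a) = Load d a"
| "ram_of (Put a b) = Store a b"
| "ram_of (P ;; Q) = Seq (ram_of P) (ram_of Q)"
| "ram_of (Cond a P Q) = IfNZ a (ram_of P) (ram_of Q)"
| "ram_of (Rep c b P) =
     Seq (Seq (Const c 0) (Add c c b)) (WhileNZ c (Seq (ram_of P) (Seq (Const 2 1) (Sub c c 2))))"

definition tick :: "nat \<Rightarrow> ram_state \<Rightarrow> ram_state" where
  "tick c \<sigma> = ((fst \<sigma>)(2 := 1, c := fst \<sigma> c - 1), snd \<sigma>)"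

fun sem :: "loop \<Rightarrow> ram_state \<Rightarrow> ram_state" where
  "sem (Set d c) (r, m) = (r(d := c), m)"
| "sem (Plus d a b) (r, m) = (r(d := r a + r b), m)"
| "sem (Minus d a b) (r, m) = (r(d := r a - r b), m)"
| "sem (Get d a) (r, m) = (r(d := m (r a)), m)"
| "sem (Put a b) (r, m) = (r, m(r a := r b))"
| "sem (P ;; Q) (r, m) = sem Q (sem P (r, m))"
| "sem (Cond a P Q) (r, m) = (if r a \<noteq> 0 then sem P (r, m) else sem Q (r, m))"
| "sem (Rep c b P) (r, m) = ((\<lambda>\<sigma>. tick c (sem P \<sigma>)) ^^ r b) (r(c := r b), m)"

text \<open>The exact number of machine steps. In a loop, 3 counts the two loading instructions and
  the final test; every round adds its own test and the two instructions of the decrement.\<close>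

fun time :: "loop \<Rightarrow> ram_state \<Rightarrow> nat" where
  "time (Set d c) \<sigma> = 1"
| "time (Plus d a b) \<sigma> = 1"
| "time (Minus d a b) \<sigma> = 1"
| "time (Get d a) \<sigma> = 1"
| "time (Put a b) \<sigma> = 1"
| "time (P ;; Q) \<sigma> = time P \<sigma> + time Q (sem P \<sigma>)"
| "time (Cond a P Q) \<sigma> = Suc (if fst \<sigma> a \<noteq> 0 then time P \<sigma> else time Q \<sigma>)"
| "time (Rep c b P) \<sigma> = 3 + (\<Sum>i<fst \<sigma> b.
     time P (((\<lambda>\<sigma>. tick c (sem P \<sigma>)) ^^ i) ((fst \<sigma>)(c := fst \<sigma> b), snd \<sigma>)) + 3)"

fun writes :: "loop \<Rightarrow> nat set" where
  "writes (Set d c) = {d}"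
| "writes (Plus d a b) = {d}"
| "writes (Minus d a b) = {d}"
| "writes (Get d a) = {d}"
| "writes (Put a b) = {}"
| "writes (P ;; Q) = writes P \<union> writes Q"
| "writes (Cond a P Q) = writes P \<union> writes Q"
| "writes (Rep c b P) = insert c (insert 2 (writes P))"

fun bounds :: "loop \<Rightarrow> nat set" where
  "bounds (P ;; Q) = bounds P \<union> bounds Q"
| "bounds (Cond a P Q) = bounds P \<union> bounds Q"
| "bounds (Rep c b P) = insert b (bounds P)"
| "bounds _ = {}"

text \<open>What the translation of loops needs: clearing the counter must not destroy the bound,
  and neither the scratch register nor the body may interfere with the counter.\<close>

fun proper :: "loop \<Rightarrow> bool" where
  "proper (P ;; Q) \<longleftrightarrow> proper P \<and> proper Q"
| "proper (Cond a P Q) \<longleftrightarrow> proper P \<and> proper Q"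
| "proper (Rep c b P) \<longleftrightarrow> c \<noteq> 2 \<and> c \<noteq> b \<and> c \<notin> writes P \<and> proper P"
| "proper _ \<longleftrightarrow> True"

text \<open>Bounds the time when all loop bounds are at most \<open>N\<close>. Branches are added
  up, so that the result is visibly a polynomial in \<open>N\<close>.\<close>

fun cost :: "loop \<Rightarrow> nat \<Rightarrow> nat" where
  "cost (P ;; Q) N = cost P N + cost Q N"
| "cost (Cond a P Q) N = Suc (cost P N + cost Q N)"
| "cost (Rep c b P) N = 3 + N * (cost P N + 3)"
| "cost _ N = 1"

lemma funpow_preserves:
  assumes "\<And>x. f (g x) = f x"
  shows "f ((g ^^ n) x) = f x"
  by (induction n) (auto simp: assms)

lemma sem_unwritten: "d \<notin> writes P \<Longrightarrow> fst (sem P \<sigma>) d = fst \<sigma> d"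
proof (induction P \<sigma> rule: sem.induct)
  case (8 c b P r m)
  have "fst (tick c (sem P \<sigma>)) d = fst \<sigma> d" for \<sigma>
    using 8 by (cases \<sigma>) (auto simp: tick_def)
  then have "fst (((\<lambda>\<sigma>. tick c (sem P \<sigma>)) ^^ i) \<sigma>) d = fst \<sigma> d" for i \<sigma>
    by (rule funpow_preserves[where f = "\<lambda>\<sigma>. fst \<sigma> d"])
  then show ?case using 8 by auto
next
  case (6 P Q r m)
  then show ?case by (cases "sem P (r, m)") auto
qed auto

lemma runs_ram_of: "proper P \<Longrightarrow> runs (ram_of P) \<sigma> (time P \<sigma>) (sem P \<sigma>)"
proof (induction P arbitrary: \<sigma>)
  case (Then P Q)
  from runs.Seq[OF Then.IH(1)[of \<sigma>] Then.IH(2)[of "sem P \<sigma>"]] Then.prems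
  show ?case by (cases \<sigma>) simp
next
  case (Cond a P Q)
  then show ?case by (cases \<sigma>) (auto intro: runs.If_nonzero runs.If_zero)
next
  case (Rep c b P)
  let ?step = "\<lambda>\<sigma>. tick c (sem P \<sigma>)"
  let ?body = "Seq (ram_of P) (Seq (Const 2 1) (Sub c c 2))"
  have c: "c \<noteq> 2" "c \<noteq> b" "c \<notin> writes P" "proper P" using Rep.prems by auto
  have body: "runs ?body \<sigma> (time P \<sigma> + 2) (?step \<sigma>)" for \<sigma>
  proof -
    obtain r m where s: "sem P \<sigma> = (r, m)" by fastforce
    from runs.Seq[OF runs.Const[of 2 1 r m] runs.Sub[of c c 2 "r(2 := 1)" m]]
    have "runs (Seq (Const 2 1) (Sub c c 2)) (r, m) 2 (tick c (r, m))"
      using c by (simp add: tick_def numeral_2_eq_2)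
    then show ?thesis using Rep.IH[OF c(4)] s by (metis runs.Seq)
  qed
  \<comment> \<open>Induction on the counter value with the state generalised, because the first
    round is the one that is peeled off.\<close>
  have loop: "runs (WhileNZ c ?body) \<sigma> (1 + (\<Sum>i<N. time P ((?step ^^ i) \<sigma>) + 3)) ((?step ^^ N) \<sigma>)"
    if "fst \<sigma> c = N" for N \<sigma>
    using that
  proof (induction N arbitrary: \<sigma>)
    case 0
    then show ?case by (cases \<sigma>) (auto intro: runs.While_zero simp del: One_nat_def)
  next
    case (Suc N)
    obtain r m where s: "\<sigma> = (r, m)" by fastforce
    have "fst (?step \<sigma>) c = N" using Suc.prems sem_unwritten[OF c(3), of \<sigma>] c by (simp add: tick_def)
    from Suc.IH[OF this]
    have "runs (WhileNZ c ?body) \<sigma> (Suc ((time P \<sigma> + 2) + (1 + (\<Sum>i<N. time P ((?step ^^ i) (?step \<sigma>)) + 3))))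
        ((?step ^^ N) (?step \<sigma>))"
      using body Suc.prems unfolding s by (intro runs.While_nonzero) auto
    moreover have "Suc ((time P \<sigma> + 2) + (1 + (\<Sum>i<N. time P ((?step ^^ i) (?step \<sigma>)) + 3))) =
       1 + (\<Sum>i<Suc N. time P ((?step ^^ i) \<sigma>) + 3)"
      by (subst sum.lessThan_Suc_shift) (simp add: funpow_Suc_right del: funpow.simps(2))
    ultimately show ?case by (simp only: funpow_Suc_right o_apply)
  qed
  obtain r m where s: "\<sigma> = (r, m)" by fastforce
  from runs.Seq[OF runs.Const[of c 0 r m] runs.Add[of c c b "r(c := 0)" m]]
  have "runs (Seq (Const c 0) (Add c c b)) (r, m) 2 (r(c := r b), m)"
    using c by (simp add: numeral_2_eq_2)
  from runs.Seq[OF this loop[of "(r(c := r b), m)" "r b"]]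
  show ?case unfolding s by (simp add: numeral_3_eq_3 numeral_2_eq_2)
qed (case_tac \<sigma>, auto intro: runs.intros simp del: One_nat_def)+

text \<open>If no loop bound is ever overwritten, the initial values of the bound registers limit
  all rounds, also those of nested loops. This is why several loops below run for a fixed, too large
  number of rounds and skip the surplus.\<close>

lemma time_le_cost:
  assumes "\<forall>b\<in>bounds P. b \<notin> writes P \<and> fst \<sigma> b \<le> N"
  shows "time P \<sigma> \<le> cost P N"
  using assms
proof (induction P arbitrary: \<sigma>)
  case (Then P Q)
  have "time P \<sigma> \<le> cost P N" using Then by auto
  moreover have "time Q (sem P \<sigma>) \<le> cost Q N"
    using Then by (intro Then.IH) (auto simp: sem_unwritten)
  ultimately show ?case by simp
next
  case (Cond a P Q)
  have "time P \<sigma> \<le> cost P N" "time Q \<sigma> \<le> cost Q N" using Cond by auto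
  then show ?case by auto
next
  case (Rep c b P)
  let ?step = "\<lambda>\<sigma>. tick c (sem P \<sigma>)"
  let ?\<sigma> = "((fst \<sigma>)(c := fst \<sigma> b), snd \<sigma>)"
  have "time P ((?step ^^ i) ?\<sigma>) \<le> cost P N" for i
  proof (rule Rep.IH, rule ballI)
    fix b' assume b': "b' \<in> bounds P"
    then have w: "b' \<notin> writes P" "b' \<noteq> c" "b' \<noteq> 2" "fst \<sigma> b' \<le> N" using Rep.prems by auto
    have "fst (?step \<sigma>) b' = fst \<sigma> b'" for \<sigma> using w by (simp add: tick_def sem_unwritten)
    then have "fst ((?step ^^ i) ?\<sigma>) b' = fst ?\<sigma> b'"
      by (rule funpow_preserves[where f = "\<lambda>\<sigma>. fst \<sigma> b'"])
    then show "b' \<notin> writes P \<and> fst ((?step ^^ i) ?\<sigma>) b' \<le> N" using w by simp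
  qed
  then have "(\<Sum>i<fst \<sigma> b. time P ((?step ^^ i) ?\<sigma>) + 3) \<le> (\<Sum>i<fst \<sigma> b. cost P N + 3)"
    by (intro sum_mono add_right_mono)
  also have "\<dots> \<le> N * (cost P N + 3)" using Rep.prems by (auto intro: mult_right_mono)
  finally show ?case by simp
qed auto

lemma cost_polynomial: "\<exists>a d. \<forall>N. cost P N \<le> a * (N + 1) ^ d"
proof (induction P)
  case (Then P Q)
  then obtain a d a' d' where h: "\<And>N. cost P N \<le> a * (N + 1) ^ d" "\<And>N. cost Q N \<le> a' * (N + 1) ^ d'" by blast
  have "cost (P ;; Q) N \<le> (a + a') * (N + 1) ^ (d + d')" for N
  proof -
    have "a * (N + 1) ^ d \<le> a * (N + 1) ^ (d + d')" "a' * (N + 1) ^ d' \<le> a' * (N + 1) ^ (d + d')"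
      by (intro mult_left_mono power_increasing; simp)+
    then have "cost P N + cost Q N \<le> a * (N + 1) ^ (d + d') + a' * (N + 1) ^ (d + d')"
      by (intro add_mono order_trans[OF h(1)] order_trans[OF h(2)])
    then show ?thesis by (simp only: cost.simps distrib_right)
  qed
  then show ?case by blast
next
  case (Cond b P Q)
  then obtain a d a' d' where h: "\<And>N. cost P N \<le> a * (N + 1) ^ d" "\<And>N. cost Q N \<le> a' * (N + 1) ^ d'" by blast
  have "cost (Cond b P Q) N \<le> (1 + a + a') * (N + 1) ^ (d + d')" for N
  proof -
    have "a * (N + 1) ^ d \<le> a * (N + 1) ^ (d + d')" "a' * (N + 1) ^ d' \<le> a' * (N + 1) ^ (d + d')"
      by (intro mult_left_mono power_increasing; simp)+
    moreover have "1 \<le> (N + 1) ^ (d + d')" by simp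
    ultimately have "1 + (cost P N + cost Q N) \<le> (N + 1) ^ (d + d') + (a * (N + 1) ^ (d + d') + a' * (N + 1) ^ (d + d'))"
      by (intro add_mono order_trans[OF h(1)] order_trans[OF h(2)])
    then show ?thesis by (simp only: cost.simps distrib_right mult_1 plus_1_eq_Suc[symmetric] add.assoc)
  qed
  then show ?case by blast
next
  case (Rep c b P)
  then obtain a d where h: "\<And>N. cost P N \<le> a * (N + 1) ^ d" by blast
  have "cost (Rep c b P) N \<le> (a + 6) * (N + 1) ^ (d + 1)" for N
  proof -
    have 1: "1 \<le> (N + 1) ^ d" by simp
    have "cost (Rep c b P) N \<le> 3 * (N + 1) + (N + 1) * (cost P N + 3)" by simp
    also have "\<dots> = (N + 1) * (cost P N + 6)" by (simp add: algebra_simps)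
    also have "\<dots> \<le> (N + 1) * (a * (N + 1) ^ d + 6 * (N + 1) ^ d)"
      using h[of N] 1 by (intro mult_left_mono add_mono) auto
    also have "\<dots> = (a + 6) * (N + 1) ^ (d + 1)" by (simp add: algebra_simps)
    finally show ?thesis .
  qed
  then show ?case by blast
qed (rule exI[of _ 1], rule exI[of _ 0], simp)+

lemma sem_Rep_invariant:
  assumes "Inv 0 (r(c := r b), m)"
    and "\<And>i r' m' r'' m''. i < r b \<Longrightarrow> Inv i (r', m') \<Longrightarrow> sem P (r', m') = (r'', m'') \<Longrightarrow>
      Inv (Suc i) (r''(2 := 1, c := r'' c - 1), m'')"
  shows "Inv (r b) (sem (Rep c b P) (r, m))"
proof -
  have "i \<le> r b \<Longrightarrow> Inv i (((\<lambda>\<sigma>. tick c (sem P \<sigma>)) ^^ i) (r(c := r b), m))" for i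
  proof (induction i)
    case (Suc i)
    obtain r' m' where s: "((\<lambda>\<sigma>. tick c (sem P \<sigma>)) ^^ i) (r(c := r b), m) = (r', m')" by fastforce
    obtain r'' m'' where s': "sem P (r', m') = (r'', m'')" by fastforce
    have "((\<lambda>\<sigma>. tick c (sem P \<sigma>)) ^^ Suc i) (r(c := r b), m) = tick c (r'', m'')"
      by (simp only: funpow.simps o_apply s s')
    moreover have "Inv i (r', m')" using Suc.IH Suc.prems unfolding s by simp
    then have "Inv (Suc i) (tick c (r'', m''))" using assms(2)[OF _ _ s', of i] Suc.prems by (simp add: tick_def)
    ultimately show ?case by (simp only:)
  qed (use assms(1) in simp)
  then show ?thesis by simp
qed

declare sem.simps(8) [simp del]

section \<open>The generator as a program\<close>

text \<open>The invariant rule for all loops that follow. Registers outside the write set are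
  preserved without being mentioned, so an invariant states only what changes.\<close>

lemma sem_Rep_obtain:
  assumes base: "Inv 0 (r(c := r b)) m"
    and step: "\<And>i r' m'. i < r b \<Longrightarrow> Inv i r' m' \<Longrightarrow> (\<And>a. a \<notin> insert c (insert 2 (writes P)) \<Longrightarrow> r' a = r a) \<Longrightarrow>
      \<exists>r'' m''. sem P (r', m') = (r'', m'') \<and> Inv (Suc i) (r''(2 := 1, c := r'' c - 1)) m''"
  obtains r' m' where "sem (Rep c b P) (r, m) = (r', m')" "Inv (r b) r' m'"
    "\<And>a. a \<notin> insert c (insert 2 (writes P)) \<Longrightarrow> r' a = r a"
proof -
  let ?Inv = "\<lambda>i \<sigma>. Inv i (fst \<sigma>) (snd \<sigma>) \<and> (\<forall>a. a \<notin> insert c (insert 2 (writes P)) \<longrightarrow> fst \<sigma> a = r a)"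
  have "?Inv (r b) (sem (Rep c b P) (r, m))"
  proof (rule sem_Rep_invariant[where Inv = ?Inv])
    fix i r' m' r'' m''
    assume *: "i < r b" "?Inv i (r', m')" "sem P (r', m') = (r'', m'')"
    have "r'' a = r' a" if "a \<notin> writes P" for a using sem_unwritten[OF that, of "(r', m')"] *(3) by simp
    then show "?Inv (Suc i) (r''(2 := 1, c := r'' c - 1), m'')" using step[of i r' m'] * by auto
  qed (use base in auto)
  then show ?thesis using that[of "fst (sem (Rep c b P) (r, m))" "snd (sem (Rep c b P) (r, m))"] by auto
qed

section \<open>Parameters and memory layout\<close>

definition bitlen :: "nat \<Rightarrow> nat" where
  "bitlen n = (LEAST q. n < 2 ^ q)"

lemma bitlen_le_iff: "bitlen n \<le> q \<longleftrightarrow> n < 2 ^ q"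
proof
  have "n < 2 ^ bitlen n" unfolding bitlen_def by (rule LeastI[of _ n]) (rule less_exp)
  moreover assume "bitlen n \<le> q"
  then have "(2::nat) ^ bitlen n \<le> 2 ^ q" by (intro power_increasing) auto
  ultimately show "n < 2 ^ q" by linarith
qed (auto simp: bitlen_def intro: Least_le)

lemma bitlen_le: "bitlen n \<le> n"
  by (simp add: bitlen_le_iff less_exp)

text \<open>
  Registers shared by the phases: \<open>0, 1\<close>: \<open>n, k\<close>; \<open>3\<close>: \<open>2 ^ bitlen n\<close>;
  \<open>4\<close>: \<open>d = 2 * bitlen n\<close>; \<open>7\<close>: seed length; \<open>8, 9, 18\<close>: \<open>2 ^ d\<close>, \<open>W = 2 ^ (d + 1)\<close>, \<open>2 * W\<close>;
  \<open>10, 11\<close>: \<open>1, 2\<close>; \<open>12\<close>: address of a copy of the seed; \<open>15\<close>: address of the table of \<open>xor\<close> on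
  \<open>{..<W}\<close>; \<open>17\<close>: \<open>n - 1\<close>; \<open>34, 35\<close>: \<open>2 ^ e\<close> and the address of row \<open>f\<close> of the table, where
  \<open>f\<close> is the modulus found by the search and \<open>e\<close> its degree.
\<close>

definition size_prog :: loop where
  "size_prog = Set 3 1 ;; Set 4 0 ;; Set 7 0 ;; Set 10 1 ;; Set 11 2 ;;
     Rep 50 0 (Plus 5 0 10 ;; Minus 5 5 3 ;; Cond 5 (Plus 3 3 3 ;; Plus 4 4 11) (Set 6 0)) ;;
     Rep 50 1 (Plus 7 7 4)"

text \<open>The first loop runs \<open>n\<close> times and doubles register 3 only while
  \<open>n + 1 - 2 ^ q\<close> is nonzero, that is \<open>2 ^ q \<le> n\<close>; hence the
  \<open>min\<close> in the invariant. \<open>bitlen n \<le> n\<close> shows that \<open>n\<close>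
  rounds are enough.\<close>

lemma sem_size_prog:
  obtains r' where "sem size_prog (r, m) = (r', m)"
    "r' 0 = r 0" "r' 1 = r 1" "r' 3 = 2 ^ bitlen (r 0)" "r' 4 = 2 * bitlen (r 0)"
    "r' 7 = r 1 * (2 * bitlen (r 0))" "r' 10 = 1" "r' 11 = 2"
proof -
  define n where "n = r 0"
  define r0 where "r0 = r(3 := 1, 4 := 0, 7 := 0, 10 := 1, 11 := 2)"
  obtain r1 m1 where 1: "sem (Rep 50 0 (Plus 5 0 10 ;; Minus 5 5 3 ;; Cond 5 (Plus 3 3 3 ;; Plus 4 4 11) (Set 6 0))) (r0, m) = (r1, m1)"
    "m1 = m \<and> r1 3 = 2 ^ min (r0 0) (bitlen n) \<and> r1 4 = 2 * min (r0 0) (bitlen n)"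
    "\<And>a. a \<notin> insert 50 (insert 2 (writes (Plus 5 0 10 ;; Minus 5 5 3 ;; Cond 5 (Plus 3 3 3 ;; Plus 4 4 11) (Set 6 0)))) \<Longrightarrow> r1 a = r0 a"
  proof (rule sem_Rep_obtain[where Inv = "\<lambda>i r' m'. m' = m \<and> r' 3 = 2 ^ min i (bitlen n) \<and> r' 4 = 2 * min i (bitlen n)"
       and c = 50 and b = 0 and r = r0 and m = m])
    fix i r' m'
    assume *: "m' = m \<and> r' 3 = 2 ^ min i (bitlen n) \<and> r' 4 = 2 * min i (bitlen n)"
      "\<And>a. a \<notin> insert 50 (insert 2 (writes (Plus 5 0 10 ;; Minus 5 5 3 ;; Cond 5 (Plus 3 3 3 ;; Plus 4 4 11) (Set 6 0)))) \<Longrightarrow> r' a = r0 a"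
    have c: "r' 0 = n" "r' 10 = 1" "r' 11 = 2" by (simp_all add: *(2) r0_def n_def)
    have "i < bitlen n \<longleftrightarrow> 2 ^ min i (bitlen n) \<le> n"
      using bitlen_le_iff[of n "min i (bitlen n)"] by auto
    then show "\<exists>r'' m''. sem (Plus 5 0 10 ;; Minus 5 5 3 ;; Cond 5 (Plus 3 3 3 ;; Plus 4 4 11) (Set 6 0)) (r', m') = (r'', m'') \<and>
       m'' = m \<and> (r''(2 := 1, 50 := r'' 50 - 1)) 3 = 2 ^ min (Suc i) (bitlen n) \<and> (r''(2 := 1, 50 := r'' 50 - 1)) 4 = 2 * min (Suc i) (bitlen n)"
      using * c by (auto simp: min_def)
  qed (auto simp: r0_def)
  have c: "r1 0 = n" "r1 1 = r 1" "r1 10 = 1" "r1 11 = 2" "r1 7 = 0" by (simp_all add: 1(3) r0_def n_def)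
  have mn: "r1 3 = 2 ^ bitlen n" "r1 4 = 2 * bitlen n" using 1(2) bitlen_le[of n] by (auto simp: r0_def n_def min_def)
  obtain r2 m2 where 2: "sem (Rep 50 1 (Plus 7 7 4)) (r1, m) = (r2, m2)"
    "m2 = m \<and> r2 7 = r1 1 * (2 * bitlen n)"
    "\<And>a. a \<notin> insert 50 (insert 2 (writes (Plus 7 7 4))) \<Longrightarrow> r2 a = r1 a"
    by (rule sem_Rep_obtain[where Inv = "\<lambda>i r' m'. m' = m \<and> r' 7 = i * (2 * bitlen n)" and c = 50 and b = 1 and r = r1 and m = m and P = "Plus 7 7 4"])
       (auto simp: c mn algebra_simps)
  have "sem size_prog (r, m) = (r2, m)" using 1(1,2) 2(1,2) by (simp add: size_prog_def r0_def)
  moreover have "r2 0 = n" "r2 1 = r 1" "r2 10 = 1" "r2 11 = 2" "r2 3 = 2 ^ bitlen n" "r2 4 = 2 * bitlen n"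
    by (simp_all add: 2(3) c c[simplified] mn)
  ultimately show ?thesis using that 2(2) c by (auto simp: n_def)
qed

text \<open>The seed of length \<open>s\<close> is copied to the cells from \<open>s + n\<close> on
  and the table starts at \<open>2 * s + n\<close>; so the copy never overlaps its source and the
  first \<open>n\<close> cells are free for the output. Register 8 becomes \<open>2 ^ d\<close> by
  repeated addition, in the absence of a multiplication.\<close>

definition copy_prog :: loop where
  "copy_prog = Set 8 0 ;; Rep 50 3 (Plus 8 8 3) ;; Plus 9 8 8 ;; Plus 18 9 9 ;; Minus 17 0 10 ;;
     Plus 12 7 0 ;; Plus 15 12 7 ;; Set 13 0 ;; Plus 14 12 13 ;;
     Rep 50 7 (Get 5 13 ;; Put 14 5 ;; Plus 13 13 10 ;; Plus 14 14 10)"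

lemma sem_copy_prog:
  assumes "r 10 = 1"
  obtains r' m' where "sem copy_prog (r, m) = (r', m')"
    "\<And>a. a \<notin> {2, 5, 8, 9, 12, 13, 14, 15, 17, 18, 50} \<Longrightarrow> r' a = r a"
    "r' 8 = r 3 * r 3" "r' 9 = 2 * (r 3 * r 3)" "r' 18 = 4 * (r 3 * r 3)" "r' 17 = r 0 - 1"
    "r' 12 = r 7 + r 0" "r' 15 = 2 * r 7 + r 0"
    "\<And>j. j < r 7 \<Longrightarrow> m' (r 7 + r 0 + j) = m j" "\<And>j. 2 * r 7 + r 0 \<le> j \<Longrightarrow> m' j = m j"
proof -
  define r0 where "r0 = r(8 := 0)"
  obtain r1 m1 where 1: "sem (Rep 50 3 (Plus 8 8 3)) (r0, m) = (r1, m1)"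
    "m1 = m \<and> r1 8 = r0 3 * r 3"
    "\<And>a. a \<notin> insert 50 (insert 2 (writes (Plus 8 8 3))) \<Longrightarrow> r1 a = r0 a"
    by (rule sem_Rep_obtain[where Inv = "\<lambda>i r' m'. m' = m \<and> r' 8 = i * r 3" and c = 50 and b = 3 and r = r0 and m = m and P = "Plus 8 8 3"])
       (auto simp: r0_def)
  have r1: "r1 a = r a" if "a \<notin> {2, 8, 50}" for a using that 1(3)[of a] by (simp add: r0_def)
  define B where "B = r 7 + r 0"
  define r2 where "r2 = r1(9 := r1 8 + r1 8, 18 := r1 8 + r1 8 + (r1 8 + r1 8), 17 := r 0 - 1, 12 := B, 15 := B + r 7, 13 := 0, 14 := B)"
  have r2': "r2 7 = r 7" "r2 10 = 1" by (simp_all add: r2_def r1 assms)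
  obtain r3 m3 where 3: "sem (Rep 50 7 (Get 5 13 ;; Put 14 5 ;; Plus 13 13 10 ;; Plus 14 14 10)) (r2, m) = (r3, m3)"
    "r3 13 = r2 7 \<and> r3 14 = B + r2 7 \<and> (\<forall>j. m3 j = (if B \<le> j \<and> j < B + r2 7 then m (j - B) else m j))"
    "\<And>a. a \<notin> insert 50 (insert 2 (writes (Get 5 13 ;; Put 14 5 ;; Plus 13 13 10 ;; Plus 14 14 10))) \<Longrightarrow> r3 a = r2 a"
  proof (rule sem_Rep_obtain[where Inv = "\<lambda>i r' m'. r' 13 = i \<and> r' 14 = B + i \<and> (\<forall>j. m' j = (if B \<le> j \<and> j < B + i then m (j - B) else m j))"
       and c = 50 and b = 7 and r = r2 and m = m and P = "Get 5 13 ;; Put 14 5 ;; Plus 13 13 10 ;; Plus 14 14 10"])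
    fix i r' m'
    assume *: "i < r2 7" "r' 13 = i \<and> r' 14 = B + i \<and> (\<forall>j. m' j = (if B \<le> j \<and> j < B + i then m (j - B) else m j))"
      "\<And>a. a \<notin> insert 50 (insert 2 (writes (Get 5 13 ;; Put 14 5 ;; Plus 13 13 10 ;; Plus 14 14 10))) \<Longrightarrow> r' a = r2 a"
    have "r' 10 = 1" using *(3)[of 10] r2' by simp
    \<comment> \<open>The cell to be read lies below the region written so far.\<close>
    moreover have "i < B" using * r2' by (simp add: B_def)
    ultimately show "\<exists>r'' m''. sem (Get 5 13 ;; Put 14 5 ;; Plus 13 13 10 ;; Plus 14 14 10) (r', m') = (r'', m'') \<and>
       (r''(2 := 1, 50 := r'' 50 - 1)) 13 = Suc i \<and> (r''(2 := 1, 50 := r'' 50 - 1)) 14 = B + Suc i \<and>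
       (\<forall>j. m'' j = (if B \<le> j \<and> j < B + Suc i then m (j - B) else m j))"
      using *(2) by auto
  qed (auto simp: r2_def)
  have "sem copy_prog (r, m) = (r3, m3)"
  proof -
    have "sem copy_prog (r, m) = sem (Rep 50 7 (Get 5 13 ;; Put 14 5 ;; Plus 13 13 10 ;; Plus 14 14 10)) (r2, m)"
      using 1(1,2) by (simp add: copy_prog_def r0_def r2_def r1 B_def assms)
    then show ?thesis using 3(1) by simp
  qed
  moreover have "r3 a = r a" if "a \<notin> {2, 5, 8, 9, 12, 13, 14, 15, 17, 18, 50}" for a
    using that by (simp add: 3(3) r2_def r1)
  moreover have "r3 8 = r 3 * r 3" "r3 9 = 2 * (r 3 * r 3)" "r3 18 = 4 * (r 3 * r 3)" "r3 17 = r 0 - 1"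
    "r3 12 = r 7 + r 0" "r3 15 = 2 * r 7 + r 0"
    using 1(2) by (simp_all add: 3(3) r2_def B_def r0_def)
  moreover have "m3 (r 7 + r 0 + j) = m j" if "j < r 7" for j using that 3(2) by (simp add: r2' B_def)
  moreover have "m3 j = m j" if "2 * r 7 + r 0 \<le> j" for j using that 3(2) by (simp add: r2' B_def)
  ultimately show ?thesis using that by blast
qed

section \<open>The table of bitwise exclusive or\<close>

definition xor_table :: "nat \<Rightarrow> nat \<Rightarrow> (nat \<Rightarrow> nat) \<Rightarrow> bool" where
  "xor_table Z W m \<longleftrightarrow> (\<forall>a<W. \<forall>b<W. m (Z + a * W + b) = xor a b)"

lemma xor_double:
  fixes a b :: nat
  shows "xor (2 * a) (2 * b) = 2 * xor a b" "xor (2 * a) (2 * b + 1) = 2 * xor a b + 1"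
    "xor (2 * a + 1) (2 * b) = 2 * xor a b + 1" "xor (2 * a + 1) (2 * b + 1) = 2 * xor a b"
  by (subst xor_rec; simp)+

definition addr :: "nat \<Rightarrow> nat \<Rightarrow> nat \<Rightarrow> nat \<Rightarrow> nat" where
  "addr Z W a b = Z + a * W + b"

lemma addr_eq_iff: "b < W \<Longrightarrow> b' < W \<Longrightarrow> addr Z W a b = addr Z W a' b' \<longleftrightarrow> a = a' \<and> b = b'"
proof
  assume b: "b < W" "b' < W" and "addr Z W a b = addr Z W a' b'"
  then have e: "a * W + b = a' * W + b'" by (simp add: addr_def)
  then have "(a * W + b) div W = (a' * W + b') div W" by simp
  then have "a = a'" using b by simp
  then show "a = a' \<and> b = b'" using e by simp
qed auto

text \<open>The machine has no bitwise operations; the table is filled by doubling. One entry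
  \<open>(a, b)\<close> determines the four entries \<open>(2 * a, 2 * b)\<close> up to
  \<open>(2 * a + 1, 2 * b + 1)\<close>. Register 22 points to the source, 23 and 24 to the target
  pairs in the two rows.\<close>

definition table_row :: loop where
  "table_row = Get 25 22 ;; Plus 26 25 25 ;; Plus 27 26 10 ;; Put 23 26 ;; Plus 28 23 10 ;; Put 28 27 ;;
     Put 24 27 ;; Plus 28 24 10 ;; Put 28 26 ;; Plus 22 22 10 ;; Plus 23 23 11 ;; Plus 24 24 11"

definition table_prog :: loop where
  "table_prog = Set 20 0 ;; Plus 20 20 15 ;; Set 21 0 ;; Plus 21 21 15 ;;
     Rep 50 8 (Set 22 0 ;; Plus 22 22 20 ;; Set 23 0 ;; Plus 23 23 21 ;; Plus 24 21 9 ;;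
       Rep 51 8 table_row ;; Plus 20 20 9 ;; Plus 21 21 18)"

text \<open>Rows below \<open>2 * a\<close> are complete, and rows \<open>2 * a\<close> and
  \<open>2 * a + 1\<close> are filled up to column \<open>2 * b\<close>. The entry for
  \<open>(0, 0)\<close> is its own source, so \<open>m Z = 0\<close> has to hold before anything is
  written.\<close>

definition table_upto :: "nat \<Rightarrow> nat \<Rightarrow> nat \<Rightarrow> nat \<Rightarrow> (nat \<Rightarrow> nat) \<Rightarrow> (nat \<Rightarrow> nat) \<Rightarrow> bool" where
  "table_upto Z W a b m0 m \<longleftrightarrow>
     (\<forall>a'<W. \<forall>b'<W. a' < 2 * a \<or> (a' div 2 = a \<and> b' < 2 * b) \<longrightarrow> m (addr Z W a' b') = xor a' b') \<and>
     m Z = 0 \<and> (\<forall>j<Z. m j = m0 j)"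

lemma table_upto_step:
  assumes t: "table_upto Z W a b m0 m" and W: "W = 2 * H" and ab: "a < H" "b < H" and v: "v = m (addr Z W a b)"
  shows "table_upto Z W a (Suc b) m0 (m(addr Z W (2 * a) (2 * b) := 2 * v, addr Z W (2 * a) (2 * b + 1) := 2 * v + 1,
    addr Z W (2 * a + 1) (2 * b) := 2 * v + 1, addr Z W (2 * a + 1) (2 * b + 1) := 2 * v))"
    (is "table_upto Z W a (Suc b) m0 ?m")
proof -
  \<comment> \<open>Apart from \<open>(0, 0)\<close>, the source is always in the finished part: row
    \<open>a\<close> is complete if \<open>a > 0\<close>, and row 0 is filled up to
    \<open>2 * b > b\<close>.\<close>
  have v': "v = xor a b"
  proof (cases "a = 0 \<and> b = 0")
    case True
    then show ?thesis using t v by (simp add: table_upto_def addr_def)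
  next
    case False
    then have "a < 2 * a \<or> (a div 2 = a \<and> b < 2 * b)" by auto
    moreover have "a < W" "b < W" using W ab by auto
    ultimately show ?thesis using t unfolding v table_upto_def by blast
  qed
  have lt: "2 * b < W" "2 * b + 1 < W" using W ab by auto
  have "?m (addr Z W a' b') = xor a' b'"
    if h: "a' < W" "b' < W" "a' < 2 * a \<or> (a' div 2 = a \<and> b' < 2 * Suc b)" for a' b'
  proof (cases "a' div 2 = a \<and> b' div 2 = b")
    case True
    then have "a' = 2 * a \<or> a' = 2 * a + 1" "b' = 2 * b \<or> b' = 2 * b + 1" by auto
    then show ?thesis using lt xor_double[of a b] by (auto simp: addr_eq_iff v' simp del: xor_nat_rec)
  next
    case False
    then have "a' < 2 * a \<or> (a' div 2 = a \<and> b' < 2 * b)" using h by auto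
    then have "m (addr Z W a' b') = xor a' b'" using t h(1,2) unfolding table_upto_def by blast
    moreover have "\<not> (a' = 2 * a \<and> b' = 2 * b)" "\<not> (a' = 2 * a \<and> b' = 2 * b + 1)"
      "\<not> (a' = 2 * a + 1 \<and> b' = 2 * b)" "\<not> (a' = 2 * a + 1 \<and> b' = 2 * b + 1)" using False by auto
    ultimately show ?thesis using lt h(2) by (auto simp: addr_eq_iff)
  qed
  moreover have "?m Z = 0"
  proof -
    have Z: "Z = addr Z W 0 0" by (simp add: addr_def)
    have "0 < W" using lt by simp
    moreover have "m (addr Z W 0 0) = 0" using t Z by (simp add: table_upto_def)
    ultimately show ?thesis using lt v' by (subst (5) Z) (auto simp: addr_eq_iff)
  qed
  moreover have "?m j = m0 j" if "j < Z" for j using that t by (auto simp: table_upto_def addr_def)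
  ultimately show ?thesis unfolding table_upto_def by blast
qed

lemma sem_table_prog:
  assumes r: "r 10 = 1" "r 11 = 2" "r 9 = 2 * r 8" "r 18 = 4 * r 8" and m: "m (r 15) = 0"
  obtains r' m' where "sem table_prog (r, m) = (r', m')" "xor_table (r 15) (r 9) m'"
    "\<And>j. j < r 15 \<Longrightarrow> m' j = m j"
    "\<And>a. a \<notin> {2, 20, 21, 22, 23, 24, 25, 26, 27, 28, 50, 51} \<Longrightarrow> r' a = r a"
proof -
  define Z W H where "Z = r 15" and "W = r 9" and "H = r 8"
  have W: "W = 2 * H" by (simp add: W_def H_def r)
  let ?body = "Set 22 0 ;; Plus 22 22 20 ;; Set 23 0 ;; Plus 23 23 21 ;; Plus 24 21 9 ;;
       Rep 51 8 table_row ;; Plus 20 20 9 ;; Plus 21 21 18"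
  define r0 where "r0 = r(20 := Z, 21 := Z)"
  let ?Inv = "\<lambda>i r' m'. r' 20 = Z + i * W \<and> r' 21 = Z + (2 * i) * W \<and> table_upto Z W i 0 m m'"
  obtain r1 m1 where 1: "sem (Rep 50 8 ?body) (r0, m) = (r1, m1)" "?Inv (r0 8) r1 m1"
    "\<And>a. a \<notin> insert 50 (insert 2 (writes ?body)) \<Longrightarrow> r1 a = r0 a"
  proof (rule sem_Rep_obtain[where Inv = ?Inv and c = 50 and b = 8 and r = r0 and m = m and P = ?body])
    show "?Inv 0 (r0(50 := r0 8)) m" using m by (simp add: r0_def table_upto_def Z_def addr_def)
  next
    fix i r' m'
    assume *: "i < r0 8" "?Inv i r' m'" "\<And>a. a \<notin> insert 50 (insert 2 (writes ?body)) \<Longrightarrow> r' a = r0 a"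
    have c: "r' 8 = H" "r' 9 = W" "r' 10 = 1" "r' 11 = 2" "r' 18 = 2 * W"
      by (simp_all add: *(3) table_row_def r0_def H_def W_def r)
    have i: "i < H" using *(1) by (simp add: r0_def H_def)
    define q0 where "q0 = r'(22 := Z + i * W, 23 := Z + 2 * i * W, 24 := Z + (2 * i + 1) * W)"
    let ?J = "\<lambda>b r'' m''. r'' 22 = addr Z W i b \<and> r'' 23 = addr Z W (2 * i) (2 * b) \<and> r'' 24 = addr Z W (2 * i + 1) (2 * b) \<and> table_upto Z W i b m m''"
    obtain q1 l1 where 2: "sem (Rep 51 8 table_row) (q0, m') = (q1, l1)" "?J (q0 8) q1 l1"
      "\<And>a. a \<notin> insert 51 (insert 2 (writes table_row)) \<Longrightarrow> q1 a = q0 a"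
    proof (rule sem_Rep_obtain[where Inv = ?J and c = 51 and b = 8 and r = q0 and m = m' and P = table_row])
      show "?J 0 (q0(51 := q0 8)) m'" using *(2) by (simp add: q0_def addr_def)
    next
      fix b q l
      assume J: "b < q0 8" "?J b q l" "\<And>a. a \<notin> insert 51 (insert 2 (writes table_row)) \<Longrightarrow> q a = q0 a"
      have d: "q 10 = 1" "q 11 = 2" by (simp_all add: J(3) table_row_def q0_def c)
      have b: "b < H" using J(1) by (simp add: q0_def c)
      define v where "v = l (addr Z W i b)"
      have t: "table_upto Z W i (Suc b) m (l(addr Z W (2 * i) (2 * b) := 2 * v, addr Z W (2 * i) (2 * b + 1) := 2 * v + 1,
        addr Z W (2 * i + 1) (2 * b) := 2 * v + 1, addr Z W (2 * i + 1) (2 * b + 1) := 2 * v))"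
        using table_upto_step[OF conjunct2[OF conjunct2[OF conjunct2[OF J(2)]]] W i b v_def] .
      have s: "Suc (addr Z W x y) = addr Z W x (Suc y)" "addr Z W x y + 2 = addr Z W x (y + 2)" for x y by (simp_all add: addr_def)
      show "\<exists>q'' l''. sem table_row (q, l) = (q'', l'') \<and> ?J (Suc b) (q''(2 := 1, 51 := q'' 51 - 1)) l''"
        using J(2) d t by (simp add: table_row_def s v_def[symmetric] mult_2[symmetric])
    qed blast
    have e: "table_upto Z W i H m l1 \<Longrightarrow> table_upto Z W (Suc i) 0 m l1"
      unfolding table_upto_def using W by (auto simp: less_Suc_eq)
    have q1: "q1 20 = Z + i * W" "q1 21 = Z + 2 * i * W" "q1 9 = W" "q1 18 = 2 * W"
      using *(2) c by (simp_all add: 2(3) table_row_def q0_def)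
    have s: "sem ?body (r', m') = sem (Plus 20 20 9 ;; Plus 21 21 18) (sem (Rep 51 8 table_row) (q0, m'))"
    proof -
      have "sem (Set 22 0 ;; Plus 22 22 20 ;; Set 23 0 ;; Plus 23 23 21 ;; Plus 24 21 9 ;; Q) (r', m') = sem Q (q0, m')" for Q
        using *(2) c by (simp add: q0_def ac_simps)
      then show ?thesis by (cases "sem (Rep 51 8 table_row) (q0, m')") simp
    qed
    show "\<exists>r'' m''. sem ?body (r', m') = (r'', m'') \<and> ?Inv (Suc i) (r''(2 := 1, 50 := r'' 50 - 1)) m''"
      unfolding s 2(1) using 2(2) e q1 c by (simp add: q0_def algebra_simps)
  qed blast
  have "sem table_prog (r, m) = (r1, m1)" using 1(1) by (simp add: table_prog_def r0_def Z_def)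
  moreover have "xor_table (r 15) (r 9) m1"
    using 1(2) W unfolding xor_table_def table_upto_def addr_def Z_def[symmetric] W_def[symmetric] by (simp add: r0_def H_def)
  moreover have "m1 j = m j" if "j < r 15" for j using 1(2) that by (simp add: table_upto_def Z_def)
  moreover have "r1 a = r a" if "a \<notin> {2, 20, 21, 22, 23, 24, 25, 26, 27, 28, 50, 51}" for a
    using that by (simp add: 1(3) table_row_def r0_def)
  ultimately show ?thesis using that by blast
qed

text \<open>A number encodes the polynomial over GF(2) whose coefficients are its binary digits. For a
  modulus \<open>f\<close> of degree \<open>e\<close> and \<open>E = 2 ^ e\<close>, \<open>tstep E f\<close> is multiplication by \<open>x\<close> modulo \<open>f\<close>.\<close>

definition tstep :: "nat \<Rightarrow> nat \<Rightarrow> nat \<Rightarrow> nat" where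
  "tstep E f q = (if 2 * q < E then 2 * q else xor (2 * q) f)"

text \<open>The test \<open>2 * q < E\<close> is a nonzero truncated difference. Otherwise the
  reduction is a single lookup at offset \<open>2 * q\<close> in row \<open>f\<close>, whose address
  is in register \<open>b\<close>.\<close>

definition mul_x :: "nat \<Rightarrow> nat \<Rightarrow> nat \<Rightarrow> loop" where
  "mul_x a e b = Plus 42 a a ;; Minus 43 e 42 ;; Cond 43 (Set a 0 ;; Plus a a 42) (Plus 42 42 b ;; Get a 42)"

lemma writes_mul_x [simp]: "writes (mul_x a e b) = {42, 43, a}"
  by (auto simp: mul_x_def)

lemma sem_mul_x:
  assumes "a \<notin> {42, 43}" "e \<notin> {42, 43}" "b \<notin> {42, 43}"
    and "xor_table Z W m" "r b = Z + f * W" "f < W" "2 * r a < W"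
  shows "sem (mul_x a e b) (r, m) =
    (r(42 := if 2 * r a < r e then 2 * r a else 2 * r a + r b, 43 := r e - 2 * r a, a := tstep (r e) f (r a)), m)"
proof -
  have "m (Z + f * W + 2 * r a) = xor (2 * r a) f"
    using assms(4,6,7) by (simp add: xor_table_def xor.commute)
  then have "m (2 * r a + r b) = xor (2 * r a) f" by (simp add: assms(5) ac_simps)
  then show ?thesis using assms(1-3) by (auto simp: mul_x_def tstep_def fun_upd_twist simp flip: mult_2)
qed

text \<open>If \<open>2 * q \<ge> E\<close>, both \<open>2 * q\<close> and \<open>f\<close> have
  their top bit at position \<open>e\<close>, and the two cancel.\<close>

lemma tstep_less:
  assumes "E = 2 ^ e" "E \<le> f" "f < 2 * E" "q < E"
  shows "tstep E f q < E"
proof (cases "2 * q < E")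
  case False
  have div1: "x div 2 ^ e = 1" if "2 ^ e \<le> x" "x < 2 * 2 ^ e" for x :: nat
    using that by (intro div_nat_eqI) auto
  have "drop_bit e (xor (2 * q) f) = xor (drop_bit e (2 * q)) (drop_bit e f)" by (rule drop_bit_xor)
  also have "drop_bit e (2 * q) = 1" using div1[of "2 * q"] assms False by (simp add: drop_bit_eq_div)
  also have "drop_bit e f = 1" using div1[of f] assms by (simp add: drop_bit_eq_div)
  also have "xor 1 1 = (0::nat)" by simp
  finally have "xor (2 * q) f div 2 ^ e = 0" by (simp only: drop_bit_eq_div)
  then have "xor (2 * q) f < 2 ^ e" using assms(1) by (simp add: div_eq_0_iff)
  then show ?thesis using False assms(1) by (simp add: tstep_def)
qed (simp add: tstep_def)

lemma tstep_funpow_less: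
  assumes "E = 2 ^ e" "E \<le> f" "f < 2 * E" "q < E"
  shows "(tstep E f ^^ i) q < E"
  by (induction i) (auto intro: tstep_less[OF assms(1-3)] assms(4))

section \<open>The search for a modulus\<close>

definition cmp_body :: loop where
  "cmp_body = mul_x 41 31 32 ;; Minus 44 41 39 ;; Minus 45 39 41 ;; Plus 44 44 45 ;; Cond 44 (Set 45 0) (Set 38 1)"

text \<open>Register 39 runs through the candidates \<open>h\<close>. \<open>E\<close> grows during
  the search and must not bound a loop, so the bound is the fixed \<open>W\<close>, and
  \<open>h \<ge> E\<close> is skipped.\<close>

definition test_body :: loop where
  "test_body = Minus 40 31 39 ;; Cond 40 (Set 41 0 ;; Plus 41 41 39 ;; Rep 52 17 cmp_body) (Set 45 0) ;; Plus 39 39 10"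

lemma writes_cmp_body [simp]: "writes cmp_body = {38, 41, 42, 43, 44, 45}"
  by (auto simp: cmp_body_def)

lemma writes_test_body [simp]: "writes test_body = {2, 38, 39, 40, 41, 42, 43, 44, 45, 52}"
  by (auto simp: test_body_def)

text \<open>Holding for all \<open>0 < h < E\<close>, this says that \<open>x ^ r - 1\<close> is a unit modulo \<open>f\<close> for \<open>0 < r < n\<close>.\<close>

definition orbit_free :: "nat \<Rightarrow> nat \<Rightarrow> nat \<Rightarrow> nat \<Rightarrow> bool" where
  "orbit_free n E f h \<longleftrightarrow> (\<forall>r. 0 < r \<and> r < n \<longrightarrow> (tstep E f ^^ r) h \<noteq> h)"

text \<open>Register 17 holds \<open>n - 1\<close>, so exactly the powers below \<open>n\<close> are
  compared with \<open>h\<close>; this explains \<open>r 17 + 1\<close>. Register 38 is a failure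
  flag that is never reset within the loop.\<close>

lemma sem_cmp_loop:
  assumes E: "E = 2 ^ e" "E \<le> f" "f < 2 * E" "2 * E \<le> W"
    and r: "r 31 = E" "r 32 = Z + f * W" "r 39 = h" "r 41 = h" "r 38 = of_bool b" "h < E"
    and t: "xor_table Z W m"
  obtains r' where "sem (Rep 52 17 cmp_body) (r, m) = (r', m)"
    "r' 38 = of_bool (b \<or> \<not> orbit_free (r 17 + 1) E f h)"
    "\<And>a. a \<notin> {2, 38, 41, 42, 43, 44, 45, 52} \<Longrightarrow> r' a = r a"
proof -
  let ?Inv = "\<lambda>i r' m'. m' = m \<and> r' 41 = (tstep E f ^^ i) h \<and> r' 38 = of_bool (b \<or> \<not> orbit_free (i + 1) E f h)"
  obtain r1 m1 where 1: "sem (Rep 52 17 cmp_body) (r, m) = (r1, m1)" "?Inv (r 17) r1 m1"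
    "\<And>a. a \<notin> insert 52 (insert 2 (writes cmp_body)) \<Longrightarrow> r1 a = r a"
  proof (rule sem_Rep_obtain[where Inv = ?Inv and c = 52 and b = 17 and r = r and m = m and P = cmp_body])
    show "?Inv 0 (r(52 := r 17)) m" by (auto simp: r orbit_free_def)
  next
    fix i r' m'
    assume *: "?Inv i r' m'" "\<And>a. a \<notin> insert 52 (insert 2 (writes cmp_body)) \<Longrightarrow> r' a = r a"
    have c: "r' 31 = E" "r' 32 = Z + f * W" "r' 39 = h" by (simp_all add: *(2) r)
    have q: "(tstep E f ^^ i) h < E" by (rule tstep_funpow_less[OF E(1-3) r(6)])
    have "f < W" "2 * (tstep E f ^^ i) h < W" using q E by linarith+
    then have s: "sem (mul_x 41 31 32) (r', m) = (r'(42 := if 2 * r' 41 < r' 31 then 2 * r' 41 else 2 * r' 41 + r' 32,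
       43 := r' 31 - 2 * r' 41, 41 := tstep E f (r' 41)), m)"
      using sem_mul_x[of 41 31 32 Z W m r' f] t c *(1) by simp
    have of: "orbit_free (Suc i + 1) E f h \<longleftrightarrow> orbit_free (i + 1) E f h \<and> (tstep E f ^^ Suc i) h \<noteq> h"
      unfolding orbit_free_def by (auto simp: less_Suc_eq)
    \<comment> \<open>Inequality is tested by adding both truncated differences.\<close>
    have eq: "x - y + (y - x) = 0 \<longleftrightarrow> x = y" for x y :: nat by auto
    show "\<exists>r'' m''. sem cmp_body (r', m') = (r'', m'') \<and> ?Inv (Suc i) (r''(2 := 1, 52 := r'' 52 - 1)) m''"
      using *(1) c of by (auto simp: cmp_body_def s)
  qed blast
  have "sem (Rep 52 17 cmp_body) (r, m) = (r1, m)" using 1 by simp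
  moreover have "r1 a = r a" if "a \<notin> {2, 38, 41, 42, 43, 44, 45, 52}" for a using that by (simp add: 1(3))
  ultimately show ?thesis using that 1(2) by blast
qed

lemma sem_test_loop:
  assumes E: "E = 2 ^ e" "E \<le> f" "f < 2 * E" "2 * E \<le> W"
    and r: "r 31 = E" "r 32 = Z + f * W" "r 39 = 1" "r 38 = 0" "r 10 = 1" "r 9 = W"
    and t: "xor_table Z W m"
  obtains r' where "sem (Rep 51 9 test_body) (r, m) = (r', m)"
    "r' 38 = of_bool (\<not> (\<forall>h. 0 < h \<and> h < E \<longrightarrow> orbit_free (r 17 + 1) E f h))"
    "\<And>a. a \<notin> {2, 38, 39, 40, 41, 42, 43, 44, 45, 51, 52} \<Longrightarrow> r' a = r a"
proof -
  let ?Inv = "\<lambda>i r' m'. m' = m \<and> r' 39 = i + 1 \<and>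
     r' 38 = of_bool (\<not> (\<forall>h. 0 < h \<and> h \<le> i \<and> h < E \<longrightarrow> orbit_free (r 17 + 1) E f h))"
  obtain r1 m1 where 1: "sem (Rep 51 9 test_body) (r, m) = (r1, m1)" "?Inv (r 9) r1 m1"
    "\<And>a. a \<notin> insert 51 (insert 2 (writes test_body)) \<Longrightarrow> r1 a = r a"
  proof (rule sem_Rep_obtain[where Inv = ?Inv and c = 51 and b = 9 and r = r and m = m and P = test_body])
    show "?Inv 0 (r(51 := r 9)) m" by (auto simp: r)
  next
    fix i r' m'
    assume *: "?Inv i r' m'" "\<And>a. a \<notin> insert 51 (insert 2 (writes test_body)) \<Longrightarrow> r' a = r a"
    have c: "r' 31 = E" "r' 32 = Z + f * W" "r' 10 = 1" "r' 17 = r 17" by (simp_all add: *(2) r)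
    have up: "(\<forall>h. 0 < h \<and> h \<le> Suc i \<and> h < E \<longrightarrow> orbit_free (r 17 + 1) E f h) \<longleftrightarrow>
       (\<forall>h. 0 < h \<and> h \<le> i \<and> h < E \<longrightarrow> orbit_free (r 17 + 1) E f h) \<and> (i + 1 < E \<longrightarrow> orbit_free (r 17 + 1) E f (i + 1))"
      by (auto simp: le_Suc_eq)
    show "\<exists>r'' m''. sem test_body (r', m') = (r'', m'') \<and> ?Inv (Suc i) (r''(2 := 1, 51 := r'' 51 - 1)) m''"
    proof (cases "i + 1 < E")
      case True
      define q where "q = r'(40 := E - (i + 1), 41 := i + 1)"
      have q: "q 31 = E" "q 32 = Z + f * W" "q 39 = i + 1" "q 41 = i + 1"
        "q 38 = of_bool (\<not> (\<forall>h. 0 < h \<and> h \<le> i \<and> h < E \<longrightarrow> orbit_free (r 17 + 1) E f h))"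
        using *(1) c by (simp_all add: q_def)
      obtain r2 where 2: "sem (Rep 52 17 cmp_body) (q, m) = (r2, m)"
        "r2 38 = of_bool (\<not> (\<forall>h. 0 < h \<and> h \<le> i \<and> h < E \<longrightarrow> orbit_free (r 17 + 1) E f h) \<or> \<not> orbit_free (q 17 + 1) E f (i + 1))"
        "\<And>a. a \<notin> {2, 38, 41, 42, 43, 44, 45, 52} \<Longrightarrow> r2 a = q a"
        by (rule sem_cmp_loop[OF E q True t]) blast
      have "sem test_body (r', m) = sem (Plus 39 39 10) (r2, m)"
        using 2(1) *(1) c True by (simp add: test_body_def q_def)
      moreover have "r2 39 = i + 1" "r2 10 = 1" "q 17 = r 17" using *(1) c by (simp_all add: 2(3) q_def)
      ultimately show ?thesis using *(1) 2(2) up True by (auto simp: c)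
    next
      case False
      then show ?thesis using *(1) c up by (simp add: test_body_def)
    qed
  qed blast
  have "sem (Rep 51 9 test_body) (r, m) = (r1, m)" using 1 by simp
  moreover have "r1 38 = of_bool (\<not> (\<forall>h. 0 < h \<and> h < E \<longrightarrow> orbit_free (r 17 + 1) E f h))"
  proof -
    have "h \<le> W" if "h < E" for h using that E(4) by linarith
    then show ?thesis using 1(2) r(6) by (auto simp: of_bool_def)
  qed
  moreover have "r1 a = r a" if "a \<notin> {2, 38, 39, 40, 41, 42, 43, 44, 45, 51, 52}" for a using that by (simp add: 1(3))
  ultimately show ?thesis using that by blast
qed

text \<open>\<open>f\<close> odd means that the constant coefficient is 1, which makes x a unit; the
  inequalities say that the degree is \<open>e\<close>. The bound \<open>e \<le> d\<close> lets a
  residue fit into a block of \<open>d\<close> seed bits and \<open>f\<close> into the table. The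
  residue ring may have zero divisors; the differences of powers of x are what must be
  invertible.\<close>

definition valid_modulus :: "nat \<Rightarrow> nat \<Rightarrow> nat \<Rightarrow> nat \<Rightarrow> bool" where
  "valid_modulus n d f E \<longleftrightarrow> odd f \<and> (\<exists>e. 0 < e \<and> e \<le> d \<and> E = 2 ^ e) \<and> E \<le> f \<and> f < 2 * E \<and>
     (\<forall>h. 0 < h \<and> h < E \<longrightarrow> orbit_free n E f h)"

text \<open>The search keeps the last valid modulus that it meets. Maximality makes the result unique and
  hence independent of the seed.\<close>

definition max_modulus :: "nat \<Rightarrow> nat \<Rightarrow> nat \<Rightarrow> nat \<Rightarrow> bool" where
  "max_modulus n d f E \<longleftrightarrow> valid_modulus n d f E \<and> (\<forall>f' E'. valid_modulus n d f' E' \<longrightarrow> f' \<le> f)"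

lemma valid_modulus_unique: "valid_modulus n d f E \<Longrightarrow> 2 ^ e \<le> f \<Longrightarrow> f < 2 * 2 ^ e \<Longrightarrow> E = 2 ^ e"
proof -
  assume val: "valid_modulus n d f E" and e: "2 ^ e \<le> f" "f < 2 * 2 ^ e"
  obtain e' where e': "E = 2 ^ e'" "2 ^ e' \<le> f" "f < 2 * 2 ^ e'" using val by (auto simp: valid_modulus_def)
  have "2 ^ e < (2::nat) ^ Suc e'" "2 ^ e' < (2::nat) ^ Suc e" using e e' by simp_all
  then have "e < Suc e'" "e' < Suc e"
    using power_less_imp_less_exp[of "2::nat" e "Suc e'"] power_less_imp_less_exp[of "2::nat" e' "Suc e"] by simp_all
  then show "E = 2 ^ e" using e'(1) by simp
qed

lemma max_modulus_unique:
  assumes "max_modulus n d f E" "max_modulus n d f' E'"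
  shows "f' = f" "E' = E"
proof -
  show "f' = f" using assms by (auto simp: max_modulus_def intro: antisym)
  moreover obtain e where "E = 2 ^ e" "2 ^ e \<le> f" "f < 2 * 2 ^ e"
    using assms(1) by (auto simp: max_modulus_def valid_modulus_def)
  ultimately show "E' = E" using valid_modulus_unique[of n d f' E' e] assms(2) by (simp add: max_modulus_def)
qed

text \<open>Register 30 runs through the odd numbers, so the row address in register 32 advances by
  \<open>2 * W\<close>. The power of two in register 31 is doubled at the start of a round once
  \<open>f\<close> has reached the next power.\<close>

definition search_body :: loop where
  "search_body = Plus 36 31 31 ;; Minus 37 36 30 ;; Cond 37 (Set 36 0) (Plus 31 31 31) ;;
     Set 38 0 ;; Set 39 1 ;; Rep 51 9 test_body ;;
     Cond 38 (Set 45 0) (Set 33 0 ;; Plus 33 33 30 ;; Set 34 0 ;; Plus 34 34 31 ;; Set 35 0 ;; Plus 35 35 32) ;;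
     Plus 30 30 11 ;; Plus 32 32 18"

definition search_prog :: loop where
  "search_prog = Set 30 1 ;; Set 31 1 ;; Plus 32 15 9 ;; Rep 50 8 search_body"

lemma writes_search_body [simp]:
  "writes search_body = {2, 30, 31, 32, 33, 34, 35, 36, 37, 38, 39, 40, 41, 42, 43, 44, 45, 51, 52}"
  by (auto simp: search_body_def)

lemma sem_search_prog:
  assumes r: "r 8 = 2 ^ d" "r 9 = 2 * 2 ^ d" "r 10 = 1" "r 11 = 2" "r 18 = 2 * r 9" "r 17 = n - 1" "n > 0"
    and t: "xor_table (r 15) (r 9) m" and ex: "\<exists>f E. valid_modulus n d f E"
  obtains r' f E where "sem search_prog (r, m) = (r', m)" "max_modulus n d f E"
    "r' 34 = E" "r' 35 = r 15 + f * r 9"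
    "\<And>a. a \<notin> {2, 30, 31, 32, 33, 34, 35, 36, 37, 38, 39, 40, 41, 42, 43, 44, 45, 50, 51, 52} \<Longrightarrow> r' a = r a"
proof -
  define Z W where "Z = r 15" and "W = r 9"
  define r0 where "r0 = r(30 := 1, 31 := 1, 32 := Z + W)"
  \<comment> \<open>Between rounds \<open>f\<close> has moved on but the power of two has not been
    adjusted yet, which allows the value \<open>2 * 2 ^ e + 1\<close>. Nothing is claimed about
    registers 34 and 35 until a valid modulus has been met.\<close>
  let ?Inv = "\<lambda>i r' m'. m' = m \<and> r' 30 = 2 * i + 1 \<and> r' 32 = Z + (2 * i + 1) * W \<and>
     (\<exists>e. r' 31 = 2 ^ e \<and> 2 ^ e \<le> 2 * i + 1 \<and> 2 * i + 1 \<le> 2 * 2 ^ e + 1) \<and>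
     ((\<exists>f E. f < 2 * i + 1 \<and> valid_modulus n d f E) \<longrightarrow> (\<exists>f E. valid_modulus n d f E \<and>
       (\<forall>f' E'. f' < 2 * i + 1 \<and> valid_modulus n d f' E' \<longrightarrow> f' \<le> f) \<and> r' 34 = E \<and> r' 35 = Z + f * W))"
  obtain r1 m1 where 1: "sem (Rep 50 8 search_body) (r0, m) = (r1, m1)" "?Inv (r0 8) r1 m1"
    "\<And>a. a \<notin> insert 50 (insert 2 (writes search_body)) \<Longrightarrow> r1 a = r0 a"
  proof (rule sem_Rep_obtain[where Inv = ?Inv and c = 50 and b = 8 and r = r0 and m = m and P = search_body])
    show "?Inv 0 (r0(50 := r0 8)) m" by (auto simp: r0_def valid_modulus_def intro: exI[of _ 0])
  next
    fix i r' m'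
    assume *: "i < r0 8" "?Inv i r' m'" "\<And>a. a \<notin> insert 50 (insert 2 (writes search_body)) \<Longrightarrow> r' a = r0 a"
    have c: "r' 9 = W" "r' 10 = 1" "r' 11 = 2" "r' 17 = n - 1" "r' 18 = 2 * W" by (simp_all add: *(3) r r0_def W_def)
    define f where "f = 2 * i + 1"
    have fW: "f < W" using *(1) r by (simp add: f_def W_def r0_def)
    obtain e0 where e0: "r' 31 = 2 ^ e0" "2 ^ e0 \<le> f" "f \<le> 2 * 2 ^ e0 + 1" using *(2) by (auto simp: f_def)
    define e where "e = (if f < 2 * 2 ^ e0 then e0 else Suc e0)"
    have "(0::nat) < 2 ^ e0" by simp
    then have "2 * 2 ^ e0 + 1 < 4 * (2::nat) ^ e0" by linarith
    then have e: "2 ^ e \<le> f" "f < 2 * 2 ^ e" using e0 by (auto simp: e_def)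
    have "2 ^ e < (2::nat) ^ Suc d" using e fW by (simp add: W_def r)
    then have ed: "e \<le> d" using power_less_imp_less_exp[of "2::nat" e "Suc d"] by simp
    then have EW: "2 * 2 ^ e \<le> W" using power_increasing[of e d "2::nat"] by (simp add: W_def r)
    define q where "q = r'(31 := 2 ^ e, 36 := if f < 2 * 2 ^ e0 then 0 else 2 * 2 ^ e0, 37 := 2 * 2 ^ e0 - f, 38 := 0, 39 := 1)"
    obtain r2 where 2: "sem (Rep 51 9 test_body) (q, m) = (r2, m)"
      "r2 38 = of_bool (\<not> (\<forall>h. 0 < h \<and> h < 2 ^ e \<longrightarrow> orbit_free (q 17 + 1) (2 ^ e) f h))"
      "\<And>a. a \<notin> {2, 38, 39, 40, 41, 42, 43, 44, 45, 51, 52} \<Longrightarrow> r2 a = q a"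
      by (rule sem_test_loop[of "2 ^ e" e f W q Z m])
        (use e EW t *(2) c in \<open>simp_all add: q_def f_def Z_def W_def\<close>)
    have q17: "q 17 + 1 = n" using c \<open>n > 0\<close> by (simp add: q_def)
    have r2: "r2 30 = f" "r2 31 = 2 ^ e" "r2 32 = Z + f * W" "r2 11 = 2" "r2 18 = 2 * W" "r2 34 = r' 34" "r2 35 = r' 35"
      using *(2) c by (simp_all add: 2(3) q_def f_def)
    let ?good = "\<forall>h. 0 < h \<and> h < 2 ^ e \<longrightarrow> orbit_free n (2 ^ e) f h"
    have "sem search_body (r', m) = sem (Cond 38 (Set 45 0) (Set 33 0 ;; Plus 33 33 30 ;; Set 34 0 ;; Plus 34 34 31 ;; Set 35 0 ;; Plus 35 35 32) ;;
     Plus 30 30 11 ;; Plus 32 32 18) (sem (Rep 51 9 test_body) (q, m))"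
    proof -
      have "sem (Plus 36 31 31 ;; Minus 37 36 30 ;; Cond 37 (Set 36 0) (Plus 31 31 31) ;; Set 38 0 ;; Set 39 1 ;; Q) (r', m) = sem Q (q, m)" for Q
      proof -
        have "r' 30 = f" using *(2) by (simp add: f_def)
        then show ?thesis
          using e0(1) by (auto simp: q_def e_def mult_2 intro!: arg_cong[where f = "\<lambda>r. sem Q (r, m)"] ext)
      qed
      then show ?thesis unfolding search_body_def 2(1) by (simp add: 2(1))
    qed
    then have s: "sem search_body (r', m) =
      (if ?good then r2(33 := f, 34 := 2 ^ e, 35 := Z + f * W, 30 := f + 2, 32 := Z + f * W + 2 * W)
       else r2(45 := 0, 30 := f + 2, 32 := Z + f * W + 2 * W), m)"
      unfolding 2(1) using 2(2) r2 q17 by (auto simp: fun_upd_twist)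
    have uniq: "valid_modulus n d f E \<Longrightarrow> E = 2 ^ e" for E
      by (rule valid_modulus_unique[OF _ e])
    have e2: "0 < e" if "f \<noteq> 1" using e that by (cases e) auto
    \<comment> \<open>Stepping by two misses the even numbers, none of which is valid.\<close>
    have split: "f' < 2 * Suc i + 1 \<Longrightarrow> valid_modulus n d f' E' \<Longrightarrow> f' < 2 * i + 1 \<or> f' = f" for f' E'
    proof -
      assume "f' < 2 * Suc i + 1" "valid_modulus n d f' E'"
      then have "f' \<le> 2 * i + 2" "odd f'" by (auto simp: valid_modulus_def)
      then show ?thesis by (cases "f' = 2 * i + 2") (auto simp: f_def)
    qed
    have res: "(\<exists>f' E. f' < 2 * Suc i + 1 \<and> valid_modulus n d f' E) \<longrightarrow>
      (\<exists>f' E. valid_modulus n d f' E \<and> (\<forall>f'' E'. f'' < 2 * Suc i + 1 \<and> valid_modulus n d f'' E' \<longrightarrow> f'' \<le> f') \<and>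
        (if ?good then 2 ^ e else r' 34) = E \<and> (if ?good then Z + f * W else r' 35) = Z + f' * W)"
    proof
      assume "\<exists>f' E. f' < 2 * Suc i + 1 \<and> valid_modulus n d f' E"
      then obtain f' E' where f': "f' < 2 * Suc i + 1" "valid_modulus n d f' E'" by blast
      show "\<exists>f' E. valid_modulus n d f' E \<and> (\<forall>f'' E'. f'' < 2 * Suc i + 1 \<and> valid_modulus n d f'' E' \<longrightarrow> f'' \<le> f') \<and>
        (if ?good then 2 ^ e else r' 34) = E \<and> (if ?good then Z + f * W else r' 35) = Z + f' * W"
      proof (cases ?good)
        case True
        \<comment> \<open>For \<open>f = 1\<close> the test succeeds vacuously although degree 0 is
          not valid. The existence of a valid \<open>f'\<close> up to this round excludes that
          \<open>f\<close> is 1.\<close>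
        obtain e' where "0 < e'" "2 ^ e' \<le> f'" using f'(2) by (auto simp: valid_modulus_def)
        moreover have "(2::nat) ^ 1 \<le> 2 ^ e'" using \<open>0 < e'\<close> by (intro power_increasing) auto
        ultimately have "f' \<noteq> 1" by auto
        then have "f \<noteq> 1" using split[OF f'] f'(2) by (auto simp: f_def valid_modulus_def)
        then have "valid_modulus n d f (2 ^ e)"
          using True e ed e2 by (auto simp: valid_modulus_def f_def)
        moreover have "f'' \<le> f" if "f'' < 2 * Suc i + 1" "valid_modulus n d f'' E''" for f'' E''
          using split[OF that] by (auto simp: f_def)
        ultimately show ?thesis unfolding if_P[OF True] by blast
      next
        case False
        have old: "f3 < 2 * i + 1" if "f3 < 2 * Suc i + 1" "valid_modulus n d f3 E3" for f3 E3
        proof -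
          have "f3 \<noteq> f"
          proof
            assume "f3 = f"
            then have v: "valid_modulus n d f E3" using that by simp
            show False using v False unfolding uniq[OF v] valid_modulus_def by blast
          qed
          then show ?thesis using split[OF that] by blast
        qed
        obtain f'' E'' where f'': "valid_modulus n d f'' E''" "r' 34 = E''" "r' 35 = Z + f'' * W"
          "\<And>f3 E3. f3 < 2 * i + 1 \<Longrightarrow> valid_modulus n d f3 E3 \<Longrightarrow> f3 \<le> f''"
          using *(2) f'(2) old[OF f'] by blast
        have "\<forall>f3 E3. f3 < 2 * Suc i + 1 \<and> valid_modulus n d f3 E3 \<longrightarrow> f3 \<le> f''" using old f''(4) by blast
        then show ?thesis unfolding if_not_P[OF False] using f''(1-3) by blast
      qed
    qed
    have E: "\<exists>e. 2 ^ e \<le> 2 * Suc i + 1 \<and> 2 * Suc i + 1 \<le> 2 * 2 ^ e + 1 \<and> r2 31 = 2 ^ e"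
      using e r2 by (intro exI[of _ e]) (auto simp: f_def)
    show "\<exists>r'' m''. sem search_body (r', m') = (r'', m'') \<and> ?Inv (Suc i) (r''(2 := 1, 50 := r'' 50 - 1)) m''"
    proof (cases ?good)
      case True
      then show ?thesis using s *(2) res E by (auto simp: f_def r2 algebra_simps)
    next
      case False
      then have "sem search_body (r', m) = (r2(45 := 0, 30 := f + 2, 32 := Z + f * W + 2 * W), m)"
        by (simp only: s False if_False)
      moreover have "(\<exists>f' E. f' < 2 * Suc i + 1 \<and> valid_modulus n d f' E) \<longrightarrow>
        (\<exists>f' E. valid_modulus n d f' E \<and> (\<forall>f'' E'. f'' < 2 * Suc i + 1 \<and> valid_modulus n d f'' E' \<longrightarrow> f'' \<le> f') \<and>
          r' 34 = E \<and> r' 35 = Z + f' * W)"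
        using res by (simp only: False if_False)
      ultimately show ?thesis using *(2) E by (auto simp: f_def r2 algebra_simps)
    qed
  qed blast
  have r08: "r0 8 = 2 ^ d" by (simp add: r0_def r)
  have small: "f < 2 * r0 8 + 1" if val: "valid_modulus n d f E" for f E
  proof -
    obtain e where e: "e \<le> d" "E = 2 ^ e" "f < 2 * E" using val by (auto simp: valid_modulus_def)
    have "(2::nat) ^ e \<le> 2 ^ d" using e(1) by (intro power_increasing) auto
    then have "f < 2 * 2 ^ d" using e by linarith
    then show ?thesis using r08 by simp
  qed
  then have "\<exists>f E. f < 2 * r0 8 + 1 \<and> valid_modulus n d f E" using ex by blast
  then obtain f E where "valid_modulus n d f E" "r1 34 = E" "r1 35 = Z + f * W"
    "\<forall>f' E'. f' < 2 * r0 8 + 1 \<and> valid_modulus n d f' E' \<longrightarrow> f' \<le> f" using 1(2) by blast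
  then have "max_modulus n d f E" "r1 34 = E" "r1 35 = Z + f * W" using small by (auto simp: max_modulus_def)
  moreover have "sem search_prog (r, m) = (r1, m)"
    using 1(1,2) by (simp add: search_prog_def r0_def Z_def W_def)
  moreover have "r1 a = r a" if "a \<notin> {2, 30, 31, 32, 33, 34, 35, 36, 37, 38, 39, 40, 41, 42, 43, 44, 45, 50, 51, 52}" for a
    using that by (simp add: 1(3) r0_def)
  ultimately show ?thesis using that unfolding Z_def W_def by blast
qed

section \<open>Computing the output bits\<close>

definition tbit :: "nat \<Rightarrow> nat \<Rightarrow> nat \<Rightarrow> nat" where
  "tbit E f t = of_bool (E \<le> 2 * (tstep E f ^^ t) 1)"

text \<open>Block \<open>j\<close> of \<open>d\<close> bits is the coefficient polynomial c_j. By
  linearity, the top coefficient (position \<open>e - 1\<close>) of the sum of the c_j * x^(i j)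
  modulo \<open>f\<close> is a sum of top coefficients of single powers of x. \<open>tbit\<close>
  reads such a coefficient by a comparison, so no bit extraction is needed.\<close>

definition out_bit :: "nat \<Rightarrow> nat \<Rightarrow> nat \<Rightarrow> nat \<Rightarrow> (nat \<Rightarrow> nat) \<Rightarrow> nat \<Rightarrow> nat" where
  "out_bit E f k d c i = (\<Sum>j<k. \<Sum>l<d. c (j * d + l) * tbit E f (i * j + l)) mod 2"

text \<open>Register 41 holds the current power of x; if its top coefficient and the seed bit are
  both 1, \<open>1 - r 61\<close> flips the accumulated parity.\<close>

definition bit_body :: loop where
  "bit_body = Get 64 62 ;; Plus 42 41 41 ;; Minus 43 34 42 ;;
     Cond 43 (Set 45 0) (Cond 64 (Minus 61 10 61) (Set 45 0)) ;; mul_x 41 34 35 ;; Plus 62 62 10"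

text \<open>Multiplies register 63 by x^i. The index \<open>i\<close> in register 60 changes during
  the program and so cannot be a loop bound; the loop runs \<open>n\<close> times and idles after
  \<open>i\<close> rounds.\<close>

definition shift_body :: loop where
  "shift_body = Minus 66 60 65 ;; Cond 66 (mul_x 63 34 35) (Set 45 0) ;; Plus 65 65 10"

definition term_body :: loop where
  "term_body = Set 41 0 ;; Plus 41 41 63 ;; Rep 52 4 bit_body ;; Set 65 0 ;; Rep 52 0 shift_body"

definition output_body :: loop where
  "output_body = Set 61 0 ;; Set 62 0 ;; Plus 62 62 12 ;; Set 63 1 ;; Rep 51 1 term_body ;; Put 60 61 ;; Plus 60 60 10"

definition output_prog :: loop where
  "output_prog = Set 60 0 ;; Rep 50 0 output_body"

lemma writes_bit_body [simp]: "writes bit_body = {41, 42, 43, 45, 61, 62, 64}"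
  by (auto simp: bit_body_def)

lemma writes_shift_body [simp]: "writes shift_body = {42, 43, 45, 63, 65, 66}"
  by (auto simp: shift_body_def)

lemma writes_term_body [simp]: "writes term_body = {2, 41, 42, 43, 45, 52, 61, 62, 63, 64, 65, 66}"
  by (auto simp: term_body_def)

lemma writes_output_body [simp]: "writes output_body = {2, 41, 42, 43, 45, 51, 52, 60, 61, 62, 63, 64, 65, 66}"
  by (auto simp: output_body_def)

definition output_ready :: "nat \<Rightarrow> nat \<Rightarrow> nat \<Rightarrow> nat \<Rightarrow> nat \<Rightarrow> (nat \<Rightarrow> nat) \<Rightarrow> (nat \<Rightarrow> nat) \<Rightarrow> bool" where
  "output_ready Z W e E f r m \<longleftrightarrow> E = 2 ^ e \<and> 0 < e \<and> E \<le> f \<and> f < 2 * E \<and> 2 * E \<le> W \<and>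
     r 34 = E \<and> r 35 = Z + f * W \<and> r 10 = 1 \<and> xor_table Z W m"

lemma output_ready_cong:
  "output_ready Z W e E f r m \<Longrightarrow> r' 34 = r 34 \<Longrightarrow> r' 35 = r 35 \<Longrightarrow> r' 10 = r 10 \<Longrightarrow> output_ready Z W e E f r' m"
  by (simp add: output_ready_def)

lemma output_ready_mul_x:
  assumes "output_ready Z W e E f r m" "a \<notin> {42, 43}" "r a = (tstep E f ^^ t) 1"
  shows "\<exists>v v'. sem (mul_x a 34 35) (r, m) = (r(42 := v, 43 := v', a := (tstep E f ^^ Suc t) 1), m)"
proof -
  have E: "E = 2 ^ e" "0 < e" "E \<le> f" "f < 2 * E" "2 * E \<le> W" "r 34 = E" "r 35 = Z + f * W" "xor_table Z W m"
    using assms(1) by (auto simp: output_ready_def)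
  have "1 < E" using one_less_power[of "2::nat" e] E(1,2) by simp
  then have "(tstep E f ^^ t) 1 < E" using tstep_funpow_less[OF E(1,3,4)] by blast
  then have "2 * r a < W" "f < W" using E assms(3) by linarith+
  then show ?thesis using sem_mul_x[of a 34 35 Z W m r f] E assms(2,3) by auto
qed

lemma sem_bit_loop:
  assumes R: "output_ready Z W e E f r m"
    and r: "r 41 = (tstep E f ^^ t) 1" "r 62 = B + p" "r 61 = A mod 2"
    and c: "\<And>l. l < r 4 \<Longrightarrow> m (B + p + l) = c (p + l)" "\<And>q. c q < 2"
  obtains r' where "sem (Rep 52 4 bit_body) (r, m) = (r', m)"
    "r' 61 = (A + (\<Sum>l<r 4. c (p + l) * tbit E f (t + l))) mod 2" "r' 62 = B + p + r 4"
    "\<And>a. a \<notin> {2, 41, 42, 43, 45, 52, 61, 62, 64} \<Longrightarrow> r' a = r a"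
proof -
  let ?Inv = "\<lambda>i r' m'. m' = m \<and> r' 41 = (tstep E f ^^ (t + i)) 1 \<and> r' 62 = B + p + i \<and>
    r' 61 = (A + (\<Sum>l<i. c (p + l) * tbit E f (t + l))) mod 2"
  obtain r1 m1 where 1: "sem (Rep 52 4 bit_body) (r, m) = (r1, m1)" "?Inv (r 4) r1 m1"
    "\<And>a. a \<notin> insert 52 (insert 2 (writes bit_body)) \<Longrightarrow> r1 a = r a"
  proof (rule sem_Rep_obtain[where Inv = ?Inv and c = 52 and b = 4 and r = r and m = m and P = bit_body])
    show "?Inv 0 (r(52 := r 4)) m" by (simp add: r)
  next
    fix i r' m'
    assume *: "i < r 4" "?Inv i r' m'" "\<And>a. a \<notin> insert 52 (insert 2 (writes bit_body)) \<Longrightarrow> r' a = r a"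
    have k: "r' 34 = E" "r' 10 = 1" using R by (simp_all add: *(3) output_ready_def)
    let ?A = "A + (\<Sum>l<i. c (p + l) * tbit E f (t + l))"
    let ?c = "c (p + i)"
    define acc where "acc = (?A + ?c * tbit E f (t + i)) mod 2"
    have ci: "m (B + p + i) = ?c" "?c = 0 \<or> ?c = 1" using c(1)[OF *(1)] c(2)[of "p + i"] by auto
    have flip: "(?A + 1) mod 2 = 1 - ?A mod 2" by presburger
    define q where "q = r'(64 := ?c, 42 := r' 41 + r' 41, 43 := E - (r' 41 + r' 41), 45 := if E \<le> 2 * r' 41 \<and> ?c \<noteq> 0 then r' 45 else 0, 61 := acc)"
    have accI: "acc = (if E \<le> 2 * r' 41 \<and> ?c \<noteq> 0 then 1 - r' 61 else r' 61)"
      using *(2) ci(2) flip by (auto simp: acc_def tbit_def)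
    have s: "sem (Get 64 62 ;; Plus 42 41 41 ;; Minus 43 34 42 ;; Cond 43 (Set 45 0) (Cond 64 (Minus 61 10 61) (Set 45 0)) ;; Q) (r', m) = sem Q (q, m)" for Q
      using *(2) k ci(1) by (auto simp: q_def accI mult_2 fun_upd_twist intro!: arg_cong[where f = "sem Q"])
    have "output_ready Z W e E f q m" using R by (rule output_ready_cong) (simp_all add: q_def *(3))
    moreover have "q 41 = (tstep E f ^^ (t + i)) 1" using *(2) by (simp add: q_def)
    ultimately obtain v v' where mx: "sem (mul_x 41 34 35) (q, m) = (q(42 := v, 43 := v', 41 := (tstep E f ^^ Suc (t + i)) 1), m)"
      using output_ready_mul_x[of Z W e E f q m 41 "t + i"] by auto
    have q: "q 62 = B + p + i" "q 10 = 1" "q 61 = acc" using *(2) k by (simp_all add: q_def)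
    have "sem bit_body (r', m) = (q(42 := v, 43 := v', 41 := (tstep E f ^^ Suc (t + i)) 1, 62 := B + p + Suc i), m)"
      unfolding bit_body_def s by (simp add: mx q)
    then show "\<exists>r'' m''. sem bit_body (r', m') = (r'', m'') \<and> ?Inv (Suc i) (r''(2 := 1, 52 := r'' 52 - 1)) m''"
      using *(2) q(3) by (simp add: acc_def add.assoc)
  qed blast
  have "sem (Rep 52 4 bit_body) (r, m) = (r1, m)" using 1 by simp
  moreover have "r1 a = r a" if "a \<notin> {2, 41, 42, 43, 45, 52, 61, 62, 64}" for a using that by (simp add: 1(3))
  ultimately show ?thesis using that 1(2) by blast
qed

lemma sem_shift_loop:
  assumes R: "output_ready Z W e E f r m"
    and r: "r 63 = (tstep E f ^^ t) 1" "r 65 = 0" "r 60 < r 0"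
  obtains r' where "sem (Rep 52 0 shift_body) (r, m) = (r', m)"
    "r' 63 = (tstep E f ^^ (t + r 60)) 1"
    "\<And>a. a \<notin> {2, 42, 43, 45, 52, 63, 65, 66} \<Longrightarrow> r' a = r a"
proof -
  let ?Inv = "\<lambda>i r' m'. m' = m \<and> r' 65 = i \<and> r' 63 = (tstep E f ^^ (t + min i (r 60))) 1"
  obtain r1 m1 where 1: "sem (Rep 52 0 shift_body) (r, m) = (r1, m1)" "?Inv (r 0) r1 m1"
    "\<And>a. a \<notin> insert 52 (insert 2 (writes shift_body)) \<Longrightarrow> r1 a = r a"
  proof (rule sem_Rep_obtain[where Inv = ?Inv and c = 52 and b = 0 and r = r and m = m and P = shift_body])
    show "?Inv 0 (r(52 := r 0)) m" by (simp add: r)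
  next
    fix i r' m'
    assume *: "i < r 0" "?Inv i r' m'" "\<And>a. a \<notin> insert 52 (insert 2 (writes shift_body)) \<Longrightarrow> r' a = r a"
    have k: "r' 60 = r 60" "r' 10 = 1" using R by (simp_all add: *(3) output_ready_def)
    show "\<exists>r'' m''. sem shift_body (r', m') = (r'', m'') \<and> ?Inv (Suc i) (r''(2 := 1, 52 := r'' 52 - 1)) m''"
    proof (cases "i < r 60")
      case True
      define q where "q = r'(66 := r 60 - i)"
      have "output_ready Z W e E f q m" using R by (rule output_ready_cong) (simp_all add: q_def *(3))
      moreover have "q 63 = (tstep E f ^^ (t + i)) 1" using *(2) True by (simp add: q_def min_def)
      ultimately obtain v v' where mx: "sem (mul_x 63 34 35) (q, m) = (q(42 := v, 43 := v', 63 := (tstep E f ^^ Suc (t + i)) 1), m)"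
        using output_ready_mul_x[of Z W e E f q m 63 "t + i"] by auto
      have "sem shift_body (r', m) = sem (Plus 65 65 10) (sem (mul_x 63 34 35) (q, m))"
        using *(2) k True by (simp add: shift_body_def q_def mx[unfolded q_def])
      moreover have "q 65 = i" "q 10 = 1" using *(2) k by (simp_all add: q_def)
      ultimately show ?thesis using *(2) True by (simp add: mx min_def)
    next
      case False
      then show ?thesis using *(2) k by (simp add: shift_body_def min_def)
    qed
  qed blast
  have "sem (Rep 52 0 shift_body) (r, m) = (r1, m)" using 1 by simp
  moreover have "r1 a = r a" if "a \<notin> {2, 42, 43, 45, 52, 63, 65, 66}" for a using that by (simp add: 1(3))
  ultimately show ?thesis using that 1(2) r(3) by (auto simp: min_def)
qed

lemma sem_term_loop:
  assumes R: "output_ready Z W e E f r m"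
    and r: "r 63 = 1" "r 62 = B" "r 61 = 0" "r 60 < r 0"
    and c: "\<And>q. q < r 1 * r 4 \<Longrightarrow> m (B + q) = c q" "\<And>q. c q < 2"
  obtains r' where "sem (Rep 51 1 term_body) (r, m) = (r', m)"
    "r' 61 = out_bit E f (r 1) (r 4) c (r 60)"
    "\<And>a. a \<notin> {2, 41, 42, 43, 45, 51, 52, 61, 62, 63, 64, 65, 66} \<Longrightarrow> r' a = r a"
proof -
  define d where "d = r 4"
  let ?Inv = "\<lambda>j r' m'. m' = m \<and> r' 63 = (tstep E f ^^ (r 60 * j)) 1 \<and> r' 62 = B + j * d \<and> r' 61 = out_bit E f j d c (r 60)"
  obtain r1 m1 where 1: "sem (Rep 51 1 term_body) (r, m) = (r1, m1)" "?Inv (r 1) r1 m1"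
    "\<And>a. a \<notin> insert 51 (insert 2 (writes term_body)) \<Longrightarrow> r1 a = r a"
  proof (rule sem_Rep_obtain[where Inv = ?Inv and c = 51 and b = 1 and r = r and m = m and P = term_body])
    show "?Inv 0 (r(51 := r 1)) m" by (simp add: r out_bit_def)
  next
    fix j r' m'
    assume *: "j < r 1" "?Inv j r' m'" "\<And>a. a \<notin> insert 51 (insert 2 (writes term_body)) \<Longrightarrow> r' a = r a"
    define q where "q = r'(41 := (tstep E f ^^ (r 60 * j)) 1)"
    have q4: "q 4 = d" "q 60 = r 60" "q 0 = r 0" by (simp_all add: q_def *(3) d_def)
    have cc: "m (B + j * d + l) = c (j * d + l)" if "l < q 4" for l
    proof -
      have "j * d + l < Suc j * d" using that q4 by simp
      also have "\<dots> \<le> r 1 * d" using *(1) by (intro mult_right_mono) auto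
      finally show ?thesis using c(1)[of "j * d + l"] by (simp add: d_def add.assoc)
    qed
    have Rq: "output_ready Z W e E f q m" using R by (rule output_ready_cong) (simp_all add: q_def *(3))
    obtain r2 where 2: "sem (Rep 52 4 bit_body) (q, m) = (r2, m)"
      "r2 61 = ((\<Sum>j<j. \<Sum>l<d. c (j * d + l) * tbit E f (r 60 * j + l)) + (\<Sum>l<q 4. c (j * d + l) * tbit E f (r 60 * j + l))) mod 2"
      "r2 62 = B + j * d + q 4"
      "\<And>a. a \<notin> {2, 41, 42, 43, 45, 52, 61, 62, 64} \<Longrightarrow> r2 a = q a"
    proof (rule sem_bit_loop[OF Rq, of "r 60 * j" B "j * d" "\<Sum>j<j. \<Sum>l<d. c (j * d + l) * tbit E f (r 60 * j + l)" c])
      show "q 61 = (\<Sum>j<j. \<Sum>l<d. c (j * d + l) * tbit E f (r 60 * j + l)) mod 2"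
        using *(2) by (simp add: q_def out_bit_def)
    qed (use *(2) cc c(2) in \<open>auto simp: q_def\<close>)
    define q' where "q' = r2(65 := 0)"
    have Rq': "output_ready Z W e E f q' m" using Rq by (rule output_ready_cong) (simp_all add: q'_def 2(4))
    obtain r3 where 3: "sem (Rep 52 0 shift_body) (q', m) = (r3, m)"
      "r3 63 = (tstep E f ^^ (r 60 * j + q' 60)) 1"
      "\<And>a. a \<notin> {2, 42, 43, 45, 52, 63, 65, 66} \<Longrightarrow> r3 a = q' a"
      by (rule sem_shift_loop[OF Rq', of "r 60 * j"]) (use *(2) r q4 in \<open>auto simp: q'_def 2(4) q_def\<close>)
    have "sem term_body (r', m) = (r3, m)"
      using *(2) 2(1) 3(1) by (simp add: term_body_def q_def q'_def)
    moreover have "r3 62 = B + Suc j * d" "r3 61 = out_bit E f (Suc j) d c (r 60)" "q' 60 = r 60"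
      using 2 q4 by (simp_all add: 3(3) q'_def out_bit_def)
    ultimately show "\<exists>r'' m''. sem term_body (r', m') = (r'', m'') \<and> ?Inv (Suc j) (r''(2 := 1, 51 := r'' 51 - 1)) m''"
      using *(2) 3(2) by (simp add: add.commute)
  qed blast
  have "sem (Rep 51 1 term_body) (r, m) = (r1, m)" using 1(1,2) by simp
  moreover have "r1 a = r a" if "a \<notin> {2, 41, 42, 43, 45, 51, 52, 61, 62, 63, 64, 65, 66}" for a using that by (simp add: 1(3))
  ultimately show ?thesis using that 1(2) unfolding d_def by blast
qed

lemma sem_output_prog:
  assumes R: "output_ready Z W e E f r m" and XB: "r 0 \<le> Z" "r 0 \<le> r 12"
    and c: "\<And>q. q < r 1 * r 4 \<Longrightarrow> m (r 12 + q) = c q" "\<And>q. c q < 2"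
  obtains r' m' where "sem output_prog (r, m) = (r', m')" "\<And>i. i < r 0 \<Longrightarrow> m' i = out_bit E f (r 1) (r 4) c i"
    "\<And>a. a \<notin> {2, 41, 42, 43, 45, 50, 51, 52, 60, 61, 62, 63, 64, 65, 66} \<Longrightarrow> r' a = r a"
proof -
  define r0 where "r0 = r(60 := 0)"
  let ?Inv = "\<lambda>i r' m'. r' 60 = i \<and> (\<forall>q<i. m' q = out_bit E f (r 1) (r 4) c q) \<and> (\<forall>q\<ge>r 0. m' q = m q)"
  obtain r1 m1 where 1: "sem (Rep 50 0 output_body) (r0, m) = (r1, m1)" "?Inv (r0 0) r1 m1"
    "\<And>a. a \<notin> insert 50 (insert 2 (writes output_body)) \<Longrightarrow> r1 a = r0 a"
  proof (rule sem_Rep_obtain[where Inv = ?Inv and c = 50 and b = 0 and r = r0 and m = m and P = output_body])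
    show "?Inv 0 (r0(50 := r0 0)) m" by (simp add: r0_def)
  next
    fix i r' m'
    assume *: "i < r0 0" "?Inv i r' m'" "\<And>a. a \<notin> insert 50 (insert 2 (writes output_body)) \<Longrightarrow> r' a = r0 a"
    have ir: "i < r 0" using *(1) by (simp add: r0_def)
    have k: "r' 0 = r 0" "r' 1 = r 1" "r' 4 = r 4" "r' 12 = r 12" "r' 10 = r 10" by (simp_all add: *(3) r0_def)
    define q where "q = r'(61 := 0, 62 := r 12, 63 := 1)"
    have k1: "q 0 = r 0" "q (Suc 0) = r 1" "q 4 = r 4" "q 10 = 1" "q 60 = i"
      using *(2) k R by (simp_all add: q_def output_ready_def)
    \<comment> \<open>Output is written to cells below \<open>n\<close> only, and both the table and
      the copy of the seed lie above.\<close>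
    have "xor_table Z W m'"
      using R *(2) XB by (auto simp: output_ready_def xor_table_def trans_le_add1)
    then have Rq: "output_ready Z W e E f q m'" using R by (simp add: output_ready_def q_def *(3) r0_def)
    obtain r2 where 2: "sem (Rep 51 1 term_body) (q, m') = (r2, m')"
      "r2 61 = out_bit E f (q 1) (q 4) c (q 60)"
      "\<And>a. a \<notin> {2, 41, 42, 43, 45, 51, 52, 61, 62, 63, 64, 65, 66} \<Longrightarrow> r2 a = q a"
    proof (rule sem_term_loop[OF Rq, of "r 12" c])
      fix p assume "p < q 1 * q 4"
      then show "m' (r 12 + p) = c p" using *(2) XB c(1)[of p] k1 by (simp add: trans_le_add1)
    qed (use ir k1 c(2) in \<open>auto simp: q_def\<close>)
    have "sem output_body (r', m') = sem (Put 60 61 ;; Plus 60 60 10) (r2, m')"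
      using *(2) k 2(1) by (simp add: output_body_def q_def)
    moreover have "r2 60 = i" "r2 10 = 1" using k1 by (simp_all add: 2(3))
    ultimately show "\<exists>r'' m''. sem output_body (r', m') = (r'', m'') \<and> ?Inv (Suc i) (r''(2 := 1, 50 := r'' 50 - 1)) m''"
      using *(2) 2(2) k1 ir by (auto simp: less_Suc_eq)
  qed blast
  have "sem output_prog (r, m) = (r1, m1)" using 1(1) by (simp add: output_prog_def r0_def)
  moreover have "m1 i = out_bit E f (r 1) (r 4) c i" if "i < r 0" for i using that 1(2) by (simp add: r0_def)
  moreover have "r1 a = r a" if "a \<notin> {2, 41, 42, 43, 45, 50, 51, 52, 60, 61, 62, 63, 64, 65, 66}" for a
    using that by (simp add: 1(3) r0_def)
  ultimately show ?thesis using that by blast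
qed

section \<open>Elements of large order in fields of characteristic two\<close>

lemma char2_double: "x + x = (0 :: bit alg_closure)"
proof -
  have "(2 :: bit alg_closure) = to_ac 2" by (simp only: to_ac_numeral)
  also have "\<dots> = 0" by simp
  finally have "(1 + 1 :: bit alg_closure) = 0" by simp
  then have "x * (1 + 1) = 0" by simp
  then show ?thesis by (simp only: distrib_left mult_1_right)
qed

text \<open>Squaring is additive because the mixed term occurs twice; iterate.\<close>

lemma frobenius_add: "(x + y :: bit alg_closure) ^ 2 ^ d = x ^ 2 ^ d + y ^ 2 ^ d"
proof (induction d)
  case (Suc d)
  have sq: "(a + b) ^ 2 = a ^ 2 + b ^ 2" for a b :: "bit alg_closure"
    using char2_double[of "a * b"] by (simp add: power2_eq_square algebra_simps)
  have "(x + y) ^ 2 ^ Suc d = ((x + y) ^ 2 ^ d) ^ 2" by (simp add: mult.commute flip: power_mult)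
  also have "\<dots> = (x ^ 2 ^ d) ^ 2 + (y ^ 2 ^ d) ^ 2" by (simp only: Suc sq)
  also have "\<dots> = x ^ 2 ^ Suc d + y ^ 2 ^ Suc d" by (simp add: mult.commute flip: power_mult)
  finally show ?case .
qed simp

text \<open>This is GF(2^d) inside the algebraic closure: the roots of X^(2^d) - X, which splits
  there and has no multiple roots because its derivative is -1.\<close>

lemma card_frobenius_fixed:
  assumes "d > 0"
  shows "finite {z :: bit alg_closure. z ^ 2 ^ d = z}" "card {z :: bit alg_closure. z ^ 2 ^ d = z} = 2 ^ d"
proof -
  define p :: "bit alg_closure poly" where "p = Polynomial.monom 1 (2 ^ d) - Polynomial.monom 1 1"
  have "(2::nat) ^ 1 \<le> 2 ^ d" using assms by (intro power_increasing) auto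
  then have big: "(1::nat) < 2 ^ d" by simp
  then have cf: "poly.coeff p (2 ^ d) = 1" by (simp add: p_def)
  then have p0: "p \<noteq> 0" by auto
  have "Polynomial.degree p \<le> 2 ^ d" using big unfolding p_def
    by (intro degree_diff_le) (auto simp: degree_monom_eq)
  moreover have "2 ^ d \<le> Polynomial.degree p" using cf by (intro le_degree) simp
  ultimately have deg: "Polynomial.degree p = 2 ^ d" by simp
  have roots: "poly p z = 0 \<longleftrightarrow> z ^ 2 ^ d = z" for z by (simp add: p_def poly_monom)
  have two: "(of_nat (2 ^ d) :: bit alg_closure) = 0"
    using assms char2_double[of 1] by (cases d) auto
  have pd: "poly (pderiv p) z = - 1" for z
    using two by (simp add: p_def pderiv_diff pderiv_monom poly_monom)
  have simple: "Polynomial.order z p \<le> 1" for z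
  proof (rule ccontr)
    assume "\<not> ?thesis"
    then have "[:- z, 1:] ^ 2 dvd p" by (simp only: order_divides) simp
    then obtain q where "p = [:- z, 1:] ^ 2 * q" by (elim dvdE)
    then have "p = [:- z, 1:] * ([:- z, 1:] * q)" by (simp only: power2_eq_square mult.assoc)
    then have "poly (pderiv p) z = 0" by (simp only: pderiv_mult poly_add poly_mult) simp
    then show False using pd by simp
  qed
  obtain A where A: "size A = Polynomial.degree p" "p = Polynomial.smult (Polynomial.lead_coeff p) (\<Prod>x\<in>#A. [:-x, 1:])"
    using alg_closed_imp_factorization[OF p0] by blast
  have "proots p = proots (\<Prod>x\<in>#A. [:-x, 1:])"
    by (subst A(2), rule proots_smult) (use p0 in auto)
  also have "\<dots> = A"
  proof -
    have nz: "(\<Prod>x\<in>#B. [:-x, 1:]) \<noteq> 0" for B :: "bit alg_closure multiset"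
      by (auto simp: prod_mset_zero_iff)
    show ?thesis
    proof (induction A)
      case (add x B)
      have "proots (\<Prod>x\<in>#add_mset x B. [:-x, 1:]) = proots [:-x, 1:] + proots (\<Prod>x\<in>#B. [:-x, 1:])"
        unfolding image_mset_add_mset prod_mset.add_mset by (rule proots_mult) (use nz in auto)
      then show ?case using add by simp
    qed simp
  qed
  finally have sz: "size (proots p) = 2 ^ d" using A(1) deg by simp
  have "count (proots p) z = 1" if "z \<in># proots p" for z
    using that p0 simple[of z] by (simp add: order_root)
  then have "size (proots p) = card (set_mset (proots p))"
    by (simp add: size_multiset_overloaded_eq)
  then have "card {z. poly p z = 0} = 2 ^ d" using sz p0 by simp
  then show "card {z :: bit alg_closure. z ^ 2 ^ d = z} = 2 ^ d" by (simp add: roots)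
  show "finite {z :: bit alg_closure. z ^ 2 ^ d = z}" using poly_roots_finite[OF p0] by (simp add: roots)
qed

text \<open>Counting: at most \<open>r\<close> elements satisfy \<open>z ^ r = 1\<close>, so those
  of order below \<open>n\<close>, together with 0, number at most \<open>1 + (n - 1) * n\<close>,
  too few to exhaust the \<open>2 ^ d\<close> elements.\<close>

lemma exists_large_order:
  assumes "n * n < 2 ^ d" "d > 0"
  shows "\<exists>\<alpha> :: bit alg_closure. \<alpha> ^ 2 ^ d = \<alpha> \<and> \<alpha> \<noteq> 0 \<and> (\<forall>r. 0 < r \<and> r < n \<longrightarrow> \<alpha> ^ r \<noteq> 1)"
proof (rule ccontr)
  assume no: "\<not> ?thesis"
  let ?R = "\<lambda>r. {z :: bit alg_closure. z ^ r = 1}"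
  have R: "finite (?R r)" "card (?R r) \<le> r" if "0 < r" for r
  proof -
    let ?p = "Polynomial.monom 1 r - 1 :: bit alg_closure poly"
    have "poly.coeff ?p r = 1" using that by (simp add: coeff_1)
    then have p0: "?p \<noteq> 0" by (metis coeff_0 zero_neq_one)
    have e: "?R r = {z. poly ?p z = 0}" by (simp add: poly_monom)
    show "finite (?R r)" unfolding e by (rule poly_roots_finite[OF p0])
    have "Polynomial.degree ?p \<le> r" by (intro degree_diff_le) (auto simp: degree_monom_le)
    then show "card (?R r) \<le> r" unfolding e using card_poly_roots_bound[OF p0] by linarith
  qed
  have "{z :: bit alg_closure. z ^ 2 ^ d = z} \<subseteq> insert 0 (\<Union>r\<in>{1..<n}. ?R r)" using no by auto
  then have "2 ^ d \<le> card (insert 0 (\<Union>r\<in>{1..<n}. ?R r))"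
    using card_frobenius_fixed[OF assms(2)] R by (metis (no_types, lifting) card_mono finite_UN finite_atLeastLessThan finite_insert atLeastLessThan_iff less_eq_Suc_le One_nat_def)
  also have "\<dots> \<le> 1 + card (\<Union>r\<in>{1..<n}. ?R r)" by (simp add: card_insert_le_m1 R card_insert_if)
  also have "card (\<Union>r\<in>{1..<n}. ?R r) \<le> (\<Sum>r\<in>{1..<n}. card (?R r))" by (rule card_UN_le) simp
  also have "\<dots> \<le> (\<Sum>r\<in>{1..<n}. n)"
  proof (rule sum_mono)
    fix r assume "r \<in> {1..<n}"
    then show "card (?R r) \<le> n" using R(2)[of r] by simp
  qed
  also have "\<dots> = (n - 1) * n" by simp
  finally have "2 ^ d \<le> 1 + (n - 1) * n" by simp
  moreover have "1 + (n - 1) * n \<le> n * n \<or> n = 0" by (cases n) auto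
  moreover have "(2::nat) ^ 1 \<le> 2 ^ d" using assms by (intro power_increasing) auto
  ultimately show False using assms(1) by auto
qed

text \<open>The value at \<open>\<alpha>\<close> of the polynomial encoded by \<open>a\<close>, provided that \<open>a < 2 ^ N\<close>.\<close>

definition evn :: "bit alg_closure \<Rightarrow> nat \<Rightarrow> nat \<Rightarrow> bit alg_closure" where
  "evn \<alpha> N a = (\<Sum>i<N. of_bool (Bit_Operations.bit a i) * \<alpha> ^ i)"

lemma evn_xor: "evn \<alpha> N (xor a b) = evn \<alpha> N a + evn \<alpha> N b"
proof -
  have "of_bool (Bit_Operations.bit (xor a b) i) * \<alpha> ^ i =
      of_bool (Bit_Operations.bit a i) * \<alpha> ^ i + of_bool (Bit_Operations.bit b i) * \<alpha> ^ i" for i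
    using char2_double[of "\<alpha> ^ i"] by (auto simp: bit_xor_iff)
  then show ?thesis by (simp only: evn_def sum.distrib)
qed

lemma not_bit_ge: "a < 2 ^ N \<Longrightarrow> N \<le> i \<Longrightarrow> \<not> Bit_Operations.bit (a::nat) i"
proof -
  assume "a < 2 ^ N" "N \<le> i"
  then have "a < 2 ^ i" using power_increasing[of N i "2::nat"] by linarith
  then show ?thesis by (simp add: bit_iff_odd)
qed

lemma evn_double:
  assumes "2 * a < 2 ^ N"
  shows "evn \<alpha> N (2 * a) = \<alpha> * evn \<alpha> N a"
proof (cases N)
  case 0
  then show ?thesis by (simp add: evn_def)
next
  case (Suc M)
  have nb: "\<not> Bit_Operations.bit a M" using assms Suc by (intro not_bit_ge[of a M]) auto
  have "evn \<alpha> N (2 * a) = (\<Sum>i<M. of_bool (Bit_Operations.bit a i) * \<alpha> ^ Suc i)"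
    unfolding evn_def Suc by (subst sum.lessThan_Suc_shift) (simp add: bit_double_iff)
  also have "\<dots> = \<alpha> * (\<Sum>i<M. of_bool (Bit_Operations.bit a i) * \<alpha> ^ i)"
    unfolding sum_distrib_left by (intro sum.cong refl) (simp add: mult_ac)
  also have "(\<Sum>i<M. of_bool (Bit_Operations.bit a i) * \<alpha> ^ i) = evn \<alpha> N a"
    unfolding evn_def Suc using nb by simp
  finally show ?thesis .
qed

text \<open>Values of polynomials over GF(2) at an element of GF(2^d) stay in that field, since the
  Frobenius map is additive and fixes \<open>\<alpha>\<close>.\<close>

lemma evn_frobenius: "\<alpha> ^ 2 ^ d = \<alpha> \<Longrightarrow> evn \<alpha> N a ^ 2 ^ d = evn \<alpha> N a"
proof -
  assume a: "\<alpha> ^ 2 ^ d = \<alpha>"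
  have "(\<Sum>i<N. of_bool (Bit_Operations.bit a i) * \<alpha> ^ i) ^ 2 ^ d = (\<Sum>i<N. of_bool (Bit_Operations.bit a i) * \<alpha> ^ i)"
  proof (induction N)
    case (Suc N)
    have "(\<alpha> ^ N) ^ 2 ^ d = \<alpha> ^ N" using a by (metis power_commutes power_mult mult.commute)
    then have "(of_bool (Bit_Operations.bit a N) * \<alpha> ^ N) ^ 2 ^ d = of_bool (Bit_Operations.bit a N) * \<alpha> ^ N"
      by auto
    then show ?case using Suc by (simp add: frobenius_add)
  qed simp
  then show ?thesis by (simp add: evn_def)
qed

text \<open>\<open>f\<close> is the least positive code of a polynomial vanishing at
  \<open>\<alpha>\<close>; as the order of codes refines the order of degrees, it is the minimal
  polynomial. Its degree is at most \<open>d\<close> by the pigeonhole principle: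
  \<open>2 ^ Suc d\<close> codes have only \<open>2 ^ d\<close> values. At \<open>\<alpha>\<close>,
  \<open>tstep\<close> acts as multiplication by \<open>\<alpha>\<close>, so a short orbit would
  give \<open>\<alpha>\<close> a small order.\<close>

theorem valid_modulus_exists:
  assumes "n * n < 2 ^ d" "d > 0"
  shows "\<exists>f E. valid_modulus n d f E"
proof -
  obtain \<alpha> :: "bit alg_closure" where \<alpha>: "\<alpha> ^ 2 ^ d = \<alpha>" "\<alpha> \<noteq> 0" "\<And>r. 0 < r \<Longrightarrow> r < n \<Longrightarrow> \<alpha> ^ r \<noteq> 1"
    using exists_large_order[OF assms] by blast
  \<comment> \<open>Leaves room for doubling a code below \<open>2 ^ Suc d\<close>.\<close>
  define N where "N = d + 2"
  have Nd: "2 ^ N = 4 * (2::nat) ^ d" by (simp add: N_def)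
  let ?ev = "evn \<alpha> N"
  have "\<not> inj_on ?ev {..<2 ^ Suc d}"
  proof
    assume "inj_on ?ev {..<2 ^ Suc d}"
    moreover have "?ev ` {..<2 ^ Suc d} \<subseteq> {z. z ^ 2 ^ d = z}" using evn_frobenius[OF \<alpha>(1)] by blast
    ultimately have "card {..<2 ^ Suc d :: nat} \<le> card {z :: bit alg_closure. z ^ 2 ^ d = z}"
      using card_frobenius_fixed[OF assms(2)] by (intro card_inj_on_le) auto
    then show False using card_frobenius_fixed[OF assms(2)] by simp
  qed
  then obtain a b :: nat where ab: "a < 2 ^ Suc d" "b < 2 ^ Suc d" "a \<noteq> b" "?ev a = ?ev b"
    by (auto simp: inj_on_def)
  define x where "x = xor a b"
  have x0: "x > 0"
  proof (rule ccontr)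
    assume "\<not> 0 < x"
    then have "xor a b = 0" by (simp add: x_def)
    then have "xor (xor a b) b = b" by simp
    then show False using ab(3) by (simp add: xor.assoc)
  qed
  have xl: "x < 2 ^ Suc d"
  proof -
    have "take_bit (Suc d) x = x" using ab(1,2) unfolding x_def
      by (simp only: take_bit_xor take_bit_nat_eq_self)
    then show ?thesis by (simp only: take_bit_nat_eq_self_iff)
  qed
  have xe: "?ev x = 0" using ab(4) char2_double by (simp add: x_def evn_xor)
  define f where "f = (LEAST y. 0 < y \<and> ?ev y = 0)"
  have f: "0 < f" "?ev f = 0" using LeastI[of "\<lambda>y. 0 < y \<and> ?ev y = 0" x] x0 xe by (auto simp: f_def)
  have fmin: "?ev y \<noteq> 0" if "0 < y" "y < f" for y using not_less_Least[of y "\<lambda>y. 0 < y \<and> ?ev y = 0"] that by (auto simp: f_def)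
  have "f \<le> x" unfolding f_def using x0 xe by (intro Least_le) auto
  then have fl: "f < 2 ^ Suc d" using xl by simp
  \<comment> \<open>Half of an even code is the quotient by x; it would vanish at the nonzero
    \<open>\<alpha>\<close> too and contradict minimality.\<close>
  have odd: "odd f"
  proof
    assume "even f"
    then obtain g where g: "f = 2 * g" by blast
    have "2 * g < 2 ^ N" using fl g Nd by simp
    then have "\<alpha> * ?ev g = 0" using f(2) g evn_double[of g N \<alpha>] by simp
    then have "?ev g = 0" using \<alpha>(2) by simp
    then show False using fmin[of g] g f(1) by simp
  qed
  have "?ev 1 = 1"
  proof -
    have "?ev 1 = (\<Sum>i<Suc (Suc d). of_bool (i = 0) * \<alpha> ^ i)" unfolding evn_def N_def
      by (intro sum.cong) (auto simp: bit_Suc_0_iff)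
    also have "\<dots> = 1" by (subst sum.lessThan_Suc_shift) simp
    finally show ?thesis .
  qed
  then have f1: "f \<noteq> 1" using f(2) by auto
  then have f3: "2 < f" using odd f(1) by (cases "f = 2") auto
  obtain e where e: "2 ^ e \<le> f" "f < 2 ^ Suc e" using ex_power_ivl1[of 2 f] f(1) by auto
  have "e \<noteq> 0" using e f3 by (intro notI) simp
  have "2 ^ e < (2::nat) ^ Suc d" using e fl by linarith
  then have "e < Suc d" using power_less_imp_less_exp[of "2::nat" e "Suc d"] by simp
  then have ed: "e \<le> d" by simp
  have ts: "?ev (tstep (2 ^ e) f q) = \<alpha> * ?ev q" if "q < 2 ^ e" for q
  proof -
    have "2 ^ e \<le> (2::nat) ^ d" using ed by (intro power_increasing) auto
    then have "2 * q < 2 ^ N" using that Nd by linarith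
    then show ?thesis using evn_double[of q N \<alpha>] f(2) by (simp add: tstep_def evn_xor)
  qed
  have "orbit_free n (2 ^ e) f h" if h: "0 < h" "h < 2 ^ e" for h
    unfolding orbit_free_def
  proof (intro allI impI notI)
    fix r assume r: "0 < r \<and> r < n" and fp: "(tstep (2 ^ e) f ^^ r) h = h"
    have lt: "(tstep (2 ^ e) f ^^ i) h < 2 ^ e" for i
      using e by (intro tstep_funpow_less[OF refl _ _ h(2)]) auto
    have "?ev ((tstep (2 ^ e) f ^^ i) h) = \<alpha> ^ i * ?ev h" for i
      by (induction i) (auto simp: ts[OF lt] mult_ac)
    from this[of r] have "?ev h = \<alpha> ^ r * ?ev h" using fp by simp
    \<comment> \<open>Since \<open>h < 2 ^ e \<le> f\<close>, by minimality of
      \<open>f\<close>.\<close>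
    moreover have "?ev h \<noteq> 0" using fmin[of h] h e by simp
    ultimately show False using \<alpha>(3) r by simp
  qed
  then show ?thesis using odd e ed \<open>e \<noteq> 0\<close> unfolding valid_modulus_def by auto
qed

section \<open>Independence by interpolation\<close>

text \<open>All digits of \<open>a\<close> are at positions below \<open>a\<close>, because
  \<open>a < 2 ^ a\<close>.\<close>

definition npoly :: "nat \<Rightarrow> bit poly" where
  "npoly a = (\<Sum>i<a. if Bit_Operations.bit a i then Polynomial.monom 1 i else 0)"

lemma coeff_npoly: "poly.coeff (npoly a) i = of_bool (Bit_Operations.bit a i)"
proof -
  have "\<not> Bit_Operations.bit a i" if "a \<le> i"
    using not_bit_ge[of a a i] that less_exp[of a] by simp
  then have "i < a" if "Bit_Operations.bit a i" using that not_le by blast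
  moreover have "poly.coeff (npoly a) i = (\<Sum>j<a. if j = i then of_bool (Bit_Operations.bit a i) else 0)"
    unfolding npoly_def coeff_sum by (intro sum.cong) auto
  ultimately show ?thesis by auto
qed

text \<open>Degree less than \<open>e\<close>, in a form that for \<open>e = 0\<close> describes
  exactly the zero polynomial.\<close>

definition below :: "nat \<Rightarrow> bit poly \<Rightarrow> bool" where
  "below e p \<longleftrightarrow> (\<forall>i\<ge>e. poly.coeff p i = 0)"

lemma below_iff: "0 < e \<Longrightarrow> below e p \<longleftrightarrow> Polynomial.degree p < e"
proof
  assume "0 < e" "below e p"
  then show "Polynomial.degree p < e"
    unfolding below_def by (metis degree_0 leading_coeff_0_iff not_le)
qed (auto simp: below_def intro: coeff_eq_0)

lemma npoly_inj: "npoly a = npoly b \<Longrightarrow> a = b"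
proof (rule bit_eqI)
  fix i assume "npoly a = npoly b"
  then have "poly.coeff (npoly a) i = poly.coeff (npoly b) i" by simp
  then show "Bit_Operations.bit a i = Bit_Operations.bit b i" by (auto simp: coeff_npoly of_bool_def split: if_splits)
qed

lemma npoly_xor: "npoly (xor a b) = npoly a + npoly b"
  by (rule poly_eqI) (auto simp: coeff_npoly bit_xor_iff)

lemma npoly_double: "npoly (2 * a) = Polynomial.monom 1 1 * npoly a"
  by (rule poly_eqI) (auto simp: coeff_npoly coeff_monom_mult bit_double_iff)

lemma below_npoly: "a < 2 ^ e \<Longrightarrow> below e (npoly a)"
  by (auto simp: below_def coeff_npoly not_bit_ge)

lemma below_imp_npoly:
  assumes "below e p"
  shows "\<exists>a<2 ^ e. p = npoly a"
proof -
  let ?a = "horner_sum of_bool 2 (map (\<lambda>i. poly.coeff p i = 1) [0..<e]) :: nat"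
  have "p = npoly ?a"
    using assms by (intro poly_eqI) (auto simp: coeff_npoly bit_horner_sum_bit_iff below_def of_bool_def)
  moreover have "?a < 2 ^ e" using horner_sum_of_bool_2_less[of "map (\<lambda>i. poly.coeff p i = 1) [0..<e]"] by simp
  ultimately show ?thesis by blast
qed

lemma finite_below: "finite {p. below e p}"
proof -
  have "{p. below e p} \<subseteq> npoly ` {..<2 ^ e}" using below_imp_npoly by auto
  then show ?thesis by (rule finite_subset) simp
qed

lemma npoly_0 [simp]: "npoly 0 = 0"
  by (simp add: npoly_def)

lemma npoly_1 [simp]: "npoly 1 = 1"
  by (rule poly_eqI) (auto simp: coeff_npoly bit_Suc_0_iff)

lemma npoly_Suc_0 [simp]: "npoly (Suc 0) = 1"
  using npoly_1 by simp

lemma of_nat_bit_mod_2: "(of_nat (a mod 2) :: bit) = of_nat a"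
  by (cases "even a") (auto elim!: evenE oddE)

context
  fixes n d f E e :: nat
  assumes valid: "valid_modulus n d f E" and Ee: "E = 2 ^ e"
begin

lemma modulus_facts: "odd f" "0 < e" "e \<le> d" "2 ^ e \<le> f" "f < 2 ^ Suc e"
  "\<And>h. 0 < h \<Longrightarrow> h < 2 ^ e \<Longrightarrow> orbit_free n (2 ^ e) f h"
proof -
  obtain e' where e': "0 < e'" "e' \<le> d" "E = 2 ^ e'" using valid by (auto simp: valid_modulus_def)
  then have "e' = e" using Ee by simp
  then show "odd f" "0 < e" "e \<le> d" "2 ^ e \<le> f" "f < 2 ^ Suc e"
    "\<And>h. 0 < h \<Longrightarrow> h < 2 ^ e \<Longrightarrow> orbit_free n (2 ^ e) f h"
    using valid e' Ee by (auto simp: valid_modulus_def)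
qed

abbreviation F :: "bit poly" where "F \<equiv> npoly f"

lemma coeff_F: "poly.coeff F e = 1" "poly.coeff F 0 = 1" "below (Suc e) F"
proof -
  have "f div 2 ^ e = 1" using modulus_facts(4,5) by (intro div_nat_eqI) auto
  then show "poly.coeff F e = 1" by (simp add: coeff_npoly bit_iff_odd)
  show "poly.coeff F 0 = 1" using modulus_facts(1) by (simp add: coeff_npoly bit_0)
  show "below (Suc e) F" by (rule below_npoly) (rule modulus_facts(5))
qed

lemma degree_F: "Polynomial.degree F = e"
proof (rule antisym)
  show "Polynomial.degree F \<le> e" using coeff_F(3) by (auto simp: below_def intro: degree_le)
  show "e \<le> Polynomial.degree F" using coeff_F(1) by (intro le_degree) simp
qed

lemma F_nonzero: "F \<noteq> 0"
  using coeff_F(1) by auto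

lemma below_mod: "below e (p mod F)"
  using degree_mod_less[OF F_nonzero, of p] modulus_facts(2) by (auto simp: below_iff degree_F)

lemma mod_below: "below e p \<Longrightarrow> p mod F = p"
  using modulus_facts(2) by (intro mod_poly_less) (simp add: below_iff degree_F)

lemma npoly_tstep: "q < 2 ^ e \<Longrightarrow> npoly (tstep (2 ^ e) f q) = (Polynomial.monom 1 1 * npoly q) mod F"
proof -
  assume q: "q < 2 ^ e"
  have t: "tstep (2 ^ e) f q < 2 ^ e" using modulus_facts q by (intro tstep_less[OF refl]) auto
  have "(Polynomial.monom 1 1 * npoly q) mod F = npoly (tstep (2 ^ e) f q) mod F"
    by (auto simp: tstep_def npoly_xor npoly_double)
  then show ?thesis using mod_below[OF below_npoly[OF t]] by simp
qed

lemma npoly_tstep_funpow: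
  assumes "q < 2 ^ e"
  shows "npoly ((tstep (2 ^ e) f ^^ t) q) = (Polynomial.monom 1 t * npoly q) mod F"
proof (induction t)
  case 0
  then show ?case using mod_below[OF below_npoly[OF assms]] by (simp flip: one_poly_eq_simps monom_0)
next
  case (Suc t)
  have lt: "(tstep (2 ^ e) f ^^ t) q < 2 ^ e"
    using modulus_facts assms by (intro tstep_funpow_less[OF refl]) auto
  have "npoly ((tstep (2 ^ e) f ^^ Suc t) q) = (Polynomial.monom 1 1 * ((Polynomial.monom 1 t * npoly q) mod F)) mod F"
    using npoly_tstep[OF lt] Suc by simp
  also have "\<dots> = (Polynomial.monom 1 1 * (Polynomial.monom 1 t * npoly q)) mod F" by (rule mod_mult_right_eq)
  also have "Polynomial.monom 1 1 * (Polynomial.monom 1 t * npoly q) = Polynomial.monom 1 (Suc t) * npoly q"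
    by (simp add: mult_monom flip: mult.assoc)
  finally show ?case .
qed

text \<open>\<open>p\<close> is not a zero divisor modulo \<open>F\<close>. In the finite residue
  ring this amounts to being a unit, but unlike an inverse it passes directly to products.\<close>

definition cancels :: "bit poly \<Rightarrow> bool" where
  "cancels p \<longleftrightarrow> (\<forall>h. F dvd p * h \<longrightarrow> F dvd h)"

lemma cancels_mult: "cancels p \<Longrightarrow> cancels q \<Longrightarrow> cancels (p * q)"
  unfolding cancels_def by (metis mult.assoc)

lemma cancelsI:
  assumes "\<And>h. below e h \<Longrightarrow> F dvd p * h \<Longrightarrow> h = 0"
  shows "cancels p"
  unfolding cancels_def
proof (intro allI impI)
  fix h assume "F dvd p * h"
  then have "F dvd p * (h mod F)" by (simp add: dvd_eq_mod_eq_0 mod_mult_right_eq)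
  then have "h mod F = 0" by (rule assms[OF below_mod])
  then show "F dvd h" by (simp add: dvd_eq_mod_eq_0)
qed

text \<open>If \<open>X * h = F * g\<close> with \<open>h\<close> reduced and nonzero, comparing
  degrees makes \<open>g\<close> a nonzero constant, and comparing constant coefficients makes it
  zero.\<close>

lemma cancels_X: "cancels (Polynomial.monom 1 1)"
proof (rule cancelsI)
  fix h assume h: "below e h" "F dvd Polynomial.monom 1 1 * h"
  then obtain g where g: "Polynomial.monom 1 1 * h = F * g" by (elim dvdE)
  show "h = 0"
  proof (rule ccontr)
    assume "h \<noteq> 0"
    then have g0: "g \<noteq> 0" using g by (auto simp: monom_eq_0_iff)
    have "e + Polynomial.degree g = 1 + Polynomial.degree h"
      using arg_cong[OF g, of Polynomial.degree] \<open>h \<noteq> 0\<close> g0 F_nonzero by (simp add: degree_mult_eq degree_F monom_eq_0_iff degree_monom_eq)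
    moreover have "Polynomial.degree h < e" using h(1) modulus_facts(2) by (simp add: below_iff)
    ultimately have "Polynomial.degree g = 0" by simp
    then have "poly.coeff g 0 \<noteq> 0" using g0 leading_coeff_neq_0[of g] by simp
    moreover have "poly.coeff (F * g) 0 = poly.coeff g 0" using coeff_F(2) by (simp add: coeff_mult_0)
    moreover have "poly.coeff (Polynomial.monom 1 1 * h) 0 = 0" by (simp add: coeff_mult)
    ultimately show False using g by simp
  qed
qed

lemma cancels_X_power: "cancels (Polynomial.monom 1 t)"
proof (induction t)
  case 0
  then show ?case by (simp add: cancels_def flip: one_poly_eq_simps monom_0)
next
  case (Suc t)
  have "Polynomial.monom (1::bit) (Suc t) = Polynomial.monom 1 1 * Polynomial.monom 1 t" by (simp add: mult_monom)
  then show ?case using cancels_mult[OF cancels_X Suc] by simp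
qed

text \<open>An \<open>h\<close> annihilated by \<open>X^r - 1\<close> is a fixed point of the
  \<open>r\<close>-fold \<open>tstep\<close>, so \<open>orbit_free\<close> leaves only
  \<open>h = 0\<close>.\<close>

lemma cancels_X_power_minus_1:
  assumes "0 < r" "r < n"
  shows "cancels (Polynomial.monom 1 r - 1)"
proof (rule cancelsI)
  fix h assume h: "below e h" "F dvd (Polynomial.monom 1 r - 1) * h"
  obtain a where a: "a < 2 ^ e" "h = npoly a" using below_imp_npoly[OF h(1)] by blast
  have "F dvd Polynomial.monom 1 r * h - h" using h(2) by (simp add: left_diff_distrib)
  then have "(Polynomial.monom 1 r * h) mod F = h mod F" by (simp only: mod_eq_dvd_iff)
  then have "npoly ((tstep (2 ^ e) f ^^ r) a) = npoly a"
    using npoly_tstep_funpow[OF a(1), of r] mod_below[OF h(1)] a(2) by simp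
  then have "(tstep (2 ^ e) f ^^ r) a = a" by (rule npoly_inj)
  then have "a = 0" using modulus_facts(6)[of a] a(1) assms by (auto simp: orbit_free_def)
  then show "h = 0" using a(2) by simp
qed

lemma cancels_minus: "cancels p \<Longrightarrow> cancels (- p)"
  unfolding cancels_def mult_minus_left dvd_minus_iff .

lemma cancels_diff:
  assumes "i < n" "j < n" "i \<noteq> j"
  shows "cancels (Polynomial.monom 1 i - Polynomial.monom 1 j)"
proof -
  have less: "cancels (Polynomial.monom 1 i - Polynomial.monom 1 j)" if "j < i" "i < n" for i j
  proof -
    have "Polynomial.monom 1 i - Polynomial.monom (1::bit) j = Polynomial.monom 1 j * (Polynomial.monom 1 (i - j) - 1)"
      using that by (simp only: right_diff_distrib mult_monom) simp
    then show ?thesis using cancels_mult[OF cancels_X_power cancels_X_power_minus_1[of "i - j"]] that by simp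
  qed
  show ?thesis
  proof (cases "j < i")
    case False
    then have "cancels (- (Polynomial.monom 1 j - Polynomial.monom 1 i))" using less[of i j] assms by (intro cancels_minus) auto
    then show ?thesis by (simp only: minus_diff_eq)
  qed (use less assms in auto)
qed

lemma cancels_prod: "finite A \<Longrightarrow> (\<And>a. a \<in> A \<Longrightarrow> cancels (g a)) \<Longrightarrow> cancels (\<Prod>a\<in>A. g a)"
proof (induction A rule: finite_induct)
  case empty
  then show ?case by (simp add: cancels_def)
qed (auto intro: cancels_mult)

text \<open>Multiplication by \<open>p\<close> is injective on the finitely many residues, hence
  surjective. This supplies the inverses for interpolation.\<close>

lemma cancels_surj:
  assumes "cancels p" "below e q"
  shows "\<exists>b. (p * b) mod F = q"
proof -
  have "inj_on (\<lambda>b. (p * b) mod F) {b. below e b}"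
  proof (rule inj_onI)
    fix a b assume "a \<in> {b. below e b}" "b \<in> {b. below e b}" "(p * a) mod F = (p * b) mod F"
    then have "F dvd p * (a - b)" by (simp only: mod_eq_dvd_iff right_diff_distrib)
    then have "F dvd a - b" using assms(1) unfolding cancels_def by blast
    then have "a mod F = b mod F" by (simp only: mod_eq_dvd_iff)
    then show "a = b" using \<open>a \<in> _\<close> \<open>b \<in> _\<close> mod_below by simp
  qed
  then have "(\<lambda>b. (p * b) mod F) ` {b. below e b} = {b. below e b}"
    using below_mod by (intro endo_inj_surj finite_below) auto
  then show ?thesis using assms(2) by (metis (mono_tags, lifting) imageE mem_Collect_eq)
qed

definition \<phi> :: "bit poly \<Rightarrow> bit" where
  "\<phi> p = poly.coeff (p mod F) (e - 1)"

lemma \<phi>_add: "\<phi> (p + q) = \<phi> p + \<phi> q"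
  by (simp add: \<phi>_def poly_mod_add_left)

lemma \<phi>_0 [simp]: "\<phi> 0 = 0"
  by (simp add: \<phi>_def)

lemma \<phi>_sum: "\<phi> (\<Sum>i\<in>A. g i) = (\<Sum>i\<in>A. \<phi> (g i))"
  by (induction A rule: infinite_finite_induct) (auto simp: \<phi>_add)

lemma \<phi>_cong: "p mod F = q mod F \<Longrightarrow> \<phi> p = \<phi> q"
  by (simp add: \<phi>_def)

lemma \<phi>_smult: "\<phi> (Polynomial.smult c p) = c * \<phi> p"
  by (cases c) auto

lemma of_nat_tbit: "(of_nat (tbit E f t) :: bit) = \<phi> (Polynomial.monom 1 t)"
proof -
  define q where "q = (tstep (2 ^ e) f ^^ t) 1"
  have one: "1 < (2::nat) ^ e" using one_less_power[of "2::nat" e] modulus_facts(2) by simp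
  have q: "q < 2 ^ e" unfolding q_def using modulus_facts one by (intro tstep_funpow_less[OF refl]) auto
  have "npoly q = Polynomial.monom 1 t mod F" using npoly_tstep_funpow[OF one, of t] by (simp add: q_def)
  then have "\<phi> (Polynomial.monom 1 t) = of_bool (Bit_Operations.bit q (e - 1))" by (simp add: \<phi>_def flip: coeff_npoly)
  moreover have "Bit_Operations.bit q (e - 1) \<longleftrightarrow> 2 ^ e \<le> 2 * q"
  proof -
    obtain e' where e': "e = Suc e'" using modulus_facts(2) gr0_implies_Suc by blast
    have "q div 2 ^ e' < 2" using q by (simp add: e' less_mult_imp_div_less)
    then have "odd (q div 2 ^ e') \<longleftrightarrow> q div 2 ^ e' \<noteq> 0" by (cases "q div 2 ^ e'") auto
    then show ?thesis by (auto simp: bit_iff_odd e' div_eq_0_iff)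
  qed
  ultimately show ?thesis by (simp add: tbit_def Ee q_def)
qed

lemma of_nat_out_bit:
  "(of_nat (out_bit E f k d c i) :: bit) = (\<Sum>j<k. \<Sum>l<d. of_nat (c (j * d + l)) * \<phi> (Polynomial.monom 1 (i * j + l)))"
  unfolding out_bit_def of_nat_bit_mod_2 of_nat_sum of_nat_mult of_nat_tbit ..

text \<open>Output bits are linear over GF(2) in the seed; both the shift argument and the
  superposition of interpolating seeds rest on this.\<close>

lemma out_bit_sum:
  assumes "\<And>q. q < k * d \<Longrightarrow> (of_nat (c q) :: bit) = (\<Sum>a\<in>A. of_nat (C a q))"
  shows "(of_nat (out_bit E f k d c i) :: bit) = (\<Sum>a\<in>A. of_nat (out_bit E f k d (C a) i))"
proof -
  have lt: "j * d + l < k * d" if "j < k" "l < d" for j l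
  proof -
    have "j * d + l < Suc j * d" using that by simp
    also have "\<dots> \<le> k * d" using that by (intro mult_right_mono) auto
    finally show ?thesis .
  qed
  have "(of_nat (out_bit E f k d c i) :: bit) =
      (\<Sum>j<k. \<Sum>l<d. \<Sum>a\<in>A. of_nat (C a (j * d + l)) * \<phi> (Polynomial.monom 1 (i * j + l)))"
    unfolding of_nat_out_bit using lt by (intro sum.cong refl) (simp only: lessThan_iff assms sum_distrib_right)
  also have "\<dots> = (\<Sum>j<k. \<Sum>a\<in>A. \<Sum>l<d. of_nat (C a (j * d + l)) * \<phi> (Polynomial.monom 1 (i * j + l)))"
    by (intro sum.cong refl sum.swap)
  also have "\<dots> = (\<Sum>a\<in>A. of_nat (out_bit E f k d (C a) i))"
    unfolding of_nat_out_bit by (rule sum.swap)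
  finally show ?thesis .
qed

text \<open>Lagrange basis: the product of \<open>Y - X^i\<close> over \<open>i\<close> in
  \<open>S - {i0}\<close> vanishes at the other nodes and is a unit at \<open>X^i0\<close>. Its
  degree is \<open>card S - 1 < k\<close>, so its coefficients fit into the \<open>k\<close>
  blocks.\<close>

lemma interpolation_seed:
  assumes S: "finite S" "S \<subseteq> {..<n}" "card S \<le> k" and i0: "i0 \<in> S"
  shows "\<exists>c. (\<forall>q. c q < 2) \<and> (\<forall>i\<in>S. out_bit E f k d c i = of_bool (i = i0))"
proof -
  let ?X = "\<lambda>i. Polynomial.monom (1::bit) i"
  let ?S = "S - {i0}"
  have "cancels (\<Prod>i\<in>?S. ?X i0 - ?X i)" using S i0 by (intro cancels_prod cancels_diff) auto
  moreover have "below e (?X (e - 1))" using modulus_facts(2) by (auto simp: below_def)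
  \<comment> \<open>Scaling by \<open>b\<close> makes the value at the node \<open>i0\<close> equal
    to \<open>X^(e - 1)\<close>, where the functional \<open>\<phi>\<close> is 1.\<close>
  ultimately obtain b where b: "((\<Prod>i\<in>?S. ?X i0 - ?X i) * b) mod F = ?X (e - 1)"
    using cancels_surj by blast
  define Q :: "bit poly poly" where "Q = Polynomial.smult b (\<Prod>i\<in>?S. [:- ?X i, 1:])"
  have "Polynomial.degree Q \<le> card ?S"
  proof -
    have "Polynomial.degree (\<Prod>i\<in>?S. [:- ?X i, 1:]) \<le> (\<Sum>i\<in>?S. Polynomial.degree [:- ?X i, 1:])"
      using degree_prod_sum_le[of ?S "\<lambda>i. [:- ?X i, 1:]"] S(1) by (simp add: o_def)
    also have "\<dots> \<le> (\<Sum>i\<in>?S. 1)" by (intro sum_mono) simp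
    finally show ?thesis unfolding Q_def using degree_smult_le order_trans by fastforce
  qed
  moreover have "card ?S < k" using S i0 card_Diff1_less[of S i0] by simp
  ultimately have dQ: "Polynomial.degree Q < k" by simp
  have polyQ: "poly Q y = (\<Sum>j<k. poly.coeff Q j * y ^ j)" for y
    unfolding poly_altdef using dQ by (intro sum.mono_neutral_left) (auto simp: coeff_eq_0)
  \<comment> \<open>Coefficients are reduced modulo \<open>F\<close>, so that
    \<open>d \<ge> e\<close> digits hold them; the value of \<open>\<phi>\<close> does not
    notice.\<close>
  define c where "c q = (if poly.coeff (poly.coeff Q (q div d) mod F) (q mod d) = 1 then 1 else 0 :: nat)" for q
  have d0: "d > 0" using modulus_facts by simp
  have c: "of_nat (c (j * d + l)) = poly.coeff (poly.coeff Q j mod F) l" if "l < d" for j l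
    using that d0 by (simp add: c_def)
  have out: "(of_nat (out_bit E f k d c i) :: bit) = \<phi> (poly Q (?X i))" for i
  proof -
    have "(of_nat (out_bit E f k d c i) :: bit) =
        (\<Sum>j<k. \<Sum>l<d. \<phi> (Polynomial.smult (poly.coeff (poly.coeff Q j mod F) l) (?X (i * j + l))))"
      unfolding of_nat_out_bit \<phi>_smult using c by (intro sum.cong refl) auto
    also have "\<dots> = (\<Sum>j<k. \<phi> ((poly.coeff Q j mod F) * ?X i ^ j))"
    proof (intro sum.cong refl)
      fix j
      have "(\<Sum>l<d. Polynomial.smult (poly.coeff (poly.coeff Q j mod F) l) (?X (i * j + l))) =
        (\<Sum>l<d. Polynomial.monom (poly.coeff (poly.coeff Q j mod F) l) l) * ?X (i * j)"
        unfolding sum_distrib_right by (intro sum.cong refl) (simp add: mult_monom smult_monom add.commute)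
      also have "(\<Sum>l<d. Polynomial.monom (poly.coeff (poly.coeff Q j mod F) l) l) = poly.coeff Q j mod F"
      proof (rule poly_eqI)
        fix t
        have "poly.coeff (\<Sum>l<d. Polynomial.monom (poly.coeff (poly.coeff Q j mod F) l) l) t =
           (if t < d then poly.coeff (poly.coeff Q j mod F) t else 0)"
          by (simp add: coeff_sum sum.delta)
        moreover have "poly.coeff (poly.coeff Q j mod F) t = 0" if "\<not> t < d"
          using below_mod[of "poly.coeff Q j"] that modulus_facts(3) unfolding below_def by simp
        ultimately show "poly.coeff (\<Sum>l<d. Polynomial.monom (poly.coeff (poly.coeff Q j mod F) l) l) t = poly.coeff (poly.coeff Q j mod F) t"
          by simp
      qed
      also have "?X (i * j) = ?X i ^ j" by (simp add: monom_power)
      finally show "(\<Sum>l<d. \<phi> (Polynomial.smult (poly.coeff (poly.coeff Q j mod F) l) (?X (i * j + l)))) = \<phi> ((poly.coeff Q j mod F) * ?X i ^ j)"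
        by (simp flip: \<phi>_sum)
    qed
    also have "\<dots> = (\<Sum>j<k. \<phi> (poly.coeff Q j * ?X i ^ j))"
      by (intro sum.cong refl \<phi>_cong) (rule mod_mult_left_eq)
    also have "\<dots> = \<phi> (poly Q (?X i))" by (simp add: polyQ \<phi>_sum)
    finally show ?thesis .
  qed
  have "out_bit E f k d c i = of_bool (i = i0)" if i: "i \<in> S" for i
  proof -
    have "\<phi> (poly Q (?X i)) = of_bool (i = i0)"
    proof (cases "i = i0")
      case True
      have "poly Q (?X i0) = (\<Prod>i\<in>?S. ?X i0 - ?X i) * b" by (simp add: Q_def poly_prod mult.commute)
      then have "\<phi> (poly Q (?X i0)) = poly.coeff (?X (e - 1)) (e - 1)" using b by (simp add: \<phi>_def)
      then show ?thesis using True by simp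
    next
      case False
      have "poly Q (?X i) = 0" using i False S(1) by (auto simp: Q_def poly_prod intro!: prod_zero bexI[of _ i])
      then show ?thesis using False by simp
    qed
    moreover have "out_bit E f k d c i = 0 \<or> out_bit E f k d c i = 1" by (auto simp: out_bit_def)
    ultimately show ?thesis using out[of i] by (auto split: if_splits)
  qed
  moreover have "\<forall>q. c q < 2" by (simp add: c_def)
  ultimately show ?thesis by blast
qed

end

section \<open>The assembled generator\<close>

definition kwise_prog :: loop where
  "kwise_prog = size_prog ;; copy_prog ;; (table_prog ;; search_prog ;; output_prog) ;; Set 0 0 ;; Plus 0 0 7"

definition kwise_seed :: "nat \<Rightarrow> nat \<Rightarrow> nat" where
  "kwise_seed n k = k * (2 * bitlen n)"

definition seed_bits :: "nat \<Rightarrow> (nat \<Rightarrow> real) \<Rightarrow> nat \<Rightarrow> nat" where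
  "seed_bits s x q = (if q < s then bit_of_sign (x q) else 0)"

definition kwise_gen :: "nat \<Rightarrow> nat \<Rightarrow> (nat \<Rightarrow> real) \<Rightarrow> (nat \<Rightarrow> real)" where
  "kwise_gen n k x = (\<lambda>i\<in>{..<n}. if snd (sem kwise_prog (ram_input n k (kwise_seed n k) x)) i = 0 then 1 else -1)"

text \<open>The reason for blocks of \<open>2 * bitlen n\<close> bits: elements of order at least
  \<open>n\<close> need a field with more than \<open>n * n\<close> elements.\<close>

lemma square_less_pow_bitlen: "n * n < 2 ^ (2 * bitlen n)"
proof -
  have n: "n < 2 ^ bitlen n" using bitlen_le_iff[of n "bitlen n"] by simp
  then have "n * n < 2 ^ bitlen n * 2 ^ bitlen n" by (intro mult_strict_mono) auto
  then show ?thesis by (simp add: mult_2 power_add)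
qed

text \<open>Keeps \<open>2 ^ d\<close> quadratic in \<open>n\<close>, so that the table and the
  exhaustive search take polynomial time.\<close>

lemma pow_bitlen_le: "2 ^ bitlen n \<le> 2 * n + 1"
proof (cases "bitlen n")
  case (Suc b)
  then have "\<not> n < 2 ^ b" using bitlen_le_iff[of n b] by simp
  then show ?thesis by (simp add: Suc)
qed simp

lemma bitlen_pos: "n > 0 \<Longrightarrow> bitlen n > 0"
  using bitlen_le_iff[of n 0] by simp

lemma bit_of_sign_less_2: "bit_of_sign b < 2"
  by (simp add: bit_of_sign_def)

text \<open>The intermediate states are exposed because the loop bounds of each phase are only known
  once the previous phase has run.\<close>

lemma sem_kwise_prog:
  obtains r1 r2 m2 r m where
    "sem size_prog (ram_input n k (kwise_seed n k) x) = (r1, snd (ram_input n k (kwise_seed n k) x))"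
    "r1 3 = 2 ^ bitlen n" "r1 7 = kwise_seed n k"
    "sem copy_prog (r1, snd (ram_input n k (kwise_seed n k) x)) = (r2, m2)"
    "r2 0 = n" "r2 1 = k" "r2 4 = 2 * bitlen n" "r2 8 = 2 ^ bitlen n * 2 ^ bitlen n" "r2 9 = 2 * (2 ^ bitlen n * 2 ^ bitlen n)" "r2 17 = n - 1"
    "sem kwise_prog (ram_input n k (kwise_seed n k) x) = (r, m)" "r 0 = kwise_seed n k"
    "n > 0 \<Longrightarrow> \<exists>f E. max_modulus n (2 * bitlen n) f E \<and>
       (\<forall>i<n. m i = out_bit E f k (2 * bitlen n) (seed_bits (kwise_seed n k) x) i)"
proof -
  define s where "s = kwise_seed n k"
  obtain r0 m0 where i: "ram_input n k s x = (r0, m0)" by fastforce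
  have r0: "r0 0 = n" "r0 1 = k" using i by (auto simp: ram_input_def)
  have m0: "m0 = seed_bits s x" using i by (auto simp: ram_input_def seed_bits_def[abs_def])
  obtain r1 where 1: "sem size_prog (r0, m0) = (r1, m0)" "r1 0 = n" "r1 1 = k" "r1 3 = 2 ^ bitlen n" "r1 4 = 2 * bitlen n"
    "r1 7 = s" "r1 10 = 1" "r1 11 = 2"
    using sem_size_prog[of r0 m0] by (metis r0 s_def kwise_seed_def)
  obtain r2 m2 where 2: "sem copy_prog (r1, m0) = (r2, m2)"
    "\<And>a. a \<notin> {2, 5, 8, 9, 12, 13, 14, 15, 17, 18, 50} \<Longrightarrow> r2 a = r1 a"
    "r2 8 = r1 3 * r1 3" "r2 9 = 2 * (r1 3 * r1 3)" "r2 18 = 4 * (r1 3 * r1 3)" "r2 17 = r1 0 - 1"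
    "r2 12 = r1 7 + r1 0" "r2 15 = 2 * r1 7 + r1 0"
    "\<And>j. j < r1 7 \<Longrightarrow> m2 (r1 7 + r1 0 + j) = m0 j" "\<And>j. 2 * r1 7 + r1 0 \<le> j \<Longrightarrow> m2 j = m0 j"
    by (rule sem_copy_prog[of r1 m0, OF 1(7)]) blast
  have k2: "r2 0 = n" "r2 1 = k" "r2 4 = 2 * bitlen n" "r2 7 = s" "r2 10 = 1" "r2 11 = 2"
    using 1(2-8) 2(2)[of 0] 2(2)[of 1] 2(2)[of 4] 2(2)[of 7] 2(2)[of 10] 2(2)[of 11] by simp_all
  \<comment> \<open>The first cell of the table lies beyond the seed and its copy, where the memory
    is still zero.\<close>
  have mz: "m2 (r2 15) = 0" using 2(8,10) by (simp add: 1 m0 seed_bits_def)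
  have pre: "r2 9 = 2 * r2 8" "r2 18 = 4 * r2 8" using 2(3-5) by simp_all
  obtain r3 m3 where 3: "sem table_prog (r2, m2) = (r3, m3)" "xor_table (r2 15) (r2 9) m3"
    "\<And>j. j < r2 15 \<Longrightarrow> m3 j = m2 j"
    "\<And>a. a \<notin> {2, 20, 21, 22, 23, 24, 25, 26, 27, 28, 50, 51} \<Longrightarrow> r3 a = r2 a"
    by (rule sem_table_prog[of r2 m2, OF k2(5,6) pre mz]) blast
  obtain r4 m4 where 4: "sem search_prog (r3, m3) = (r4, m4)" by fastforce
  obtain r5 m5 where 5: "sem output_prog (r4, m4) = (r5, m5)" by fastforce
  \<comment> \<open>The last two phases do not write register 7. This covers \<open>n = 0\<close> as
    well, where \<open>d = 0\<close> and no valid modulus exists.\<close>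
  have fr: "r5 7 = s"
    using sem_unwritten[of 7 search_prog "(r3, m3)"] sem_unwritten[of 7 output_prog "(r4, m4)"] 4 5 3(4)[of 7] k2
    by (simp add: search_prog_def output_prog_def)
  have res: "\<exists>f E. max_modulus n (2 * bitlen n) f E \<and> (\<forall>i<n. m5 i = out_bit E f k (2 * bitlen n) (seed_bits s x) i)"
    if n0: "n > 0"
  proof -
    define d where "d = 2 * bitlen n"
    have d: "2 ^ bitlen n * 2 ^ bitlen n = (2::nat) ^ d" by (simp add: d_def mult_2 power_add)
    have d0: "d > 0" using bitlen_pos[OF n0] by (simp add: d_def)
    have k3: "r3 8 = 2 ^ d" "r3 9 = 2 * 2 ^ d" "r3 10 = 1" "r3 11 = 2" "r3 18 = 2 * r3 9" "r3 17 = n - 1" "r3 15 = r2 15" "r3 9 = r2 9"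
      "r3 0 = n" "r3 (Suc 0) = k" "r3 4 = d" "r3 12 = s + n"
      using k2 2(3-8) 1 d by (simp_all add: 3(4) d_def)
    obtain r4' f E where search: "sem search_prog (r3, m3) = (r4', m3)" "max_modulus n d f E"
      "r4' 34 = E" "r4' 35 = r3 15 + f * r3 9"
      "\<And>a. a \<notin> {2, 30, 31, 32, 33, 34, 35, 36, 37, 38, 39, 40, 41, 42, 43, 44, 45, 50, 51, 52} \<Longrightarrow> r4' a = r3 a"
    proof (rule sem_search_prog[OF k3(1-6) n0])
      show "xor_table (r3 15) (r3 9) m3" using 3(2) k3 by simp
      show "\<exists>f E. valid_modulus n d f E"
        using valid_modulus_exists[of n d] square_less_pow_bitlen[of n] d0 by (simp add: d_def)
    qed blast
    have e4: "r4 = r4'" "m4 = m3" using 4 search(1) by auto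
    have k4: "r4' 0 = n" "r4' (Suc 0) = k" "r4' 4 = d" "r4' 10 = 1" "r4' 12 = s + n" using k3 by (simp_all add: search(5))
    obtain e where e: "0 < e" "e \<le> d" "E = 2 ^ e" "E \<le> f" "f < 2 * E"
      using search(2) by (auto simp: max_modulus_def valid_modulus_def)
    have "(2::nat) ^ e \<le> 2 ^ d" using e(2) by (intro power_increasing) auto
    then have EW: "2 * E \<le> r3 9" using e(3) k3 by simp
    have ready: "output_ready (r3 15) (r3 9) e E f r4' m3"
      unfolding output_ready_def using e EW search(3,4) k4 3(2) k3 by simp
    have X: "r3 15 = 2 * s + n" using k3 2(8) 1 by simp
    obtain r5' m5' where out5: "sem output_prog (r4', m3) = (r5', m5')"
      "\<And>i. i < r4' 0 \<Longrightarrow> m5' i = out_bit E f (r4' 1) (r4' 4) (seed_bits s x) i"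
    proof (rule sem_output_prog[OF ready, of "seed_bits s x"])
      fix q assume "q < r4' 1 * r4' 4"
      then have q: "q < s" using k4 by (simp add: s_def kwise_seed_def d_def)
      have "m3 (s + n + q) = m2 (s + n + q)" using q X k3 by (intro 3(3)) simp
      also have "\<dots> = m0 q" using 2(9)[of q] q 1 by simp
      finally show "m3 (r4' 12 + q) = seed_bits s x q" using k4 m0 by simp
    qed (use k4 X in \<open>auto simp: seed_bits_def bit_of_sign_less_2\<close>)
    have "m5 = m5'" using 5 out5(1) e4 by simp
    then have "\<forall>i<n. m5 i = out_bit E f k d (seed_bits s x) i" using out5(2) k4 by simp
    then show ?thesis using search(2) unfolding d_def by blast
  qed
  have "sem kwise_prog (r0, m0) = (r5(0 := s), m5)"
    using 1(1) 2(1) 3(1) 4 5 fr by (simp add: kwise_prog_def)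
  then show ?thesis
    using that[of r1 r2 m2 "r5(0 := s)" m5] i 1 2(1,3,4,6) k2 res by (simp add: s_def)
qed

lemma proper_kwise_prog: "proper kwise_prog"
  by (simp add: kwise_prog_def size_prog_def copy_prog_def table_prog_def table_row_def search_prog_def
    search_body_def test_body_def cmp_body_def output_prog_def output_body_def term_body_def bit_body_def
    shift_body_def mul_x_def)

text \<open>With \<open>t = n + k + 1\<close>, the largest loop bound is
  \<open>W = 2 * 2 ^ d \<le> 2 * (2 * t)^2\<close>, which gives the 8.\<close>

lemma time_kwise_prog:
  assumes N: "N = 8 * (n + k + 1)\<^sup>2"
  shows "time kwise_prog (ram_input n k (kwise_seed n k) x) \<le> cost kwise_prog N"
proof -
  define t where "t = n + k + 1"
  obtain r0 m0 where i: "ram_input n k (kwise_seed n k) x = (r0, m0)" by fastforce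
  have r0: "r0 0 = n" "r0 (Suc 0) = k" using i by (auto simp: ram_input_def)
  obtain r1 r2 m2 r m where 1: "sem size_prog (r0, m0) = (r1, m0)" "r1 3 = 2 ^ bitlen n" "r1 7 = kwise_seed n k"
    and 2: "sem copy_prog (r1, m0) = (r2, m2)" "r2 0 = n" "r2 1 = k" "r2 4 = 2 * bitlen n"
      "r2 8 = 2 ^ bitlen n * 2 ^ bitlen n" "r2 9 = 2 * (2 ^ bitlen n * 2 ^ bitlen n)" "r2 17 = n - 1"
    by (rule sem_kwise_prog[of n k x, unfolded i snd_conv]) (rule that; assumption)
  have t1: "t \<le> t * t" by (simp add: t_def)
  have p: "2 ^ bitlen n \<le> 2 * t" using pow_bitlen_le[of n] by (simp add: t_def)
  have pp: "2 ^ bitlen n * 2 ^ bitlen n \<le> 4 * (t * t)" using mult_mono[OF p p] by simp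
  have Nt: "N = 8 * (t * t)" by (simp add: N t_def power2_eq_square)
  have s: "kwise_seed n k \<le> N"
  proof -
    have "k * bitlen n \<le> t * t" using bitlen_le[of n] by (intro mult_mono) (auto simp: t_def)
    then show ?thesis by (simp add: kwise_seed_def Nt)
  qed
  have nk: "n \<le> N" "k \<le> N" "2 * bitlen n \<le> N" "2 ^ bitlen n \<le> N" "n - 1 \<le> N"
    using t1 p bitlen_le[of n] by (simp_all add: Nt t_def)
  have "time size_prog (r0, m0) \<le> cost size_prog N"
    by (rule time_le_cost) (use r0 nk in \<open>simp add: size_prog_def\<close>)
  moreover have "time copy_prog (r1, m0) \<le> cost copy_prog N"
    by (rule time_le_cost) (use 1 s nk in \<open>simp add: copy_prog_def\<close>)
  moreover have "time (table_prog ;; search_prog ;; output_prog) (r2, m2) \<le> cost (table_prog ;; search_prog ;; output_prog) N"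
    by (rule time_le_cost)
      (use 2 nk pp Nt in \<open>simp add: table_prog_def table_row_def search_prog_def
    search_body_def test_body_def cmp_body_def output_prog_def output_body_def term_body_def bit_body_def
    shift_body_def mul_x_def\<close>)
  ultimately show ?thesis
    unfolding i kwise_prog_def using 1(1) 2(1) by (simp del: time.simps(8) cost.simps(3))
qed

lemma explicit_kwise_gen: "explicit_generator kwise_seed kwise_gen"
  unfolding explicit_generator_def
proof (intro conjI allI)
  fix n k
  show "kwise_gen n k \<in> cube (kwise_seed n k) \<rightarrow> cube n"
    by (auto simp: kwise_gen_def signs_def)
next
  obtain a d where ad: "\<And>N. cost kwise_prog N \<le> a * (N + 1) ^ d" using cost_polynomial by blast
  have "\<exists>t r m. runs (ram_of kwise_prog) (ram_input n k (kwise_seed n k) x) t (r, m) \<and>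
      t \<le> (a * 9 ^ d) * (n + k + 1) ^ (2 * d) \<and> r 0 = kwise_seed n k \<and> (\<forall>i<n. m i = bit_of_sign (kwise_gen n k x i))" for n k x
  proof -
    obtain r m where rm: "sem kwise_prog (ram_input n k (kwise_seed n k) x) = (r, m)" "r 0 = kwise_seed n k"
      "n > 0 \<Longrightarrow> \<exists>f E. max_modulus n (2 * bitlen n) f E \<and>
       (\<forall>i<n. m i = out_bit E f k (2 * bitlen n) (seed_bits (kwise_seed n k) x) i)"
      using sem_kwise_prog[of n k x] by metis
    define N where "N = 8 * (n + k + 1)\<^sup>2"
    have "time kwise_prog (ram_input n k (kwise_seed n k) x) \<le> a * (N + 1) ^ d"
      using time_kwise_prog[OF N_def] ad[of N] by (rule order_trans)
    also have "\<dots> \<le> a * (9 * (n + k + 1)\<^sup>2) ^ d"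
      by (intro mult_left_mono power_mono) (auto simp: N_def)
    also have "\<dots> = (a * 9 ^ d) * (n + k + 1) ^ (2 * d)"
      by (simp only: power_mult_distrib power_mult mult.assoc)
    finally have t: "time kwise_prog (ram_input n k (kwise_seed n k) x) \<le> (a * 9 ^ d) * (n + k + 1) ^ (2 * d)" .
    have "m i = bit_of_sign (kwise_gen n k x i)" if i: "i < n" for i
    proof -
      have "m i = 0 \<or> m i = 1" using rm(3) i by (auto simp: out_bit_def)
      then show ?thesis using i rm(1) by (auto simp: kwise_gen_def bit_of_sign_def)
    qed
    then show ?thesis
      using runs_ram_of[OF proper_kwise_prog, of "ram_input n k (kwise_seed n k) x"] t rm by auto
  qed
  then show "\<exists>P c d. \<forall>n k. \<forall>x\<in>cube (kwise_seed n k). \<exists>t r m.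
        runs P (ram_input n k (kwise_seed n k) x) t (r, m) \<and> t \<le> c * (n + k + 1) ^ d \<and>
        r 0 = kwise_seed n k \<and> (\<forall>i<n. m i = bit_of_sign (kwise_gen n k x i))" by blast
qed

section \<open>Independence of the outputs\<close>

lemma kwise_gen_out_bit:
  assumes "n > 0"
  obtains f E where "valid_modulus n (2 * bitlen n) f E"
    "\<And>k x i. i < n \<Longrightarrow> kwise_gen n k x i =
       (if out_bit E f k (2 * bitlen n) (seed_bits (kwise_seed n k) x) i = 0 then 1 else -1)"
proof -
  have ex: "\<exists>f E. max_modulus n (2 * bitlen n) f E \<and>
       (\<forall>i<n. kwise_gen n k x i = (if out_bit E f k (2 * bitlen n) (seed_bits (kwise_seed n k) x) i = 0 then 1 else -1))" for k x
  proof -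
    obtain r m where rm: "sem kwise_prog (ram_input n k (kwise_seed n k) x) = (r, m)"
      "\<exists>f E. max_modulus n (2 * bitlen n) f E \<and>
       (\<forall>i<n. m i = out_bit E f k (2 * bitlen n) (seed_bits (kwise_seed n k) x) i)"
      using sem_kwise_prog[of n k x] assms by metis
    then obtain f E where "max_modulus n (2 * bitlen n) f E"
      "\<forall>i<n. m i = out_bit E f k (2 * bitlen n) (seed_bits (kwise_seed n k) x) i" by blast
    then show ?thesis by (intro exI[of _ f] exI[of _ E]) (simp add: kwise_gen_def rm(1))
  qed
  then obtain f E where m: "max_modulus n (2 * bitlen n) f E" by blast
  show ?thesis
  proof (rule that[of f E])
    show "valid_modulus n (2 * bitlen n) f E" using m by (simp add: max_modulus_def)
    fix k x i assume "i < n"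
    then show "kwise_gen n k x i = (if out_bit E f k (2 * bitlen n) (seed_bits (kwise_seed n k) x) i = 0 then 1 else -1)"
      using ex[of k x] max_modulus_unique[OF m] by metis
  qed
qed

text \<open>The fibres over \<open>B\<close> partition \<open>A\<close>, so each has
  \<open>card A / card B\<close> elements; surjectivity onto \<open>B\<close> comes out as a
  by-product.\<close>

lemma map_pmf_of_set_equal_fibres:
  assumes "finite A" "A \<noteq> {}" "finite B" "g ` A \<subseteq> B"
    and fib: "\<And>y y'. y \<in> B \<Longrightarrow> y' \<in> B \<Longrightarrow> card {x \<in> A. g x = y} = card {x \<in> A. g x = y'}"
  shows "map_pmf g (pmf_of_set A) = pmf_of_set B"
proof (rule pmf_eqI)
  fix y
  have B: "B \<noteq> {}" using assms by auto
  have p: "pmf (map_pmf g (pmf_of_set A)) y = card {x \<in> A. g x = y} / card A"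
    using assms(1,2) by (simp add: pmf_map measure_pmf_of_set vimage_def Int_def conj_commute)
  show "pmf (map_pmf g (pmf_of_set A)) y = pmf (pmf_of_set B) y"
  proof (cases "y \<in> B")
    case False
    then have "{x \<in> A. g x = y} = {}" using assms(4) by auto
    then show ?thesis using False assms(3) B unfolding p by (simp only: card.empty) simp
  next
    case True
    have "card A = (\<Sum>y'\<in>B. card {x \<in> A. g x = y'})"
      using sum.group[OF assms(1,3,4), of "\<lambda>_. 1::nat"] by simp
    also have "\<dots> = (\<Sum>y'\<in>B. card {x \<in> A. g x = y})" by (intro sum.cong refl fib True)
    also have "\<dots> = card B * card {x \<in> A. g x = y}" by simp
    finally have "card A = card B * card {x \<in> A. g x = y}" .
    moreover have "card A > 0" using assms(1,2) by (simp add: card_gt_0_iff)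
    ultimately show ?thesis using True assms(3) B by (simp add: p)
  qed
qed

text \<open>Under pointwise multiplication of signs the generator is a homomorphism. A seed
  \<open>t\<close> whose outputs on \<open>S\<close> are \<open>y * y'\<close> therefore shifts the
  fibre of \<open>y\<close> injectively into that of \<open>y'\<close>, so all fibres have the same
  size.\<close>

lemma kwise_independent_kwise_gen:
  assumes "n > 0"
  shows "kwise_independent n k (map_pmf (kwise_gen n k) (pmf_of_set (cube (kwise_seed n k))))"
  unfolding kwise_independent_def
proof (intro conjI allI impI)
  define d s where "d = 2 * bitlen n" and "s = kwise_seed n k"
  have sd: "s = k * d" by (simp add: s_def d_def kwise_seed_def)
  have fin: "finite (cube s)" by (simp add: signs_def finite_PiE)
  have ne: "cube s \<noteq> {}" by (simp add: signs_def PiE_eq_empty_iff)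
  have G: "kwise_gen n k ` cube s \<subseteq> cube n"
    using explicit_kwise_gen unfolding explicit_generator_def s_def by blast
  show "set_pmf (map_pmf (kwise_gen n k) (pmf_of_set (cube (kwise_seed n k)))) \<subseteq> cube n"
    using G fin ne by (simp add: s_def)
  fix S assume S: "S \<subseteq> {..<n}" "card S = min k n"
  have finS: "finite S" using S finite_subset by blast
  obtain f E where v: "valid_modulus n d f E"
    and g: "\<And>x i. i < n \<Longrightarrow> kwise_gen n k x i = (if out_bit E f k d (seed_bits s x) i = 0 then 1 else -1)"
    using kwise_gen_out_bit[OF assms] unfolding d_def s_def by metis
  obtain e where Ee: "E = 2 ^ e" using v by (auto simp: valid_modulus_def)
  note outsum = out_bit_sum[OF v Ee]
  define ob where "ob x i = out_bit E f k d (seed_bits s x) i" for x i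
  have o2: "ob x i < 2" for x i by (simp add: ob_def out_bit_def)
  have bit_sign: "(of_nat a :: bit) = of_nat b \<Longrightarrow> a < 2 \<Longrightarrow> b < 2 \<Longrightarrow> a = b" for a b :: nat
    by (auto simp: less_2_cases_iff)
  let ?r = "\<lambda>x. restrict (kwise_gen n k x) S"
  define shift where "shift t x = (\<lambda>q\<in>{..<s}. x q * t q)" for t x :: "nat \<Rightarrow> real"
  have pm: "x q = 1 \<or> x q = -1" if "x \<in> cube s" "q < s" for x q
    using that by (auto simp: signs_def PiE_def Pi_def)
  have shift_in: "shift t x \<in> cube s" if "t \<in> cube s" "x \<in> cube s" for t x
  proof -
    have "x q * t q \<in> {-1, 1}" if "q < s" for q
      using pm[OF \<open>t \<in> _\<close> that] pm[OF \<open>x \<in> _\<close> that] by auto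
    then show ?thesis by (auto simp: shift_def signs_def)
  qed
  have G_shift: "kwise_gen n k (shift t x) i = kwise_gen n k x i * kwise_gen n k t i"
    if t: "t \<in> cube s" and x: "x \<in> cube s" and i: "i < n" for t x i
  proof -
    have "(of_nat (seed_bits s (shift t x) q) :: bit) = (\<Sum>y\<in>{True, False}. of_nat (seed_bits s (if y then x else t) q))"
      if q: "q < k * d" for q
      using pm[OF t, of q] pm[OF x, of q] q by (auto simp: seed_bits_def shift_def bit_of_sign_def sd)
    from outsum[where k = k and c = "seed_bits s (shift t x)" and A = "{True, False}" and C = "\<lambda>y. seed_bits s (if y then x else t)" and i = i, OF this]
    have "(of_nat (ob (shift t x) i) :: bit) = of_nat (ob x i) + of_nat (ob t i)" by (simp add: ob_def)
    then show ?thesis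
      using o2[of "shift t x" i] o2[of x i] o2[of t i] unfolding g[OF i] ob_def[symmetric]
      by (auto simp: less_2_cases_iff)
  qed
  have seed_ex: "\<exists>t\<in>cube s. \<forall>i\<in>S. kwise_gen n k t i = y i" if y: "\<forall>i\<in>S. y i \<in> {-1, 1}" for y :: "nat \<Rightarrow> real"
  proof -
    have "\<exists>c. (\<forall>q. c q < 2) \<and> (\<forall>i\<in>S. out_bit E f k d c i = of_bool (i = a))" if "a \<in> S" for a
      using interpolation_seed[OF v Ee finS S(1) _ that, of k] S(2) by simp
    then obtain C where C: "\<And>a i. a \<in> S \<Longrightarrow> i \<in> S \<Longrightarrow> out_bit E f k d (C a) i = of_bool (i = a)"
      by metis
    \<comment> \<open>The seed for a prescribed pattern is the sum of the interpolating seeds of the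
      coordinates that are to become -1.\<close>
    define A where "A = {a \<in> S. y a = -1}"
    define t where "t = (\<lambda>q\<in>{..<s}. if (\<Sum>a\<in>A. of_nat (C a q) :: bit) = 0 then 1 else -1 :: real)"
    have tc: "t \<in> cube s" by (auto simp: t_def signs_def)
    have "(of_nat (seed_bits s t q) :: bit) = (\<Sum>a\<in>A. of_nat (C a q))" if "q < k * d" for q
      using that by (auto simp: seed_bits_def t_def bit_of_sign_def sd)
    from outsum[where k = k and c = "seed_bits s t" and A = A and C = C, OF this]
    have ot: "(of_nat (ob t i) :: bit) = (\<Sum>a\<in>A. of_nat (out_bit E f k d (C a) i))" for i by (simp add: ob_def)
    have "kwise_gen n k t i = y i" if i: "i \<in> S" for i
    proof -
      have "(of_nat (ob t i) :: bit) = (\<Sum>a\<in>A. if a = i then 1 else 0)"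
        unfolding ot using C i by (intro sum.cong refl) (auto simp: A_def)
      also have "\<dots> = of_bool (y i = -1)" using finS i by (simp add: A_def)
      finally have "ob t i = of_bool (y i = -1)" using o2[of t i] by (auto simp: less_2_cases_iff split: if_splits)
      moreover have "i < n" "y i \<in> {-1, 1}" using S(1) i y by auto
      ultimately show ?thesis unfolding g[OF \<open>i < n\<close>] ob_def[symmetric] by auto
    qed
    then show ?thesis using tc by blast
  qed
  have le: "card {x \<in> cube s. ?r x = y} \<le> card {x \<in> cube s. ?r x = y'}" if y: "y \<in> signs S" "y' \<in> signs S" for y y'
  proof -
    have yv: "y i \<in> {-1, 1}" "y' i \<in> {-1, 1}" if "i \<in> S" for i using y that by (auto simp: signs_def PiE_def Pi_def)
    then have "\<forall>i\<in>S. y i * y' i \<in> {-1, 1}" by fastforce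
    then obtain t where t: "t \<in> cube s" "\<forall>i\<in>S. kwise_gen n k t i = y i * y' i"
      using seed_ex[of "\<lambda>i. y i * y' i"] by blast
    have "inj_on (shift t) {x \<in> cube s. ?r x = y}"
    proof (rule inj_onI)
      fix a b assume a: "a \<in> {x \<in> cube s. ?r x = y}" and b: "b \<in> {x \<in> cube s. ?r x = y}" and eq: "shift t a = shift t b"
      have "a q = b q" if "q < s" for q
        using fun_cong[OF eq, of q] that pm[OF t(1) that] by (auto simp: shift_def)
      moreover have "a \<in> extensional {..<s}" "b \<in> extensional {..<s}" using a b by (auto simp: signs_def PiE_def)
      ultimately show "a = b" by (intro extensionalityI[of _ "{..<s}"]) auto
    qed
    moreover have "shift t ` {x \<in> cube s. ?r x = y} \<subseteq> {x \<in> cube s. ?r x = y'}"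
    proof (rule image_subsetI)
      fix x assume x: "x \<in> {x \<in> cube s. ?r x = y}"
      have "?r (shift t x) = y'"
      proof (rule extensionalityI[of _ S])
        fix i assume i: "i \<in> S"
        then have "kwise_gen n k x i = y i" using x fun_cong[of "?r x" y i] by auto
        moreover have "i < n" using S(1) i by auto
        ultimately show "?r (shift t x) i = y' i"
          using G_shift[OF t(1), of x i] x t(2) i yv(1)[OF i] by auto
      qed (use y in \<open>auto simp: signs_def PiE_def\<close>)
      then show "shift t x \<in> {x \<in> cube s. ?r x = y'}" using shift_in[OF t(1)] x by blast
    qed
    ultimately show ?thesis using fin by (intro card_inj_on_le) auto
  qed
  have "map_pmf ?r (pmf_of_set (cube s)) = pmf_of_set (signs S)"
  proof (rule map_pmf_of_set_equal_fibres[OF fin ne])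
    show "finite (signs S)" using finS by (simp add: signs_def finite_PiE)
    have "restrict z S \<in> signs S" if "z \<in> cube n" for z
      using that S(1) by (auto simp: signs_def PiE_def Pi_def)
    then show "?r ` cube s \<subseteq> signs S" using G by blast
  qed (intro antisym le)
  then show "map_pmf (\<lambda>x. restrict x S) (map_pmf (kwise_gen n k) (pmf_of_set (cube (kwise_seed n k)))) = pmf_of_set (signs S)"
    by (simp add: map_pmf_comp s_def)
qed

lemma bitlen_le_ln: "n \<ge> 2 \<Longrightarrow> real (bitlen n) \<le> 3 * ln (real n)"
proof -
  assume n: "n \<ge> 2"
  then obtain b where b: "bitlen n = Suc b" using bitlen_pos[of n] gr0_implies_Suc by auto
  then have "2 ^ b \<le> n" using bitlen_le_iff[of n b] by simp
  then have "(2::real) ^ b \<le> real n" by (metis of_nat_le_iff of_nat_numeral of_nat_power)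
  then have "ln ((2::real) ^ b) \<le> ln (real n)" by (subst ln_le_cancel_iff) (use n in auto)
  then have 1: "real b * ln 2 \<le> ln (real n)" by (simp add: ln_realpow)
  have 2: "ln 2 \<le> ln (real n)" using n by simp
  have "real (bitlen n) * (2/3) \<le> real (bitlen n) * ln 2" using ln2_ge_two_thirds by (intro mult_left_mono) auto
  also have "\<dots> \<le> 2 * ln (real n)" using 1 2 by (simp add: b algebra_simps)
  finally show ?thesis by simp
qed

theorem explicit_kwise_construction_exists: "explicit_kwise_construction kwise_seed kwise_gen"
  unfolding explicit_kwise_construction_def
proof (intro conjI explicit_kwise_gen allI impI)
  fix n k :: nat assume "2 \<le> n"
  then show "kwise_independent n k (map_pmf (kwise_gen n k) (pmf_of_set (cube (kwise_seed n k))))"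
    by (intro kwise_independent_kwise_gen) simp
next
  have "real (kwise_seed n k) \<le> 6 * (real k * ln (real n))" if "2 \<le> n" for n k
  proof -
    have "real (kwise_seed n k) = real k * (2 * real (bitlen n))" by (simp add: kwise_seed_def)
    also have "\<dots> \<le> real k * (2 * (3 * ln (real n)))" using bitlen_le_ln[OF that] by (intro mult_left_mono) auto
    finally show ?thesis by (simp add: mult_ac)
  qed
  then show "\<exists>c. \<forall>n\<ge>2. \<forall>k\<ge>1. real (kwise_seed n k) \<le> c * (real k * ln (real n))" by blast
qed

theorem mainTheorem2:
  "\<exists>C>0.
     (\<exists>seed G. explicit_kwise_construction seed G) \<and>
     (\<forall>seed G. explicit_kwise_construction seed G \<longrightarrow>
        (\<exists>C'. \<forall>n\<ge>2. \<forall>\<epsilon>::real. 0 < \<epsilon> \<and> \<epsilon> \<le> 1/2 \<longrightarrow>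
           (let k = nat \<lceil>C * ((ln (1 / \<epsilon>))\<^sup>2 / \<epsilon>\<^sup>2)\<rceil> in
              fools_halfspaces n (seed n k) (G n k) \<epsilon> \<and>
              real (seed n k) \<le> C' * (ln (real n) * (ln (1 / \<epsilon>))\<^sup>2 / \<epsilon>\<^sup>2))))"
proof (rule exI[of _ "600 * 13\<^sup>2 * 2200\<^sup>2"], intro conjI allI impI)
  show "\<exists>seed G. explicit_kwise_construction seed G"
    using explicit_kwise_construction_exists by blast
qed (simp, erule explicit_kwise_construction_fools)

end
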